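(* Let $(M,\mu)$ be a symmetric space over $\mathbb{K}$. There exists a linear connection $L$ on $TM$ which is uniquely determined by one of the following two equivalent properties: (a) $L$ is invariant under all symmetries $\sigma_x$, $x\in M$. (b) For all $x\in M$, the symmetric space structure on $(TTM)_x$ is the canonical flat structure associated to the $\mathbb{K}$-module $((TTM)_x,L_x)$: for all $u,v\in(TTM)_x$, $TT\mu(u,v)=2u-v$. In particular, the fibers of $TTM$ over $M$ are abelian symmetric spaces. The torsion of $L$ vanishes.
   Context: $\mathbb{K}$ is a commutative unital Hausdorff topological ring with open dense unit group and continuous inversion; topological modules are Hausdorff. A map $f:V\supset U\to W$ ($U$ open, $V,W$ topological $\mathbb{K}$-modules) is $C^1$ if there is a continuous $f^{[1]}$ on $\{(x,v,t)\in U\times V\times\mathbb{K}:x+tv\in U\}$ with $f(x+tv)-f(x)=tf^{[1]}(x,v,t)$; $df(x)v=f^{[1]}(x,v,0)$; $C^{j+1}$ means $C^1$ with $f^{[1]}$ of class $C^j$; smooth means $C^j$ for all $j$. Manifolds and tangent bundles are defined by charts; $Tf(x,v)=(f(x),df(x)v)$. $(TTM)_x$ is the fiber of $TTM=T(TM)$ over $x\in M$; in a chart it is $V\times V\times V$. A symmetric space over $\mathbb{K}$ (where $2$ is assumed invertible in $\mathbb{K}$) is a smooth manifold $M$ with a smooth map $\mu:M\times M\to M$ such that, with $\sigma_x(y):=\mu(x,y)$, for all $x,y,z$: (M1) $\mu(x,x)=x$; (M2) $\sigma_x^2=\mathrm{id}_M$; (M3) $\mu(x,\mu(y,z))=\mu(\mu(x,y),\mu(x,z))$;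 (M4) $T_x(\sigma_x)=-\mathrm{id}_{T_xM}$. A reflection/symmetric space is abelian if the group generated by all $\sigma_x\circ\sigma_y$ is abelian. $(TM,T\mu)$ and $(TTM,TT\mu)$ are again symmetric spaces and $TT\mu$ restricts to the fibers $(TTM)_x$. A linear connection $L$ on $TM$ is a smooth family of $\mathbb{K}$-module structures $L_x$ on the fibers $(TTM)_x$ of $TTM\to M$ (smooth addition $TTM\times_MTTM\to TTM$ and scalar multiplication $\mathbb{K}\times TTM\to TTM$) such that in each chart $L_x$ is the push-forward of the chart's linear structure on $V\times V\times V$ under a map $(u,v,w)\mapsto(u,v,w+b_x(u,v))$ with $b_x:V\times V\to V$ bilinear. Its torsion in a chart is $b_x(u,v)-b_x(v,u)$. $L$ is invariant under a diffeomorphism $\phi$ of $M$ if $TT\phi:TTM\to TTM$ is fiberwise linear with respect to $L$. *)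

theory Defs
  imports "HOL-Analysis.Analysis" "HOL-Algebra.Module" "HOL-Algebra.Bij"
    "HOL-Algebra.Generated_Groups"
begin

section \<open>Base rings and topological modules\<close>

class dense_unit_ring =
  comm_ring_1 + t2_space + topological_ab_group_add + topological_semigroup_mult +
  assumes open_units: "open {u. u dvd 1}"
    and dense_units: "open U \<Longrightarrow> U \<noteq> {} \<Longrightarrow> \<exists>u\<in>U. u dvd 1"
    and continuous_unit_inverse: "u dvd 1 \<Longrightarrow>
      ((\<lambda>x. THE w. x * w = 1) \<longlongrightarrow> (THE w. u * w = 1)) (at u within {x. x dvd 1})"

locale topological_module = Modules.module smul
  for smul :: "'k::dense_unit_ring \<Rightarrow> 'v::{ab_group_add,t2_space} \<Rightarrow> 'v" +
  assumes continuous_add: "continuous_on UNIV (\<lambda>(x::'v, y). x + y)"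
    and continuous_scale: "continuous_on UNIV (\<lambda>(r, x). smul r x)"


section \<open>Differential calculus\<close>

text \<open>
  The definition of \<open>C\<^sup>k\<close> is recursive in the function \<open>f\<^sup>[\<^sup>1\<^sup>]\<close>, whose domain lies in
  \<open>V \<times> V \<times> K\<close>, so the type of the domain changes in every step. To have all the iterated
  domains in one type, \<open>V\<^sub>0 = V\<close>, \<open>V\<^sub>n\<^sub>+\<^sub>1 = V\<^sub>n \<times> V\<^sub>n \<times> K\<close> are realised as the sets \<open>jets n\<close>
  of perfect trees of depth \<open>n\<close>, where \<open>Node x v t\<close> plays the role of \<open>(x, v, t)\<close>.
\<close>

datatype ('v, 'k) jet = Base (base: 'v) | Node "('v, 'k) jet" "('v, 'k) jet" 'k

primrec jets :: "nat \<Rightarrow> ('v, 'k) jet set" where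
  "jets 0 = range Base"
| "jets (Suc n) = {Node x v t | x v t. x \<in> jets n \<and> v \<in> jets n}"

fun jet_add :: "('v::plus, 'k::plus) jet \<Rightarrow> ('v, 'k) jet \<Rightarrow> ('v, 'k) jet" where
  "jet_add (Base x) (Base y) = Base (x + y)"
| "jet_add (Node x v t) (Node y w s) = Node (jet_add x y) (jet_add v w) (t + s)"
| "jet_add _ _ = undefined" \<comment> \<open>trees of different shapes are never added\<close>

primrec jet_scale :: "('k::times \<Rightarrow> 'v \<Rightarrow> 'v) \<Rightarrow> 'k \<Rightarrow> ('v, 'k) jet \<Rightarrow> ('v, 'k) jet" where
  "jet_scale smul r (Base x) = Base (smul r x)"
| "jet_scale smul r (Node x v t) = Node (jet_scale smul r x) (jet_scale smul r v) (r * t)"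

text \<open>
  The topology: \<open>Base\<close> is an open embedding of \<open>V\<close> and \<open>(x, v, t) \<mapsto> Node x v t\<close> is an open
  embedding of the product, so each \<open>jets n\<close> carries the product topology of \<open>V\<^sub>n\<close>.
\<close>

inductive jet_basis :: "('v::topological_space, 'k::topological_space) jet set \<Rightarrow> bool" where
  "open U \<Longrightarrow> jet_basis (Base ` U)"
| "jet_basis A \<Longrightarrow> jet_basis B \<Longrightarrow> open T \<Longrightarrow> jet_basis ((\<lambda>(x, v, t). Node x v t) ` (A \<times> B \<times> T))"

instantiation jet :: (topological_space, topological_space) topological_space
begin

definition open_jet :: "('a, 'b) jet set \<Rightarrow> bool" where
  "open_jet = generate_topology (Collect jet_basis)"

instance
  by standard (auto simp: open_jet_def intro: generate_topology.intros)

end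

text \<open>
  For \<open>U \<subseteq> V\<^sub>n\<close>, \<open>quotient_domain smul n U\<close> is \<open>U\<^sup>[\<^sup>1\<^sup>] = {(x, v, t). x \<in> U, x + t v \<in> U}\<close>.
\<close>

definition quotient_domain ::
  "('k::dense_unit_ring \<Rightarrow> 'v::{ab_group_add,t2_space} \<Rightarrow> 'v) \<Rightarrow> nat \<Rightarrow>
    ('v, 'k) jet set \<Rightarrow> ('v, 'k) jet set" where
  "quotient_domain smul n U =
    {Node x v t | x v t. x \<in> U \<and> v \<in> jets n \<and> jet_add x (jet_scale smul t v) \<in> U}"

definition difference_quotient ::
  "('k::dense_unit_ring \<Rightarrow> 'v::{ab_group_add,t2_space} \<Rightarrow> 'v) \<Rightarrow>
   ('k \<Rightarrow> 'w::{ab_group_add,t2_space} \<Rightarrow> 'w) \<Rightarrow> nat \<Rightarrow> ('v, 'k) jet set \<Rightarrow>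
   (('v, 'k) jet \<Rightarrow> 'w) \<Rightarrow> (('v, 'k) jet \<Rightarrow> 'w) \<Rightarrow> bool" where
  "difference_quotient scaleV scaleW n U f f1 \<longleftrightarrow>
    continuous_on (quotient_domain scaleV n U) f1 \<and>
    (\<forall>x v t. Node x v t \<in> quotient_domain scaleV n U \<longrightarrow>
      f (jet_add x (jet_scale scaleV t v)) - f x = scaleW t (f1 (Node x v t)))"

primrec C_jet ::
  "('k::dense_unit_ring \<Rightarrow> 'v::{ab_group_add,t2_space} \<Rightarrow> 'v) \<Rightarrow>
   ('k \<Rightarrow> 'w::{ab_group_add,t2_space} \<Rightarrow> 'w) \<Rightarrow> nat \<Rightarrow> nat \<Rightarrow> ('v, 'k) jet set \<Rightarrow>
   (('v, 'k) jet \<Rightarrow> 'w) \<Rightarrow> bool" where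
  "C_jet scaleV scaleW 0 n U f \<longleftrightarrow> continuous_on U f"
| "C_jet scaleV scaleW (Suc j) n U f \<longleftrightarrow>
    (\<exists>f1. difference_quotient scaleV scaleW n U f f1 \<and>
      C_jet scaleV scaleW j (Suc n) (quotient_domain scaleV n U) f1)"

definition smooth_on ::
  "('k::dense_unit_ring \<Rightarrow> 'v::{ab_group_add,t2_space} \<Rightarrow> 'v) \<Rightarrow>
   ('k \<Rightarrow> 'w::{ab_group_add,t2_space} \<Rightarrow> 'w) \<Rightarrow> 'v set \<Rightarrow> ('v \<Rightarrow> 'w) \<Rightarrow> bool" where
  "smooth_on scaleV scaleW U f \<longleftrightarrow>
    open U \<and> (\<forall>j. C_jet scaleV scaleW j 0 (Base ` U) (f \<circ> base))"

text \<open>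
  \<open>df(x)v = f\<^sup>[\<^sup>1\<^sup>](x, v, 0)\<close>. For \<open>U\<close> open, \<open>f\<^sup>[\<^sup>1\<^sup>]\<close> is unique on \<open>U\<^sup>[\<^sup>1\<^sup>]\<close> because the units are
  dense and the modules are Hausdorff.
\<close>

definition differential ::
  "('k::dense_unit_ring \<Rightarrow> 'v::{ab_group_add,t2_space} \<Rightarrow> 'v) \<Rightarrow>
   ('k \<Rightarrow> 'w::{ab_group_add,t2_space} \<Rightarrow> 'w) \<Rightarrow> 'v set \<Rightarrow> ('v \<Rightarrow> 'w) \<Rightarrow> 'v \<Rightarrow> 'v \<Rightarrow> 'w" where
  "differential scaleV scaleW U f x v =
    (SOME f1. difference_quotient scaleV scaleW 0 (Base ` U) (f \<circ> base) f1)
      (Node (Base x) (Base v) 0)"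


section \<open>Manifolds\<close>

text \<open>
  A manifold is given by a topological space, the scalar multiplication of its model space, which
  is the type \<open>'v\<close>, and an atlas \<open>(chart i : cdom i \<rightarrow> 'v)\<close>, \<open>i \<in> index\<close>.
\<close>

record ('k, 'm, 'i, 'v) manifold =
  mtop :: "'m topology"
  smul :: "'k \<Rightarrow> 'v \<Rightarrow> 'v"
  index :: "'i set"
  cdom :: "'i \<Rightarrow> 'm set"
  chart :: "'i \<Rightarrow> 'm \<Rightarrow> 'v"

abbreviation points :: "('k, 'm, 'i, 'v) manifold \<Rightarrow> 'm set" where
  "points M \<equiv> topspace (mtop M)"

definition charts_at :: "('k, 'm, 'i, 'v) manifold \<Rightarrow> 'm \<Rightarrow> 'i set" where
  "charts_at M p = {i \<in> index M. p \<in> cdom M i}"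

definition local_dom ::
  "('k, 'm, 'i, 'v) manifold \<Rightarrow> ('k, 'n, 'j, 'w) manifold \<Rightarrow> ('m \<Rightarrow> 'n) \<Rightarrow> 'i \<Rightarrow> 'j \<Rightarrow> 'v set" where
  "local_dom M N f i j = chart M i ` (cdom M i \<inter> f -` cdom N j)"

definition local_rep ::
  "('k, 'm, 'i, 'v) manifold \<Rightarrow> ('k, 'n, 'j, 'w) manifold \<Rightarrow> ('m \<Rightarrow> 'n) \<Rightarrow> 'i \<Rightarrow> 'j \<Rightarrow> 'v \<Rightarrow> 'w" where
  "local_rep M N f i j = chart N j \<circ> f \<circ> inv_into (cdom M i) (chart M i)"

definition smooth_manifold ::
  "('k::dense_unit_ring, 'm, 'i, 'v::{ab_group_add,t2_space}) manifold \<Rightarrow> bool" where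
  "smooth_manifold M \<longleftrightarrow>
    topological_module (smul M) \<and>
    points M = (\<Union>i\<in>index M. cdom M i) \<and>
    (\<forall>i\<in>index M. openin (mtop M) (cdom M i) \<and> open (chart M i ` cdom M i) \<and>
      homeomorphic_map (subtopology (mtop M) (cdom M i))
        (top_of_set (chart M i ` cdom M i)) (chart M i)) \<and>
    (\<forall>i\<in>index M. \<forall>j\<in>index M.
      smooth_on (smul M) (smul M) (local_dom M M id i j) (local_rep M M id i j))"

definition smooth_map ::
  "('k::dense_unit_ring, 'm, 'i, 'v::{ab_group_add,t2_space}) manifold \<Rightarrow>
   ('k, 'n, 'j, 'w::{ab_group_add,t2_space}) manifold \<Rightarrow> ('m \<Rightarrow> 'n) \<Rightarrow> bool" where
  "smooth_map M N f \<longleftrightarrow>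
    continuous_map (mtop M) (mtop N) f \<and>
    (\<forall>i\<in>index M. \<forall>j\<in>index N.
      smooth_on (smul M) (smul N) (local_dom M N f i j) (local_rep M N f i j))"

definition prod_scale :: "('k \<Rightarrow> 'v \<Rightarrow> 'v) \<Rightarrow> ('k \<Rightarrow> 'w \<Rightarrow> 'w) \<Rightarrow> 'k \<Rightarrow> 'v \<times> 'w \<Rightarrow> 'v \<times> 'w" where
  "prod_scale s s' r = map_prod (s r) (s' r)"

definition prod_manifold ::
  "('k, 'm, 'i, 'v) manifold \<Rightarrow> ('k, 'n, 'j, 'w) manifold \<Rightarrow>
   ('k, 'm \<times> 'n, 'i \<times> 'j, 'v \<times> 'w) manifold" where
  "prod_manifold M N =
    \<lparr>mtop = prod_topology (mtop M) (mtop N),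
     smul = prod_scale (smul M) (smul N),
     index = index M \<times> index N,
     cdom = (\<lambda>(i, j). cdom M i \<times> cdom N j),
     chart = (\<lambda>(i, j). map_prod (chart M i) (chart N j))\<rparr>"

definition ring_manifold :: "('k::dense_unit_ring, 'k, unit, 'k) manifold" where
  "ring_manifold =
    \<lparr>mtop = euclidean, smul = (*), index = UNIV, cdom = (\<lambda>_. UNIV), chart = (\<lambda>_. id)\<rparr>"


section \<open>Tangent bundles\<close>

text \<open>
  A tangent vector at \<open>p\<close> is a family \<open>\<xi>\<close> of vectors, one for each chart at \<open>p\<close>, which transforms
  under the differentials of the transition maps.
\<close>

definition tangent_vectors ::
  "('k::dense_unit_ring, 'm, 'i, 'v::{ab_group_add,t2_space}) manifold \<Rightarrow> ('m \<times> ('i \<Rightarrow> 'v)) set" where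
  "tangent_vectors M = {(p, \<xi>). p \<in> points M \<and> \<xi> \<in> extensional (charts_at M p) \<and>
    (\<forall>i\<in>charts_at M p. \<forall>j\<in>charts_at M p.
      \<xi> j = differential (smul M) (smul M) (local_dom M M id i j) (local_rep M M id i j)
              (chart M i p) (\<xi> i))}"

definition tangent_cdom ::
  "('k::dense_unit_ring, 'm, 'i, 'v::{ab_group_add,t2_space}) manifold \<Rightarrow>
   'i \<Rightarrow> ('m \<times> ('i \<Rightarrow> 'v)) set" where
  "tangent_cdom M i = {(p, \<xi>) \<in> tangent_vectors M. p \<in> cdom M i}"

definition tangent_chart ::
  "('k, 'm, 'i, 'v) manifold \<Rightarrow> 'i \<Rightarrow> 'm \<times> ('i \<Rightarrow> 'v) \<Rightarrow> 'v \<times> 'v" where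
  "tangent_chart M i = (\<lambda>(p, \<xi>). (chart M i p, \<xi> i))"

definition tangent_bundle ::
  "('k::dense_unit_ring, 'm, 'i, 'v::{ab_group_add,t2_space}) manifold \<Rightarrow>
   ('k, 'm \<times> ('i \<Rightarrow> 'v), 'i, 'v \<times> 'v) manifold" where
  "tangent_bundle M =
    \<lparr>mtop = topology_generated_by
       {tangent_cdom M i \<inter> tangent_chart M i -` W | i W. i \<in> index M \<and> open W},
     smul = prod_scale (smul M) (smul M),
     index = index M,
     cdom = tangent_cdom M,
     chart = tangent_chart M\<rparr>"

text \<open>The value of \<open>tangent_map M N f (p, \<xi>)\<close> does not depend on the selected chart at \<open>p\<close>.\<close>

definition tangent_map ::
  "('k::dense_unit_ring, 'm, 'i, 'v::{ab_group_add,t2_space}) manifold \<Rightarrow>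
   ('k, 'n, 'j, 'w::{ab_group_add,t2_space}) manifold \<Rightarrow> ('m \<Rightarrow> 'n) \<Rightarrow>
   'm \<times> ('i \<Rightarrow> 'v) \<Rightarrow> 'n \<times> ('j \<Rightarrow> 'w)" where
  "tangent_map M N f = (\<lambda>(p, \<xi>).
    (f p,
     let i = (SOME i. i \<in> charts_at M p) in
       (\<lambda>j\<in>charts_at N (f p).
         differential (smul M) (smul N) (local_dom M N f i j) (local_rep M N f i j)
           (chart M i p) (\<xi> i))))"

definition tangent_uminus ::
  "('k, 'm, 'i, 'v::ab_group_add) manifold \<Rightarrow> 'm \<times> ('i \<Rightarrow> 'v) \<Rightarrow> 'm \<times> ('i \<Rightarrow> 'v)" where
  "tangent_uminus M = (\<lambda>(p, \<xi>). (p, \<lambda>i\<in>charts_at M p. - \<xi> i))"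

text \<open>The canonical identification of \<open>TM \<times> TN\<close> with \<open>T(M \<times> N)\<close>.\<close>

definition tangent_pair ::
  "('k, 'm, 'i, 'v) manifold \<Rightarrow> ('k, 'n, 'j, 'w) manifold \<Rightarrow>
   ('m \<times> ('i \<Rightarrow> 'v)) \<times> ('n \<times> ('j \<Rightarrow> 'w)) \<Rightarrow> ('m \<times> 'n) \<times> ('i \<times> 'j \<Rightarrow> 'v \<times> 'w)" where
  "tangent_pair M N = (\<lambda>((p, \<xi>), (q, \<eta>)).
    ((p, q), \<lambda>(i, j)\<in>charts_at M p \<times> charts_at N q. (\<xi> i, \<eta> j)))"

text \<open>For a product \<open>\<mu> : M \<times> M \<rightarrow> M\<close>, this is \<open>T\<mu>\<close>, viewed as a product \<open>TM \<times> TM \<rightarrow> TM\<close>.\<close>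

definition tangent_product ::
  "('k::dense_unit_ring, 'm, 'i, 'v::{ab_group_add,t2_space}) manifold \<Rightarrow> ('m \<times> 'm \<Rightarrow> 'm) \<Rightarrow>
   ('m \<times> ('i \<Rightarrow> 'v)) \<times> ('m \<times> ('i \<Rightarrow> 'v)) \<Rightarrow> 'm \<times> ('i \<Rightarrow> 'v)" where
  "tangent_product M \<mu> = tangent_map (prod_manifold M M) M \<mu> \<circ> tangent_pair M M"


section \<open>Symmetric spaces\<close>

definition symmetric_space ::
  "('k::dense_unit_ring, 'm, 'i, 'v::{ab_group_add,t2_space}) manifold \<Rightarrow> ('m \<times> 'm \<Rightarrow> 'm) \<Rightarrow> bool" where
  "symmetric_space M \<mu> \<longleftrightarrow>
    (2::'k) dvd 1 \<and>
    smooth_manifold M \<and>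
    smooth_map (prod_manifold M M) M \<mu> \<and>
    (\<forall>x\<in>points M. \<mu> (x, x) = x) \<and>
    (\<forall>x\<in>points M. \<forall>y\<in>points M. \<mu> (x, \<mu> (x, y)) = y) \<and>
    (\<forall>x\<in>points M. \<forall>y\<in>points M. \<forall>z\<in>points M.
      \<mu> (x, \<mu> (y, z)) = \<mu> (\<mu> (x, y), \<mu> (x, z))) \<and>
    (\<forall>x\<in>points M. \<forall>u\<in>tangent_vectors M. fst u = x \<longrightarrow>
      tangent_map M M (\<lambda>y. \<mu> (x, y)) u = tangent_uminus M u)"

text \<open>
  The symmetries are restricted to the carrier since the elements of \<open>BijGroup\<close> are extensional.
\<close>

definition symmetry :: "'m set \<Rightarrow> ('m \<times> 'm \<Rightarrow> 'm) \<Rightarrow> 'm \<Rightarrow> 'm \<Rightarrow> 'm" where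
  "symmetry X \<mu> x = (\<lambda>y\<in>X. \<mu> (x, y))"

definition abelian_reflection_space :: "'m set \<Rightarrow> ('m \<times> 'm \<Rightarrow> 'm) \<Rightarrow> bool" where
  "abelian_reflection_space X \<mu> \<longleftrightarrow>
    comm_group ((BijGroup X)\<lparr>carrier := generate (BijGroup X)
      {compose X (symmetry X \<mu> x) (symmetry X \<mu> y) | x y. x \<in> X \<and> y \<in> X}\<rparr>)"


section \<open>The second tangent bundle and its fibers over the base\<close>

type_synonym ('m, 'i, 'v) second_tangent = "('m \<times> ('i \<Rightarrow> 'v)) \<times> ('i \<Rightarrow> 'v \<times> 'v)"

definition TT ::
  "('k::dense_unit_ring, 'm, 'i, 'v::{ab_group_add,t2_space}) manifold \<Rightarrow>
   ('k, ('m, 'i, 'v) second_tangent, 'i, ('v \<times> 'v) \<times> ('v \<times> 'v)) manifold" where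
  "TT M = tangent_bundle (tangent_bundle M)"

definition TT_map ::
  "('k::dense_unit_ring, 'm, 'i, 'v::{ab_group_add,t2_space}) manifold \<Rightarrow> ('m \<Rightarrow> 'm) \<Rightarrow>
   ('m, 'i, 'v) second_tangent \<Rightarrow> ('m, 'i, 'v) second_tangent" where
  "TT_map M f = tangent_map (tangent_bundle M) (tangent_bundle M) (tangent_map M M f)"

definition TT_product ::
  "('k::dense_unit_ring, 'm, 'i, 'v::{ab_group_add,t2_space}) manifold \<Rightarrow> ('m \<times> 'm \<Rightarrow> 'm) \<Rightarrow>
   ('m, 'i, 'v) second_tangent \<times> ('m, 'i, 'v) second_tangent \<Rightarrow> ('m, 'i, 'v) second_tangent" where
  "TT_product M \<mu> = tangent_product (tangent_bundle M) (tangent_product M \<mu>)"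

definition foot :: "('m, 'i, 'v) second_tangent \<Rightarrow> 'm" where
  "foot z = fst (fst z)"

definition TT_fiber ::
  "('k::dense_unit_ring, 'm, 'i, 'v::{ab_group_add,t2_space}) manifold \<Rightarrow> 'm \<Rightarrow>
   ('m, 'i, 'v) second_tangent set" where
  "TT_fiber M p = {z \<in> points (TT M). foot z = p}"

text \<open>
  The chart \<open>i\<close> maps \<open>z \<in> TTM\<close> to \<open>((x, u), (v, w))\<close>, where \<open>x\<close> is the base point. On the fiber
  there remain the coordinates \<open>(u, v, w)\<close>.
\<close>

definition fiber_chart :: "'i \<Rightarrow> ('m, 'i, 'v) second_tangent \<Rightarrow> 'v \<times> 'v \<times> 'v" where
  "fiber_chart i = (\<lambda>((p, \<xi>), \<Xi>). (\<xi> i, \<Xi> i))"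

definition fiber_scale :: "('k, 'm, 'i, 'v) manifold \<Rightarrow> 'k \<Rightarrow> 'v \<times> 'v \<times> 'v \<Rightarrow> 'v \<times> 'v \<times> 'v" where
  "fiber_scale M = prod_scale (smul M) (prod_scale (smul M) (smul M))"

definition fiber_manifold ::
  "('k::dense_unit_ring, 'm, 'i, 'v::{ab_group_add,t2_space}) manifold \<Rightarrow> 'm \<Rightarrow>
   ('k, ('m, 'i, 'v) second_tangent, 'i, 'v \<times> 'v \<times> 'v) manifold" where
  "fiber_manifold M p =
    \<lparr>mtop = subtopology (mtop (TT M)) (TT_fiber M p),
     smul = fiber_scale M,
     index = charts_at M p,
     cdom = (\<lambda>_. TT_fiber M p),
     chart = fiber_chart\<rparr>"

text \<open>The fibered product of \<open>TTM\<close> with itself over \<open>M\<close>.\<close>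

definition fiber_product ::
  "('k::dense_unit_ring, 'm, 'i, 'v::{ab_group_add,t2_space}) manifold \<Rightarrow>
   ('k, ('m, 'i, 'v) second_tangent \<times> ('m, 'i, 'v) second_tangent, 'i,
    'v \<times> ('v \<times> 'v \<times> 'v) \<times> ('v \<times> 'v \<times> 'v)) manifold" where
  "fiber_product M =
    \<lparr>mtop = subtopology (prod_topology (mtop (TT M)) (mtop (TT M))) {(z, z'). foot z = foot z'},
     smul = prod_scale (smul M) (prod_scale (fiber_scale M) (fiber_scale M)),
     index = index M,
     cdom = (\<lambda>i. {(z, z'). z \<in> cdom (TT M) i \<and> z' \<in> cdom (TT M) i \<and> foot z = foot z'}),
     chart = (\<lambda>i (z, z'). (chart M i (foot z), fiber_chart i z, fiber_chart i z'))\<rparr>"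


section \<open>Linear connections\<close>

definition scalar_ring :: "('k::comm_ring_1) ring" where
  "scalar_ring = \<lparr>carrier = UNIV, monoid.mult = (*), one = 1, zero = 0, add = (+)\<rparr>"

definition linear_map ::
  "('k, 'a, 'c) module_scheme \<Rightarrow> ('k, 'b, 'd) module_scheme \<Rightarrow> ('a \<Rightarrow> 'b) \<Rightarrow> bool" where
  "linear_map A B f \<longleftrightarrow>
    f \<in> carrier A \<rightarrow> carrier B \<and>
    (\<forall>u\<in>carrier A. \<forall>v\<in>carrier A. f (u \<oplus>\<^bsub>A\<^esub> v) = f u \<oplus>\<^bsub>B\<^esub> f v) \<and>
    (\<forall>r. \<forall>u\<in>carrier A. f (r \<odot>\<^bsub>A\<^esub> u) = r \<odot>\<^bsub>B\<^esub> f u)"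

definition bilinear_map :: "('k::comm_ring_1 \<Rightarrow> 'v::ab_group_add \<Rightarrow> 'v) \<Rightarrow> ('v \<Rightarrow> 'v \<Rightarrow> 'v) \<Rightarrow> bool" where
  "bilinear_map s b \<longleftrightarrow>
    (\<forall>u. Modules.module_hom s s (b u)) \<and> (\<forall>v. Modules.module_hom s s (\<lambda>u. b u v))"

text \<open>
  A family of module structures on the fibers assigns to each \<open>p\<close> a record \<open>L p\<close>, of which only the
  fields \<open>carrier\<close>, \<open>add\<close>, \<open>zero\<close> and \<open>smult\<close> are relevant (the record type for modules also has
  unused multiplicative fields). In the chart \<open>i\<close>, the structure \<open>L p\<close> is the push-forward of
  the linear structure of \<open>V \<times> V \<times> V\<close> under \<open>(u, v, w) \<mapsto> (u, v, w + b u v)\<close>: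
\<close>

definition connection_form ::
  "('k::dense_unit_ring, 'm, 'i, 'v::{ab_group_add,t2_space}) manifold \<Rightarrow>
   ('m \<Rightarrow> ('k, ('m, 'i, 'v) second_tangent) module) \<Rightarrow> 'i \<Rightarrow> 'm \<Rightarrow> ('v \<Rightarrow> 'v \<Rightarrow> 'v) \<Rightarrow> bool" where
  "connection_form M L i p b \<longleftrightarrow>
    bilinear_map (smul M) b \<and>
    (let \<Psi> = (\<lambda>(u, v, w). inv_into (TT_fiber M p) (fiber_chart i) (u, v, w + b u v)) in
      (\<forall>z z'. \<Psi> (z + z') = \<Psi> z \<oplus>\<^bsub>L p\<^esub> \<Psi> z') \<and>
      (\<forall>r z. \<Psi> (fiber_scale M r z) = r \<odot>\<^bsub>L p\<^esub> \<Psi> z))"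

definition linear_connection ::
  "('k::dense_unit_ring, 'm, 'i, 'v::{ab_group_add,t2_space}) manifold \<Rightarrow>
   ('m \<Rightarrow> ('k, ('m, 'i, 'v) second_tangent) module) \<Rightarrow> bool" where
  "linear_connection M L \<longleftrightarrow>
    (\<forall>p\<in>points M. carrier (L p) = TT_fiber M p \<and> Module.module scalar_ring (L p)) \<and>
    smooth_map (fiber_product M) (TT M) (\<lambda>(z, z'). z \<oplus>\<^bsub>L (foot z)\<^esub> z') \<and>
    smooth_map (prod_manifold ring_manifold (TT M)) (TT M) (\<lambda>(r, z). r \<odot>\<^bsub>L (foot z)\<^esub> z) \<and>
    (\<forall>i\<in>index M. \<forall>p\<in>cdom M i. \<exists>b. connection_form M L i p b)"

definition same_connection ::
  "('k::dense_unit_ring, 'm, 'i, 'v::{ab_group_add,t2_space}) manifold \<Rightarrow>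
   ('m \<Rightarrow> ('k, ('m, 'i, 'v) second_tangent) module) \<Rightarrow>
   ('m \<Rightarrow> ('k, ('m, 'i, 'v) second_tangent) module) \<Rightarrow> bool" where
  "same_connection M L L' \<longleftrightarrow>
    (\<forall>p\<in>points M. \<forall>u\<in>TT_fiber M p.
      (\<forall>v\<in>TT_fiber M p. u \<oplus>\<^bsub>L p\<^esub> v = u \<oplus>\<^bsub>L' p\<^esub> v) \<and> (\<forall>r. r \<odot>\<^bsub>L p\<^esub> u = r \<odot>\<^bsub>L' p\<^esub> u))"

text \<open>The form \<open>b\<close> is uniquely determined by the connection, the chart and the point.\<close>

definition torsion ::
  "('k::dense_unit_ring, 'm, 'i, 'v::{ab_group_add,t2_space}) manifold \<Rightarrow>
   ('m \<Rightarrow> ('k, ('m, 'i, 'v) second_tangent) module) \<Rightarrow> 'i \<Rightarrow> 'm \<Rightarrow> 'v \<Rightarrow> 'v \<Rightarrow> 'v" where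
  "torsion M L i p u v = (let b = (THE b. connection_form M L i p b) in b u v - b v u)"

definition invariant_connection ::
  "('k::dense_unit_ring, 'm, 'i, 'v::{ab_group_add,t2_space}) manifold \<Rightarrow>
   ('m \<Rightarrow> ('k, ('m, 'i, 'v) second_tangent) module) \<Rightarrow> ('m \<Rightarrow> 'm) \<Rightarrow> bool" where
  "invariant_connection M L \<phi> \<longleftrightarrow> (\<forall>p\<in>points M. linear_map (L p) (L (\<phi> p)) (TT_map M \<phi>))"

definition invariant_under_symmetries ::
  "('k::dense_unit_ring, 'm, 'i, 'v::{ab_group_add,t2_space}) manifold \<Rightarrow> ('m \<times> 'm \<Rightarrow> 'm) \<Rightarrow>
   ('m \<Rightarrow> ('k, ('m, 'i, 'v) second_tangent) module) \<Rightarrow> bool" where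
  "invariant_under_symmetries M \<mu> L \<longleftrightarrow>
    (\<forall>x\<in>points M. invariant_connection M L (\<lambda>y. \<mu> (x, y)))"

definition flat_on_fibers ::
  "('k::dense_unit_ring, 'm, 'i, 'v::{ab_group_add,t2_space}) manifold \<Rightarrow> ('m \<times> 'm \<Rightarrow> 'm) \<Rightarrow>
   ('m \<Rightarrow> ('k, ('m, 'i, 'v) second_tangent) module) \<Rightarrow> bool" where
  "flat_on_fibers M \<mu> L \<longleftrightarrow>
    (\<forall>x\<in>points M. \<forall>u\<in>TT_fiber M x. \<forall>v\<in>TT_fiber M x.
      TT_product M \<mu> (u, v) = (2 \<odot>\<^bsub>L x\<^esub> u) \<ominus>\<^bsub>L x\<^esub> v)"

end

theory Submission
  imports Defs
begin

text \<open>
  Write the product \<open>\<mu>\<close> in a chart around \<open>p\<close> and let \<open>A\<close> be the second differential at \<open>p\<close> of the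
  symmetry \<open>\<sigma>\<^sub>p\<close>. The fiber of \<open>TTM\<close> over \<open>p\<close> has the coordinates \<open>(u, v, w)\<close>, and the only second
  order term in \<open>TT\<mu>\<close> on this fiber is the second differential of \<open>\<mu>\<close> at \<open>(p, p)\<close>. Differentiating
  \<open>\<mu>(x, x) = x\<close>, \<open>\<mu>(x, \<mu>(x, y)) = y\<close> and using \<open>T\<^sub>p\<sigma>\<^sub>p = -1\<close> as well as the invertibility of \<open>2\<close>, this
  second differential turns out to be \<open>A(u - u', v - v')\<close> (\<open>\<mu>_second_order\<close>). Hence
  \<open>TT\<mu>((u, v, w), (u', v', w')) = (2u - u', 2v - v', 2w - w' + A(u - u', v - v'))\<close>.

  A connection with the form \<open>b\<close> has the linear coordinates \<open>(u, v, w - b(u, v))\<close>. In these, the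
  product above is \<open>2z - z'\<close> precisely for \<open>b = A/2\<close>. Likewise \<open>TT\<sigma>\<^sub>p\<close>, which is
  \<open>(u, v, w) \<mapsto> (-u, -v, A(u, v) - w)\<close> on the fiber over its fixed point, is additive only for
  \<open>b = A/2\<close>. So both properties of the theorem force the same form in every chart, which is
  uniqueness and one half of the equivalence (\<open>flat_imp_canonical_forms\<close>,
  \<open>invariant_imp_canonical_forms\<close>). Conversely, let \<open>f\<close> be smooth with
  \<open>f \<circ> \<sigma>\<^sub>p = \<sigma>\<^bsub>f(p)\<^esub> \<circ> f\<close>. Comparing the second differentials of both sides at \<open>p\<close> shows
  that the second order part of \<open>f\<close> is exactly the defect between \<open>A/2\<close> at \<open>p\<close> and at \<open>f(p)\<close>, that is, \<open>TTf\<close> is linear in the coordinates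
  \<open>(u, v, w - A(u, v)/2)\<close> (\<open>straight_homomorphism\<close>). With \<open>f\<close> the identity in two charts, the forms
  \<open>A/2\<close> fit together to one connection; with \<open>f = \<sigma>\<^sub>x\<close>, this connection is invariant. Its torsion
  vanishes because second differentials are symmetric.

  Over a ring with non-units, the usual limit \<open>t \<rightarrow> 0\<close> with \<open>t \<noteq> 0\<close> is replaced by the density of the
  units: continuous functions that agree for all invertible \<open>t\<close> agree at \<open>t = 0\<close>. This yields
  linearity of differentials, the chain rule and Schwarz's theorem. The iterated difference quotients
  \<open>f\<^sup>[\<^sup>1\<^sup>]\<close>, \<open>f\<^sup>[\<^sup>2\<^sup>]\<close>, \<open>\<dots>\<close> enter only through closure properties of smooth maps: under composition,
  pairing, sums, products with scalars, and passage to the difference quotient.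
\<close>

section \<open>The topology of jets\<close>

lemma Node_in_image_iff [simp]:
  "Node x v t \<in> (\<lambda>(x, v, t). Node x v t) ` S \<longleftrightarrow> (x, v, t) \<in> S"
  by (force simp: image_iff)

text \<open>
  The boxes in the definition of the topology are closed under intersection, so that they form a base
  and not merely a subbase. Therefore \<open>Base\<close> and \<open>Node\<close> are open embeddings.
\<close>

lemma jet_basis_Int:
  assumes "jet_basis A" "jet_basis B"
  shows "jet_basis (A \<inter> B)"
  using assms
proof (induction A arbitrary: B rule: jet_basis.induct)
  case (1 U)
  from 1(2) show ?case
  proof cases
    case (1 U')
    have "Base ` U \<inter> B = Base ` (U \<inter> U')" using 1 by auto
    then show ?thesis using 1 \<open>open U\<close> by (auto intro: jet_basis.intros)
  next
    case (2 A' B' T')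
    have "Base ` U \<inter> B = Base ` {}" using 2 by auto
    then show ?thesis by (metis jet_basis.intros(1) open_empty)
  qed
next
  case (2 A1 B1 T1)
  from 2(6) show ?case
  proof cases
    case (1 U')
    have "(\<lambda>(x, v, t). Node x v t) ` (A1 \<times> B1 \<times> T1) \<inter> B = Base ` {}" using 1 by auto
    then show ?thesis by (metis jet_basis.intros(1) open_empty)
  next
    case (2 A' B' T')
    have "(\<lambda>(x, v, t). Node x v t) ` (A1 \<times> B1 \<times> T1) \<inter> B
      = (\<lambda>(x, v, t). Node x v t) ` ((A1 \<inter> A') \<times> (B1 \<inter> B') \<times> (T1 \<inter> T'))"
      using 2 by auto
    moreover have "jet_basis (A1 \<inter> A')" "jet_basis (B1 \<inter> B')"
      using "2.IH" 2 by auto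
    ultimately show ?thesis
      using 2 \<open>open T1\<close> by (simp add: jet_basis.intros(2) open_Int)
  qed
qed

lemma jet_basis_open: "jet_basis A \<Longrightarrow> open A"
  unfolding open_jet_def by (rule generate_topology.Basis) simp

lemma jet_basis_cover: "\<exists>A. jet_basis A \<and> z \<in> A"
proof (induction z)
  case (Base x)
  then show ?case using jet_basis.intros(1)[of UNIV] by auto
next
  case (Node z1 z2 t)
  then obtain A B where "jet_basis A" "z1 \<in> A" "jet_basis B" "z2 \<in> B" by auto
  then show ?case using jet_basis.intros(2)[of A B UNIV]
    by (intro exI[of _ "(\<lambda>(x, v, t). Node x v t) ` (A \<times> B \<times> UNIV)"]) auto
qed

lemma open_jet_basisE:
  assumes "open S" "z \<in> S"
  obtains A where "jet_basis A" "z \<in> A" "A \<subseteq> S"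
proof -
  have "generate_topology (Collect jet_basis) S" using assms(1) by (simp add: open_jet_def)
  then have "\<forall>z\<in>S. \<exists>A. jet_basis A \<and> z \<in> A \<and> A \<subseteq> S"
  proof induction
    case UNIV
    then show ?case using jet_basis_cover by auto
  next
    case (Int a b)
    show ?case
    proof
      fix z assume "z \<in> a \<inter> b"
      then obtain A B where "jet_basis A" "z \<in> A" "A \<subseteq> a" "jet_basis B" "z \<in> B" "B \<subseteq> b"
        using Int by (meson IntD1 IntD2)
      then show "\<exists>A. jet_basis A \<and> z \<in> A \<and> A \<subseteq> a \<inter> b"
        by (intro exI[of _ "A \<inter> B"]) (auto intro: jet_basis_Int)
    qed
  next
    case (UN K)
    then show ?case by (metis Union_iff Union_upper order_trans)
  next
    case (Basis s)
    then show ?case by auto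
  qed
  then show ?thesis using assms(2) that by blast
qed

lemma open_Base: "open U \<Longrightarrow> open (Base ` U)"
  by (rule jet_basis_open) (rule jet_basis.intros)

lemma open_Node:
  assumes "open A" "open B" "open T"
  shows "open ((\<lambda>(x, v, t). Node x v t) ` (A \<times> B \<times> T))"
proof (subst open_subopen, safe)
  fix x v t assume *: "x \<in> A" "v \<in> B" "t \<in> T"
  obtain A' where A': "jet_basis A'" "x \<in> A'" "A' \<subseteq> A" using assms * open_jet_basisE by blast
  obtain B' where B': "jet_basis B'" "v \<in> B'" "B' \<subseteq> B" using assms * open_jet_basisE by blast
  show "\<exists>S. open S \<and> Node x v t \<in> S \<and> S \<subseteq> (\<lambda>(x, v, t). Node x v t) ` (A \<times> B \<times> T)"
    using A' B' * assms(3)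
    by (intro exI[of _ "(\<lambda>(x, v, t). Node x v t) ` (A' \<times> B' \<times> T)"] conjI jet_basis_open jet_basis.intros)
      auto
qed

primrec node_point :: "('v, 'k) jet \<Rightarrow> ('v, 'k) jet" where
  "node_point (Base x) = Base x"
| "node_point (Node x v t) = x"

primrec node_direction :: "('v, 'k) jet \<Rightarrow> ('v, 'k) jet" where
  "node_direction (Base x) = Base x"
| "node_direction (Node x v t) = v"

primrec node_scalar :: "('v, 'k) jet \<Rightarrow> 'k" where
  "node_scalar (Base x) = undefined"
| "node_scalar (Node x v t) = t"

lemma continuous_on_open_vimageI:
  assumes "\<And>B x. open B \<Longrightarrow> x \<in> S \<Longrightarrow> f x \<in> B \<Longrightarrow> \<exists>A. open A \<and> x \<in> A \<and> A \<inter> S \<subseteq> f -` B"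
  shows "continuous_on S f"
  unfolding continuous_on_topological
  using assms by (meson IntI subsetD vimageD)

lemma continuous_on_Base [continuous_intros]:
  assumes "continuous_on S f"
  shows "continuous_on S (\<lambda>x. Base (f x) :: ('v::topological_space, 'k::topological_space) jet)"
proof -
  have "continuous_on UNIV (Base :: 'v \<Rightarrow> ('v, 'k) jet)"
  proof (rule continuous_on_open_vimageI)
    fix B :: "('v, 'k) jet set" and x assume "open B" "Base x \<in> B"
    then obtain A where A: "jet_basis A" "Base x \<in> A" "A \<subseteq> B" by (rule open_jet_basisE)
    from A(1) obtain U where "open U" "A = Base ` U" by cases (use A in auto)
    then show "\<exists>A. open A \<and> x \<in> A \<and> A \<inter> UNIV \<subseteq> Base -` B" using A by blast
  qed
  then show ?thesis using assms by (rule continuous_on_compose2) simp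
qed

lemma continuous_on_base: "continuous_on (range Base) base"
proof (rule continuous_on_open_vimageI)
  fix B :: "'a set" and z :: "('a, 'b) jet" assume "open B" "z \<in> range Base" "base z \<in> B"
  then show "\<exists>A. open A \<and> z \<in> A \<and> A \<inter> range Base \<subseteq> base -` B"
    by (intro exI[of _ "Base ` B"]) (auto intro: open_Base)
qed

lemma continuous_on_Node [continuous_intros]:
  fixes f g :: "'x::topological_space \<Rightarrow> ('v::topological_space, 'k::topological_space) jet"
  assumes "continuous_on S f" "continuous_on S g" "continuous_on S h"
  shows "continuous_on S (\<lambda>x. Node (f x) (g x) (h x))"
proof -
  have "continuous_on UNIV (\<lambda>(x, v, t). Node x v t :: ('v, 'k) jet)"
  proof (rule continuous_on_open_vimageI, safe)
    fix B :: "('v, 'k) jet set" and x v t assume "open B" "Node x v t \<in> B"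
    then obtain A where A: "jet_basis A" "Node x v t \<in> A" "A \<subseteq> B" by (rule open_jet_basisE)
    from A(1) obtain A1 A2 T where "jet_basis A1" "jet_basis A2" "open T"
      "A = (\<lambda>(x, v, t). Node x v t) ` (A1 \<times> A2 \<times> T)" by cases (use A in auto)
    moreover from this have "Node x' v' t' \<in> B" if "x' \<in> A1" "v' \<in> A2" "t' \<in> T" for x' v' t'
      using A(3) that by auto
    ultimately show "\<exists>A. open A \<and> (x, v, t) \<in> A \<and> A \<inter> UNIV \<subseteq> (\<lambda>(x, v, t). Node x v t) -` B"
      using A by (intro exI[of _ "A1 \<times> A2 \<times> T"]) (auto intro!: open_Times jet_basis_open)
  qed
  moreover have "continuous_on S (\<lambda>x. (f x, g x, h x))" using assms by (intro continuous_intros)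
  ultimately show ?thesis
    using continuous_on_compose2[of UNIV "\<lambda>(x, v, t). Node x v t" S "\<lambda>x. (f x, g x, h x)"] by simp
qed

lemma jets_Suc: "z \<in> jets (Suc n) \<longleftrightarrow> (\<exists>x v t. z = Node x v t \<and> x \<in> jets n \<and> v \<in> jets n)"
  by auto

lemma continuous_on_node_point: "continuous_on (jets (Suc n)) node_point"
proof (rule continuous_on_open_vimageI)
  fix B :: "('a, 'b) jet set" and z assume "open B" "z \<in> jets (Suc n)" "node_point z \<in> B"
  then show "\<exists>A. open A \<and> z \<in> A \<and> A \<inter> jets (Suc n) \<subseteq> node_point -` B"
    by (intro exI[of _ "(\<lambda>(x, v, t). Node x v t) ` (B \<times> UNIV \<times> UNIV)"] conjI open_Node) auto
qed

lemma continuous_on_node_direction: "continuous_on (jets (Suc n)) node_direction"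
proof (rule continuous_on_open_vimageI)
  fix B :: "('a, 'b) jet set" and z assume "open B" "z \<in> jets (Suc n)" "node_direction z \<in> B"
  then show "\<exists>A. open A \<and> z \<in> A \<and> A \<inter> jets (Suc n) \<subseteq> node_direction -` B"
    by (intro exI[of _ "(\<lambda>(x, v, t). Node x v t) ` (UNIV \<times> B \<times> UNIV)"] conjI open_Node) auto
qed

lemma continuous_on_node_scalar: "continuous_on (jets (Suc n)) node_scalar"
proof (rule continuous_on_open_vimageI)
  fix B :: "'b set" and z :: "('a, 'b) jet"
  assume "open B" "z \<in> jets (Suc n)" "node_scalar z \<in> B"
  then show "\<exists>A. open A \<and> z \<in> A \<and> A \<inter> jets (Suc n) \<subseteq> node_scalar -` B"
    by (intro exI[of _ "(\<lambda>(x, v, t). Node x v t) ` (UNIV \<times> UNIV \<times> B)"] conjI open_Node) auto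
qed

lemma continuous_on_jet_components:
  assumes "continuous_on S F" "F ` S \<subseteq> jets (Suc n)"
  shows "continuous_on S (\<lambda>x. node_point (F x))" "continuous_on S (\<lambda>x. node_direction (F x))"
    "continuous_on S (\<lambda>x. node_scalar (F x))"
  using continuous_on_compose2[OF continuous_on_node_point assms]
    continuous_on_compose2[OF continuous_on_node_direction assms]
    continuous_on_compose2[OF continuous_on_node_scalar assms] by auto

section \<open>Topological modules\<close>

lemma topological_module_ring: "topological_module ((*) :: 'k::dense_unit_ring \<Rightarrow> 'k \<Rightarrow> 'k)"
proof unfold_locales
  show "continuous_on UNIV (\<lambda>(x::'k, y). x + y)"
    unfolding case_prod_beta by (intro continuous_intros)
  show "continuous_on UNIV (\<lambda>(x::'k, y). x * y)"
    unfolding case_prod_beta by (intro continuous_intros)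
qed (auto simp: algebra_simps)

context topological_module
begin

lemma cont_add:
  fixes f g :: "'x::topological_space \<Rightarrow> 'v"
  assumes "continuous_on S f" "continuous_on S g"
  shows "continuous_on S (\<lambda>x. f x + g x)"
  using continuous_on_compose2[OF continuous_add continuous_on_Pair[OF assms]] by simp

lemma cont_scale:
  assumes "continuous_on S f" "continuous_on S g"
  shows "continuous_on S (\<lambda>x. smul (f x) (g x))"
  using continuous_on_compose2[OF continuous_scale continuous_on_Pair[OF assms]] by simp

lemma unit_cancel:
  assumes "t dvd 1" "smul t x = smul t y"
  shows "x = y"
proof -
  obtain w where "1 = t * w" using assms(1) by auto
  then have "w * t = 1" by (simp add: mult.commute)
  then show ?thesis using arg_cong[OF assms(2), of "smul w"] by simp
qed

end

lemma topological_module_prod: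
  assumes "topological_module s" "topological_module s'"
  shows "topological_module (prod_scale s s')"
proof -
  interpret A: topological_module s by fact
  interpret B: topological_module s' by fact
  show ?thesis
  proof unfold_locales
    have "continuous_on UNIV (\<lambda>p :: ('b \<times> 'c) \<times> ('b \<times> 'c). (fst (fst p) + fst (snd p), snd (fst p) + snd (snd p)))"
      by (intro continuous_on_Pair A.cont_add B.cont_add continuous_on_fst continuous_on_snd continuous_on_id)
    then show "continuous_on UNIV (\<lambda>(x::'b \<times> 'c, y). x + y)"
      by (simp add: case_prod_beta plus_prod_def)
    have "continuous_on UNIV (\<lambda>p. (s (fst p) (fst (snd p)), s' (fst p) (snd (snd p))))"
      by (intro continuous_on_Pair A.cont_scale B.cont_scale continuous_on_fst continuous_on_snd continuous_on_id)
    then show "continuous_on UNIV (\<lambda>(r, x). prod_scale s s' r x)"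
      by (simp add: case_prod_beta prod_scale_def map_prod_def)
  qed (auto simp: prod_scale_def A.scale_right_distrib A.scale_left_distrib
      B.scale_right_distrib B.scale_left_distrib)
qed

section \<open>The module operations on jets\<close>

context topological_module
begin

lemma jet_add_closed: "x \<in> jets n \<Longrightarrow> y \<in> jets n \<Longrightarrow> jet_add x y \<in> jets n"
  by (induction n arbitrary: x y) auto

lemma jet_scale_closed: "x \<in> jets n \<Longrightarrow> jet_scale smul r x \<in> jets n"
  by (induction n arbitrary: x) auto

lemma cont_jet_add:
  fixes f g :: "'x::topological_space \<Rightarrow> ('v, 'k) jet"
  assumes "continuous_on S f" "continuous_on S g" "f ` S \<subseteq> jets n" "g ` S \<subseteq> jets n"
  shows "continuous_on S (\<lambda>x. jet_add (f x) (g x))"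
  using assms
proof (induction n arbitrary: f g)
  case 0
  have "continuous_on S (\<lambda>x. Base (base (f x) + base (g x)))"
    using 0 by (intro continuous_on_Base cont_add continuous_on_compose2[OF continuous_on_base]) auto
  then show ?case
    by (rule continuous_on_eq) (use 0 in \<open>fastforce simp: image_subset_iff\<close>)
next
  case (Suc n)
  have f: "node_point (f x) \<in> jets n" "node_direction (f x) \<in> jets n"
    "node_point (g x) \<in> jets n" "node_direction (g x) \<in> jets n" if "x \<in> S" for x
    using Suc.prems(3,4) that by (force simp: image_subset_iff)+
  have "continuous_on S (\<lambda>x. Node (jet_add (node_point (f x)) (node_point (g x)))
      (jet_add (node_direction (f x)) (node_direction (g x))) (node_scalar (f x) + node_scalar (g x)))"
    using f by (intro continuous_on_Node Suc.IH continuous_on_add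
      continuous_on_jet_components[OF Suc.prems(1,3)] continuous_on_jet_components[OF Suc.prems(2,4)]) auto
  then show ?case
    by (rule continuous_on_eq) (use Suc.prems(3,4) in \<open>fastforce simp: image_subset_iff\<close>)
qed

lemma jet_add_diff:
  "x \<in> jets n \<Longrightarrow> y \<in> jets n \<Longrightarrow>
    jet_add x (jet_scale smul 1 (jet_add y (jet_scale smul (-1) x))) = y"
  by (induction n arbitrary: x y) auto

end


section \<open>Maps of class \<open>C\<^sup>k\<close> on jets\<close>

lemma quotient_domain_iff [simp]:
  "Node x v t \<in> quotient_domain s n U \<longleftrightarrow>
    x \<in> U \<and> v \<in> jets n \<and> jet_add x (jet_scale s t v) \<in> U"
  by (auto simp: quotient_domain_def)

lemma quotient_domainE:
  assumes "z \<in> quotient_domain s n U"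
  obtains x v t where "z = Node x v t" "x \<in> U" "v \<in> jets n" "jet_add x (jet_scale s t v) \<in> U"
  using assms by (auto simp: quotient_domain_def)

lemma quotient_domain_subset_jets: "U \<subseteq> jets n \<Longrightarrow> quotient_domain s n U \<subseteq> jets (Suc n)"
  by (auto simp: quotient_domain_def)

lemma quotient_domain_mono: "U' \<subseteq> U \<Longrightarrow> quotient_domain s n U' \<subseteq> quotient_domain s n U"
  by (auto simp: quotient_domain_def)

lemma C_jet_cong:
  assumes "C_jet s s' j n U f" "\<And>x. x \<in> U \<Longrightarrow> f x = g x"
  shows "C_jet s s' j n U g"
proof (cases j)
  case 0
  then show ?thesis using assms by (simp cong: continuous_on_cong)
next
  case (Suc i)
  then obtain f1 where f1: "difference_quotient s s' n U f f1" "C_jet s s' i (Suc n) (quotient_domain s n U) f1"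
    using assms(1) by auto
  then have "difference_quotient s s' n U g f1"
    using assms(2) by (simp add: difference_quotient_def)
  then show ?thesis using f1 Suc by auto
qed

lemma C_jet_subset:
  assumes "C_jet s s' j n U f" "U' \<subseteq> U"
  shows "C_jet s s' j n U' f"
  using assms
proof (induction j arbitrary: n U U' f)
  case 0
  then show ?case by (auto intro: continuous_on_subset)
next
  case (Suc j)
  then obtain f1 where f1: "difference_quotient s s' n U f f1" "C_jet s s' j (Suc n) (quotient_domain s n U) f1"
    by auto
  have "difference_quotient s s' n U' f f1"
    using f1(1) quotient_domain_mono[OF Suc.prems(2)] unfolding difference_quotient_def
    by (meson continuous_on_subset subsetD)
  then show ?case using Suc.IH[OF f1(2) quotient_domain_mono[OF Suc.prems(2)]] by auto
qed

text \<open>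
  The value \<open>f y\<close> is \<open>f x + f\<^sup>[\<^sup>1\<^sup>](x, y - x, 1)\<close>, for one fixed point \<open>x\<close>. Hence a map with a
  continuous difference quotient is continuous.
\<close>

lemma difference_quotient_continuous:
  assumes s: "topological_module s" and s': "topological_module s'"
    and U: "U \<subseteq> jets n" and f: "difference_quotient s s' n U f f1"
  shows "continuous_on U f"
proof (cases "U = {}")
  case False
  interpret V: topological_module s by fact
  interpret W: topological_module s' by fact
  obtain x where x: "x \<in> U" using False by auto
  let ?N = "\<lambda>y. Node x (jet_add y (jet_scale s (-1) x)) 1"
  have in_U: "jet_add x (jet_scale s 1 (jet_add y (jet_scale s (-1) x))) = y" if "y \<in> U" for y
    using V.jet_add_diff[of x n y] that U x by auto
  have N: "?N y \<in> quotient_domain s n U" if "y \<in> U" for y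
    using in_U[OF that] that x U by (auto intro!: V.jet_add_closed V.jet_scale_closed)
  have "continuous_on U ?N"
    using U x by (intro continuous_on_Node continuous_on_const V.cont_jet_add[where n = n] continuous_on_id)
      (auto intro!: V.jet_scale_closed)
  then have "continuous_on U (\<lambda>y. f x + f1 (?N y))"
    using f N by (intro W.cont_add continuous_on_const continuous_on_compose2[where g = f1 and f = ?N])
      (auto simp: difference_quotient_def)
  moreover have "f x + f1 (?N y) = f y" if "y \<in> U" for y
  proof -
    have "f y - f x = s' 1 (f1 (?N y))"
      using f N[OF that] in_U[OF that] unfolding difference_quotient_def by metis
    then show ?thesis by (simp add: algebra_simps)
  qed
  ultimately show ?thesis by (rule continuous_on_eq)
qed simp

lemma C_jet_continuous:
  assumes "topological_module s" "topological_module s'" "U \<subseteq> jets n" "C_jet s s' j n U f"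
  shows "continuous_on U f"
  using assms difference_quotient_continuous by (cases j) auto

lemma C_jet_SucD:
  assumes "topological_module s" "topological_module s'" "U \<subseteq> jets n" "C_jet s s' (Suc j) n U f"
  shows "C_jet s s' j n U f"
  using assms(3,4)
proof (induction j arbitrary: n U f)
  case 0
  then show ?case using difference_quotient_continuous[OF assms(1,2)] by auto
next
  case (Suc j)
  then obtain f1 where f1: "difference_quotient s s' n U f f1"
      "C_jet s s' (Suc j) (Suc n) (quotient_domain s n U) f1"
    by (auto simp del: C_jet.simps(2) simp: C_jet.simps(2)[of _ _ "Suc j"])
  then have "C_jet s s' j (Suc n) (quotient_domain s n U) f1"
    using Suc.IH quotient_domain_subset_jets[OF Suc.prems(1)] by blast
  then show ?case using f1(1) by auto
qed

definition jet_linear ::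
  "('k::dense_unit_ring \<Rightarrow> 'v::{ab_group_add,t2_space} \<Rightarrow> 'v) \<Rightarrow>
   ('k \<Rightarrow> 'w::{ab_group_add,t2_space} \<Rightarrow> 'w) \<Rightarrow> nat \<Rightarrow> nat \<Rightarrow> (('v, 'k) jet \<Rightarrow> ('w, 'k) jet) \<Rightarrow> bool" where
  "jet_linear s s' n m \<rho> \<longleftrightarrow> \<rho> ` jets n \<subseteq> jets m \<and> continuous_on (jets n) \<rho> \<and>
    (\<forall>x\<in>jets n. \<forall>y\<in>jets n. \<rho> (jet_add x y) = jet_add (\<rho> x) (\<rho> y)) \<and>
    (\<forall>r. \<forall>x\<in>jets n. \<rho> (jet_scale s r x) = jet_scale s' r (\<rho> x))"

definition jet_functional ::
  "('k::dense_unit_ring \<Rightarrow> 'v::{ab_group_add,t2_space} \<Rightarrow> 'v) \<Rightarrow>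
   ('k \<Rightarrow> 'w::{ab_group_add,t2_space} \<Rightarrow> 'w) \<Rightarrow> nat \<Rightarrow> (('v, 'k) jet \<Rightarrow> 'w) \<Rightarrow> bool" where
  "jet_functional s s' n l \<longleftrightarrow> continuous_on (jets n) l \<and>
    (\<forall>x\<in>jets n. \<forall>y\<in>jets n. l (jet_add x y) = l x + l y) \<and>
    (\<forall>r. \<forall>x\<in>jets n. l (jet_scale s r x) = s' r (l x))"

text \<open>
  This is the linear map \<open>(x, v, t) \<mapsto> (\<rho> x, \<rho> v, t)\<close>. It satisfies
  \<open>(f \<circ> \<rho>)\<^sup>[\<^sup>1\<^sup>] = f\<^sup>[\<^sup>1\<^sup>] \<circ> lift_node \<rho>\<close>, which makes inductions over the degree of differentiability work.
\<close>

definition lift_node :: "(('v, 'k) jet \<Rightarrow> ('w, 'k) jet) \<Rightarrow> ('v, 'k) jet \<Rightarrow> ('w, 'k) jet" where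
  "lift_node \<rho> z = Node (\<rho> (node_point z)) (\<rho> (node_direction z)) (node_scalar z)"

lemma lift_node_Node [simp]: "lift_node \<rho> (Node x v t) = Node (\<rho> x) (\<rho> v) t"
  by (simp add: lift_node_def)

lemma jet_linear_lift:
  assumes "jet_linear s s' n m \<rho>"
  shows "jet_linear s s' (Suc n) (Suc m) (lift_node \<rho>)"
proof -
  have "continuous_on (jets (Suc n)) (lift_node \<rho>)"
    unfolding lift_node_def using assms
    by (intro continuous_on_Node continuous_on_node_scalar
      continuous_on_compose2[OF _ continuous_on_node_point]
      continuous_on_compose2[OF _ continuous_on_node_direction]) (auto simp: jet_linear_def)
  then show ?thesis using assms by (auto simp: jet_linear_def image_subset_iff)
qed

lemma jet_linear_node_point: "jet_linear s s (Suc n) n node_point"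
  by (auto simp: jet_linear_def continuous_on_node_point simp del: jets.simps(2))
    (auto simp: jets_Suc)

lemma jet_functional_node_direction:
  "jet_functional s s' n l \<Longrightarrow> jet_functional s s' (Suc n) (\<lambda>z. l (node_direction z))"
  unfolding jet_functional_def
  by (intro conjI continuous_on_compose2[OF _ continuous_on_node_direction]) auto

lemma jet_functional_node_scalar: "jet_functional s (*) (Suc n) node_scalar"
  unfolding jet_functional_def by (auto simp: continuous_on_node_scalar simp del: jets.simps(2)) (auto simp: jets_Suc)

lemma C_jet_precompose_linear:
  assumes "C_jet s' sW j m U f" "jet_linear s s' n m \<rho>" "\<rho> ` U' \<subseteq> U" "U' \<subseteq> jets n"
  shows "C_jet s sW j n U' (\<lambda>x. f (\<rho> x))"
  using assms
proof (induction j arbitrary: n m U U' f \<rho>)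
  case 0
  then show ?case
    by (auto simp: jet_linear_def intro!: continuous_on_compose2[of U f U' \<rho>] intro: continuous_on_subset)
next
  case (Suc j)
  then obtain f1 where f1: "difference_quotient s' sW m U f f1"
      "C_jet s' sW j (Suc m) (quotient_domain s' m U) f1"
    by auto
  have lin: "jet_linear s s' (Suc n) (Suc m) (lift_node \<rho>)" by (rule jet_linear_lift) fact
  have sub: "quotient_domain s n U' \<subseteq> jets (Suc n)"
    by (rule quotient_domain_subset_jets) fact
  have add: "\<rho> (jet_add x (jet_scale s t v)) = jet_add (\<rho> x) (jet_scale s' t (\<rho> v))"
    if "x \<in> U'" "v \<in> jets n" "jet_scale s t v \<in> jets n" for x v t
    using Suc.prems(2,4) that by (auto simp: jet_linear_def subset_iff)
  have closed: "jet_scale s t v \<in> jets n" if "v \<in> jets n" for v :: "('d, 'a) jet" and t n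
    using that by (induction n arbitrary: v) auto
  have img: "lift_node \<rho> ` quotient_domain s n U' \<subseteq> quotient_domain s' m U"
  proof safe
    fix z assume "z \<in> quotient_domain s n U'"
    then obtain x v t where z: "z = Node x v t" "x \<in> U'" "v \<in> jets n" "jet_add x (jet_scale s t v) \<in> U'"
      by (rule quotient_domainE)
    then have "\<rho> (jet_add x (jet_scale s t v)) \<in> U" "\<rho> x \<in> U" "\<rho> v \<in> jets m"
      using Suc.prems(2,3) by (auto simp: jet_linear_def)
    then show "lift_node \<rho> z \<in> quotient_domain s' m U" using add[OF z(2,3) closed[OF z(3)]] z(1) by simp
  qed
  have "difference_quotient s sW n U' (\<lambda>x. f (\<rho> x)) (\<lambda>z. f1 (lift_node \<rho> z))"
    unfolding difference_quotient_def
  proof (intro conjI allI impI)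
    show "continuous_on (quotient_domain s n U') (\<lambda>z. f1 (lift_node \<rho> z))"
      using f1 lin sub img
      by (auto simp: jet_linear_def difference_quotient_def
        intro!: continuous_on_compose2[of "quotient_domain s' m U" f1] intro: continuous_on_subset)
    fix x v t assume z: "Node x v t \<in> quotient_domain s n U'"
    then have "lift_node \<rho> (Node x v t) \<in> quotient_domain s' m U" using img by blast
    then show "f (\<rho> (jet_add x (jet_scale s t v))) - f (\<rho> x) = sW t (f1 (lift_node \<rho> (Node x v t)))"
      using f1(1) z add closed by (auto simp: difference_quotient_def)
  qed
  moreover have "C_jet s sW j (Suc n) (quotient_domain s n U') (\<lambda>z. f1 (lift_node \<rho> z))"
    by (rule Suc.IH[OF f1(2) lin img sub])
  ultimately show ?case by auto
qed

lemma C_jet_node_point: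
  assumes "C_jet s s' j n U f" "U \<subseteq> jets n"
  shows "C_jet s s' j (Suc n) (quotient_domain s n U) (\<lambda>z. f (node_point z))"
  by (rule C_jet_precompose_linear[OF assms(1) jet_linear_node_point])
    (use assms(2) quotient_domain_subset_jets in \<open>auto elim!: quotient_domainE\<close>)

text \<open>
  The difference quotient of a linear functional \<open>l\<close> is \<open>(x, v, t) \<mapsto> l v\<close>, again a linear functional.
\<close>

lemma C_jet_functional:
  assumes "topological_module s" "topological_module s'" "jet_functional s s' n l" "U \<subseteq> jets n"
  shows "C_jet s s' j n U l"
  using assms(3,4)
proof (induction j arbitrary: n U l)
  case 0
  then show ?case by (auto simp: jet_functional_def intro: continuous_on_subset)
next
  case (Suc j)
  interpret V: topological_module s by fact
  have sub: "quotient_domain s n U \<subseteq> jets (Suc n)"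
    by (rule quotient_domain_subset_jets) fact
  have lin: "jet_functional s s' (Suc n) (\<lambda>z. l (node_direction z))"
    by (rule jet_functional_node_direction) fact
  have "difference_quotient s s' n U l (\<lambda>z. l (node_direction z))"
    unfolding difference_quotient_def
  proof (intro conjI allI impI)
    show "continuous_on (quotient_domain s n U) (\<lambda>z. l (node_direction z))"
      using lin sub by (auto simp: jet_functional_def intro: continuous_on_subset)
    fix x v t assume "Node x v t \<in> quotient_domain s n U"
    then have "x \<in> jets n" "v \<in> jets n" using Suc.prems by auto
    then show "l (jet_add x (jet_scale s t v)) - l x = s' t (l (node_direction (Node x v t)))"
      using Suc.prems(1) V.jet_scale_closed by (auto simp: jet_functional_def)
  qed
  then show ?case using Suc.IH[OF lin sub] by auto
qed

lemma C_jet_const: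
  assumes "topological_module s'"
  shows "C_jet s s' j n U (\<lambda>_. c)"
proof (induction j arbitrary: n U c)
  case (Suc j)
  interpret W: topological_module s' by fact
  have "difference_quotient s s' n U (\<lambda>_. c) (\<lambda>_. 0)"
    by (auto simp: difference_quotient_def)
  then show ?case using Suc by auto
qed simp

lemma C_jet_Pair:
  assumes "C_jet s s' j n U f" "C_jet s s'' j n U g"
  shows "C_jet s (prod_scale s' s'') j n U (\<lambda>x. (f x, g x))"
  using assms
proof (induction j arbitrary: n U f g)
  case 0
  then show ?case by (auto intro: continuous_on_Pair)
next
  case (Suc j)
  then obtain f1 g1 where
    "difference_quotient s s' n U f f1" "C_jet s s' j (Suc n) (quotient_domain s n U) f1"
    "difference_quotient s s'' n U g g1" "C_jet s s'' j (Suc n) (quotient_domain s n U) g1"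
    by auto
  moreover from this have "C_jet s (prod_scale s' s'') j (Suc n) (quotient_domain s n U) (\<lambda>x. (f1 x, g1 x))"
    by (intro Suc.IH)
  ultimately have "difference_quotient s (prod_scale s' s'') n U (\<lambda>x. (f x, g x)) (\<lambda>x. (f1 x, g1 x))"
      "C_jet s (prod_scale s' s'') j (Suc n) (quotient_domain s n U) (\<lambda>x. (f1 x, g1 x))"
    by (auto simp: difference_quotient_def prod_scale_def intro!: continuous_on_Pair)
  then show ?case by auto
qed

definition continuous_linear ::
  "('k::dense_unit_ring \<Rightarrow> 'v::{ab_group_add,t2_space} \<Rightarrow> 'v) \<Rightarrow>
   ('k \<Rightarrow> 'w::{ab_group_add,t2_space} \<Rightarrow> 'w) \<Rightarrow> ('v \<Rightarrow> 'w) \<Rightarrow> bool" where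
  "continuous_linear s s' l \<longleftrightarrow> continuous_on UNIV l \<and> (\<forall>x y. l (x + y) = l x + l y) \<and>
    (\<forall>r x. l (s r x) = s' r (l x))"

lemma C_jet_add:
  assumes "topological_module s'" "C_jet s s' j n U f" "C_jet s s' j n U g"
  shows "C_jet s s' j n U (\<lambda>x. f x + g x)"
  using assms(2,3)
proof (induction j arbitrary: n U f g)
  interpret W: topological_module s' by fact
  {
    case 0
    then show ?case by (auto intro: W.cont_add)
  next
    case (Suc j)
    then obtain f1 g1 where
      "difference_quotient s s' n U f f1" "C_jet s s' j (Suc n) (quotient_domain s n U) f1"
      "difference_quotient s s' n U g g1" "C_jet s s' j (Suc n) (quotient_domain s n U) g1"
      by auto
    then have "difference_quotient s s' n U (\<lambda>x. f x + g x) (\<lambda>x. f1 x + g1 x)"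
        "C_jet s s' j (Suc n) (quotient_domain s n U) (\<lambda>x. f1 x + g1 x)"
      using Suc.IH by (auto simp: difference_quotient_def W.scale_right_distrib add_diff_add intro: W.cont_add)
    then show ?case by auto
  }
qed

text \<open>
  The difference quotient of a product \<open>r f\<close> at \<open>(x, v, t)\<close> is
  \<open>r\<^sup>[\<^sup>1\<^sup>] f(x) + r(x) f\<^sup>[\<^sup>1\<^sup>] + t r\<^sup>[\<^sup>1\<^sup>] f\<^sup>[\<^sup>1\<^sup>]\<close>. The last term is a product with the coordinate \<open>t\<close>; it avoids
  the value \<open>f(x + t v)\<close>, which is not the composite of \<open>f\<close> with a linear map.
\<close>

lemma C_jet_scale:
  assumes s: "topological_module s" and s': "topological_module s'"
    and "U \<subseteq> jets n" "C_jet s (*) j n U r" "C_jet s s' j n U f"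
  shows "C_jet s s' j n U (\<lambda>x. s' (r x) (f x))"
  using assms(3-5)
proof (induction j arbitrary: n U r f)
  interpret W: topological_module s' by fact
  {
    case 0
    then show ?case by (auto intro: W.cont_scale)
  next
    case (Suc j)
    let ?Q = "quotient_domain s n U"
    have sub: "?Q \<subseteq> jets (Suc n)"
      by (rule quotient_domain_subset_jets) fact
    from Suc.prems obtain r1 f1 where
      r1: "difference_quotient s (*) n U r r1" "C_jet s (*) j (Suc n) ?Q r1" and
      f1: "difference_quotient s s' n U f f1" "C_jet s s' j (Suc n) ?Q f1"
      by auto
    have r: "C_jet s (*) j (Suc n) ?Q (\<lambda>z. r (node_point z))"
      by (rule C_jet_node_point[OF C_jet_SucD[OF s topological_module_ring Suc.prems(1,2)] Suc.prems(1)])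
    have f: "C_jet s s' j (Suc n) ?Q (\<lambda>z. f (node_point z))"
      by (rule C_jet_node_point[OF C_jet_SucD[OF s s' Suc.prems(1,3)] Suc.prems(1)])
    have t: "C_jet s (*) j (Suc n) ?Q node_scalar"
      by (intro C_jet_functional s topological_module_ring jet_functional_node_scalar sub)
    let ?h = "\<lambda>z. s' (r1 z) (f (node_point z)) + (s' (r (node_point z)) (f1 z) +
      s' (node_scalar z) (s' (r1 z) (f1 z)))"
    have h: "C_jet s s' j (Suc n) ?Q ?h"
      by (intro C_jet_add s' Suc.IH sub r f t r1 f1)
    have "difference_quotient s s' n U (\<lambda>x. s' (r x) (f x)) ?h"
      unfolding difference_quotient_def
    proof (intro conjI allI impI)
      show "continuous_on ?Q ?h" by (rule C_jet_continuous[OF s s' sub h])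
      fix x v t assume z: "Node x v t \<in> ?Q"
      have "r (jet_add x (jet_scale s t v)) = r x + t * r1 (Node x v t)"
        "f (jet_add x (jet_scale s t v)) = f x + s' t (f1 (Node x v t))"
        using r1(1) f1(1) z unfolding difference_quotient_def diff_eq_eq add.commute[of "_ * _"]
          add.commute[of "s' _ _"] by blast+
      then show "s' (r (jet_add x (jet_scale s t v))) (f (jet_add x (jet_scale s t v))) - s' (r x) (f x)
          = s' t (?h (Node x v t))"
        by (simp add: W.scale_left_distrib W.scale_right_distrib distrib_left mult_ac)
    qed
    then show ?case using h by auto
  }
qed

section \<open>The chain rule for jets\<close>

text \<open>
  The difference quotient of \<open>g \<circ> F\<close> is \<open>(x, v, t) \<mapsto> g\<^sup>[\<^sup>1\<^sup>](F x, F\<^sup>[\<^sup>1\<^sup>](x, v, t), t)\<close>. An induction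
  therefore has to admit inner maps \<open>F\<close> whose values are themselves jets.
\<close>

primrec C_map ::
  "('k::dense_unit_ring \<Rightarrow> 'v::{ab_group_add,t2_space} \<Rightarrow> 'v) \<Rightarrow>
   ('k \<Rightarrow> 'w::{ab_group_add,t2_space} \<Rightarrow> 'w) \<Rightarrow> nat \<Rightarrow> nat \<Rightarrow> ('v, 'k) jet set \<Rightarrow> nat \<Rightarrow>
   (('v, 'k) jet \<Rightarrow> ('w, 'k) jet) \<Rightarrow> bool" where
  "C_map s s' j n U 0 F \<longleftrightarrow> F ` U \<subseteq> jets 0 \<and> C_jet s s' j n U (\<lambda>z. base (F z))"
| "C_map s s' j n U (Suc m) F \<longleftrightarrow> F ` U \<subseteq> jets (Suc m) \<and> C_map s s' j n U m (\<lambda>z. node_point (F z)) \<and>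
    C_map s s' j n U m (\<lambda>z. node_direction (F z)) \<and> C_jet s (*) j n U (\<lambda>z. node_scalar (F z))"

lemma C_map_in_jets: "C_map s s' j n U m F \<Longrightarrow> x \<in> U \<Longrightarrow> F x \<in> jets m"
  by (cases m) auto

lemma C_map_node_point:
  assumes "C_map s s' j n U m F" "U \<subseteq> jets n"
  shows "C_map s s' j (Suc n) (quotient_domain s n U) m (\<lambda>z. F (node_point z))"
  using assms(1)
proof (induction m arbitrary: F)
  case 0
  then show ?case using assms(2) C_jet_node_point[of s s' j n U "\<lambda>z. base (F z)"]
    by (auto elim!: quotient_domainE simp: subset_iff image_iff) 
next
  case (Suc m)
  have "(\<lambda>z. F (node_point z)) ` quotient_domain s n U \<subseteq> jets (Suc m)"
    using Suc.prems C_map_in_jets[OF Suc.prems] by (auto elim!: quotient_domainE simp del: jets.simps)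
  then show ?case using Suc assms(2) C_jet_node_point[of s "(*)" j n U "\<lambda>z. node_scalar (F z)"]
    by (auto simp del: jets.simps)
qed

lemma C_map_continuous:
  assumes s: "topological_module s" and s': "topological_module s'" and U: "U \<subseteq> jets n"
    and "C_map s s' j n U m F"
  shows "continuous_on U F"
  using assms(4)
proof (induction m arbitrary: F)
  case 0
  then have "continuous_on U (\<lambda>z. Base (base (F z)))"
    by (intro continuous_on_Base C_jet_continuous[OF s s' U]) auto
  then show ?case by (rule continuous_on_eq) (use 0 in \<open>auto simp: image_subset_iff\<close>)
next
  case (Suc m)
  then have "continuous_on U (\<lambda>z. node_scalar (F z))"
    by (intro C_jet_continuous[OF s topological_module_ring U]) auto
  then have "continuous_on U (\<lambda>z. Node (node_point (F z)) (node_direction (F z)) (node_scalar (F z)))"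
    using Suc by (intro continuous_on_Node) auto
  then show ?case by (rule continuous_on_eq) (use Suc.prems in \<open>force simp: image_subset_iff\<close>)
qed

lemma C_map_SucD:
  assumes "topological_module s" "topological_module s'" "U \<subseteq> jets n" "C_map s s' (Suc j) n U m F"
  shows "C_map s s' j n U m F"
  using assms(4)
proof (induction m arbitrary: F)
  case 0
  then show ?case using C_jet_SucD[OF assms(1-3)] by (auto simp del: C_jet.simps jets.simps)
next
  case (Suc m)
  then show ?case using C_jet_SucD[OF assms(1) topological_module_ring assms(3)]
    by (auto simp del: C_jet.simps jets.simps)
qed

text \<open>
  The components of a map into jets have difference quotients with values in modules; together they
  are the jet \<open>F\<^sup>[\<^sup>1\<^sup>](x, v, t)\<close> that occurs in the chain rule.
\<close>

lemma C_map_difference_quotient: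
  assumes s': "topological_module s'" and "C_map s s' (Suc j) n U m F"
  shows "\<exists>F1. C_map s s' j (Suc n) (quotient_domain s n U) m F1 \<and>
    (\<forall>x v t. Node x v t \<in> quotient_domain s n U \<longrightarrow>
      F (jet_add x (jet_scale s t v)) = jet_add (F x) (jet_scale s' t (F1 (Node x v t))))"
  using assms(2)
proof (induction m arbitrary: F)
  case 0
  then obtain f1 where f1: "difference_quotient s s' n U (\<lambda>z. base (F z)) f1"
    "C_jet s s' j (Suc n) (quotient_domain s n U) f1" by auto
  have "F (jet_add x (jet_scale s t v)) = jet_add (F x) (jet_scale s' t (Base (f1 (Node x v t))))"
    if "Node x v t \<in> quotient_domain s n U" for x v t
  proof -
    have "F (jet_add x (jet_scale s t v)) \<in> range Base" "F x \<in> range Base"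
      using 0 that by auto
    then obtain a b where "F (jet_add x (jet_scale s t v)) = Base a" "F x = Base b" by auto
    moreover have "base (F (jet_add x (jet_scale s t v))) - base (F x) = s' t (f1 (Node x v t))"
      using f1(1) that unfolding difference_quotient_def by blast
    ultimately show ?thesis by (simp add: algebra_simps)
  qed
  then show ?case using f1(2) by (intro exI[of _ "\<lambda>z. Base (f1 z)"]) auto
next
  case (Suc m)
  obtain P where P: "C_map s s' j (Suc n) (quotient_domain s n U) m P"
    "\<And>x v t. Node x v t \<in> quotient_domain s n U \<Longrightarrow>
      node_point (F (jet_add x (jet_scale s t v)))
        = jet_add (node_point (F x)) (jet_scale s' t (P (Node x v t)))"
    using Suc.IH[of "\<lambda>z. node_point (F z)"] Suc.prems by auto
  obtain D where D: "C_map s s' j (Suc n) (quotient_domain s n U) m D"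
    "\<And>x v t. Node x v t \<in> quotient_domain s n U \<Longrightarrow>
      node_direction (F (jet_add x (jet_scale s t v)))
        = jet_add (node_direction (F x)) (jet_scale s' t (D (Node x v t)))"
    using Suc.IH[of "\<lambda>z. node_direction (F z)"] Suc.prems by auto
  obtain c where c: "difference_quotient s (*) n U (\<lambda>z. node_scalar (F z)) c"
    "C_jet s (*) j (Suc n) (quotient_domain s n U) c" using Suc.prems by auto
  have "F (jet_add x (jet_scale s t v)) =
      jet_add (F x) (jet_scale s' t (Node (P (Node x v t)) (D (Node x v t)) (c (Node x v t))))"
    if "Node x v t \<in> quotient_domain s n U" for x v t
  proof -
    have "F (jet_add x (jet_scale s t v)) \<in> jets (Suc m)" "F x \<in> jets (Suc m)"
      using Suc.prems that by (auto simp del: jets.simps)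
    then obtain x1 v1 t1 x2 v2 t2 where
      "F (jet_add x (jet_scale s t v)) = Node x1 v1 t1" "F x = Node x2 v2 t2" by auto
    moreover have "node_scalar (F (jet_add x (jet_scale s t v))) - node_scalar (F x) = t * c (Node x v t)"
      using c(1) that unfolding difference_quotient_def by blast
    ultimately show ?thesis using P(2)[OF that] D(2)[OF that] by (simp add: algebra_simps)
  qed
  moreover have "C_map s s' j (Suc n) (quotient_domain s n U) (Suc m) (\<lambda>z. Node (P z) (D z) (c z))"
    using P(1) D(1) c(2) C_map_in_jets[OF P(1)] C_map_in_jets[OF D(1)] by auto
  ultimately show ?case by (intro exI[of _ "\<lambda>z. Node (P z) (D z) (c z)"]) auto
qed

lemma C_jet_compose:
  assumes s: "topological_module s" and s': "topological_module s'" and s'': "topological_module s''"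
    and "U \<subseteq> jets n" "U' \<subseteq> jets m" "C_map s s' j n U m F" "C_jet s' s'' j m U' g" "F ` U \<subseteq> U'"
  shows "C_jet s s'' j n U (\<lambda>x. g (F x))"
  using assms(4-)
proof (induction j arbitrary: n m U U' F g)
  case 0
  then show ?case using C_map_continuous[OF s s' 0(1,3)] by (auto intro: continuous_on_compose2)
next
  case (Suc j)
  let ?Q = "quotient_domain s n U" and ?Q' = "quotient_domain s' m U'"
  obtain g1 where g1: "difference_quotient s' s'' m U' g g1" "C_jet s' s'' j (Suc m) ?Q' g1"
    using Suc.prems by auto
  obtain F1 where F1: "C_map s s' j (Suc n) ?Q m F1"
    "\<And>x v t. Node x v t \<in> ?Q \<Longrightarrow>
      F (jet_add x (jet_scale s t v)) = jet_add (F x) (jet_scale s' t (F1 (Node x v t)))"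
    using C_map_difference_quotient[OF s' Suc.prems(3)] by auto
  have sub: "?Q \<subseteq> jets (Suc n)" "?Q' \<subseteq> jets (Suc m)"
    using Suc.prems quotient_domain_subset_jets by blast+
  let ?G = "\<lambda>z. Node (F (node_point z)) (F1 z) (node_scalar z)"
  have F: "C_map s s' j (Suc n) ?Q m (\<lambda>z. F (node_point z))"
    by (rule C_map_node_point[OF C_map_SucD[OF s s' Suc.prems(1,3)] Suc.prems(1)])
  have t: "C_jet s (*) j (Suc n) ?Q node_scalar"
    by (intro C_jet_functional s topological_module_ring jet_functional_node_scalar sub)
  have G: "C_map s s' j (Suc n) ?Q (Suc m) ?G"
    using F F1(1) t C_map_in_jets[OF F] C_map_in_jets[OF F1(1)] by auto
  have img: "?G ` ?Q \<subseteq> ?Q'"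
  proof safe
    fix z assume z: "z \<in> ?Q"
    then obtain x v t where xvt: "z = Node x v t" "x \<in> U" "v \<in> jets n" "jet_add x (jet_scale s t v) \<in> U"
      by (rule quotient_domainE)
    have "jet_add (F x) (jet_scale s' t (F1 z)) \<in> U'" "F x \<in> U'"
      using F1(2)[of x v t] xvt Suc.prems(5) by (auto simp: image_subset_iff)
    then show "?G z \<in> ?Q'" using C_map_in_jets[OF F1(1) z] xvt(1) by simp
  qed
  have h: "C_jet s s'' j (Suc n) ?Q (\<lambda>z. g1 (?G z))"
    by (rule Suc.IH[OF sub G g1(2) img])
  have "difference_quotient s s'' n U (\<lambda>x. g (F x)) (\<lambda>z. g1 (?G z))"
    unfolding difference_quotient_def
  proof (intro conjI allI impI)
    show "continuous_on ?Q (\<lambda>z. g1 (?G z))" by (rule C_jet_continuous[OF s s'' sub(1) h])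
    fix x v t assume z: "Node x v t \<in> ?Q"
    then have "?G (Node x v t) \<in> ?Q'" using img by blast
    then have "g (jet_add (F x) (jet_scale s' t (F1 (Node x v t)))) - g (F x)
        = s'' t (g1 (?G (Node x v t)))"
      using g1(1) by (simp add: difference_quotient_def)
    then show "g (F (jet_add x (jet_scale s t v))) - g (F x) = s'' t (g1 (?G (Node x v t)))"
      using F1(2)[OF z] by simp
  qed
  then show ?case using h by auto
qed


section \<open>Smooth maps between topological modules\<close>

lemma smooth_on_open: "smooth_on s s' U f \<Longrightarrow> open U"
  by (simp add: smooth_on_def)

lemma smooth_on_cong:
  assumes "smooth_on s s' U f" "\<And>x. x \<in> U \<Longrightarrow> f x = g x"
  shows "smooth_on s s' U g"
  using assms unfolding smooth_on_def by (auto intro!: C_jet_cong[of s s' _ 0 _ "f \<circ> base" "g \<circ> base"])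

lemma smooth_on_subset:
  assumes "smooth_on s s' U f" "open U'" "U' \<subseteq> U"
  shows "smooth_on s s' U' f"
  using assms unfolding smooth_on_def by (auto intro: C_jet_subset[OF _ image_mono])

lemma smooth_on_continuous:
  assumes "smooth_on s s' U f"
  shows "continuous_on U f"
proof -
  have "continuous_on (Base ` U :: ('b, 'a) jet set) (f \<circ> base)"
    using assms unfolding smooth_on_def by (metis C_jet.simps(1))
  then show ?thesis
    using continuous_on_compose2[of "Base ` U" "f \<circ> base" U Base] continuous_on_Base[OF continuous_on_id, of U]
    by auto
qed

lemma smooth_on_compose:
  assumes "topological_module s" "topological_module s'" "topological_module s''"
    and f: "smooth_on s s' U f" and g: "smooth_on s' s'' U' g" and fU: "f ` U \<subseteq> U'"
  shows "smooth_on s s'' U (\<lambda>x. g (f x))"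
  unfolding smooth_on_def
proof (intro conjI allI smooth_on_open[OF f])
  fix j
  have "C_map s s' j 0 (Base ` U) 0 (\<lambda>z. Base (f (base z)))"
    using f by (auto simp: smooth_on_def comp_def)
  then have "C_jet s s'' j 0 (Base ` U) (\<lambda>x. (g \<circ> base) (Base (f (base x))))"
    using C_jet_compose[OF assms(1-3), of "Base ` U" 0 "Base ` U'" 0 j "\<lambda>z. Base (f (base z))" "g \<circ> base"] g fU
    by (auto simp: smooth_on_def image_subset_iff)
  then show "C_jet s s'' j 0 (Base ` U) ((\<lambda>x. g (f x)) \<circ> base)"
    by (simp add: comp_def)
qed

lemma smooth_on_linear:
  assumes "topological_module s" "topological_module s'" "continuous_linear s s' l" "open U"
  shows "smooth_on s s' U l"
proof -
  have "jet_functional s s' 0 (l \<circ> base)"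
    using assms(3) continuous_on_compose2[OF _ continuous_on_base, of UNIV l]
    by (auto simp: jet_functional_def continuous_linear_def)
  then show ?thesis
    using assms(4) by (auto simp: smooth_on_def simp del: o_apply intro!: C_jet_functional[OF assms(1,2)])
qed

lemma smooth_on_const:
  assumes "topological_module s'" "open U"
  shows "smooth_on s s' U (\<lambda>_. c)"
  using assms C_jet_const[OF assms(1)] by (auto simp: smooth_on_def comp_def)

lemma smooth_on_Pair:
  assumes "smooth_on s s' U f" "smooth_on s s'' U g"
  shows "smooth_on s (prod_scale s' s'') U (\<lambda>x. (f x, g x))"
  using assms C_jet_Pair[of s s' _ 0 "Base ` U" "f \<circ> base" s'' "g \<circ> base"]
  by (auto simp: smooth_on_def comp_def)

lemma smooth_on_add:
  assumes "topological_module s'" "smooth_on s s' U f" "smooth_on s s' U g"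
  shows "smooth_on s s' U (\<lambda>x. f x + g x)"
  using assms C_jet_add[of s' s _ 0 "Base ` U" "f \<circ> base" "g \<circ> base"]
  by (auto simp: smooth_on_def comp_def)

lemma smooth_on_scale:
  assumes "topological_module s" "topological_module s'" "smooth_on s (*) U r" "smooth_on s s' U f"
  shows "smooth_on s s' U (\<lambda>x. s' (r x) (f x))"
  using assms C_jet_scale[of s s' "Base ` U" 0 _ "r \<circ> base" "f \<circ> base"]
  by (auto simp: smooth_on_def comp_def)

lemma smooth_on_id:
  assumes "topological_module s" "open U"
  shows "smooth_on s s U (\<lambda>x. x)"
  by (rule smooth_on_linear[OF assms(1,1) _ assms(2)]) (auto simp: continuous_linear_def continuous_on_id)

lemma smooth_on_scale_const:
  assumes "topological_module s" "topological_module s'" "smooth_on s s' U f"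
  shows "smooth_on s s' U (\<lambda>x. s' r (f x))"
  by (intro smooth_on_scale assms smooth_on_const topological_module_ring smooth_on_open[OF assms(3)])

lemma smooth_on_diff:
  assumes "topological_module s" "topological_module s'" "smooth_on s s' U f" "smooth_on s s' U g"
  shows "smooth_on s s' U (\<lambda>x. f x - g x)"
proof -
  interpret W: topological_module s' by fact
  show ?thesis
    using smooth_on_add[OF assms(2,3) smooth_on_scale_const[OF assms(1,2,4), of "-1"]] by simp
qed

lemma continuous_linear_fst: "continuous_linear (prod_scale s s') s fst"
  by (auto simp: continuous_linear_def prod_scale_def intro!: continuous_intros)

lemma continuous_linear_snd: "continuous_linear (prod_scale s s') s' snd"
  by (auto simp: continuous_linear_def prod_scale_def intro!: continuous_intros)

section \<open>Difference quotients and differentials\<close>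

text \<open>
  This principle replaces limits \<open>t \<rightarrow> 0\<close> with \<open>t \<noteq> 0\<close>, since a scalar can only be cancelled if it is
  a unit.
\<close>

lemma eq_by_dense_units:
  fixes F G :: "'k::dense_unit_ring \<Rightarrow> 'w::t2_space"
  assumes "open N" "t \<in> N" "continuous_on N F" "continuous_on N G"
    and eq: "\<And>u. u \<in> N \<Longrightarrow> u dvd 1 \<Longrightarrow> F u = G u"
  shows "F t = G t"
proof (rule ccontr)
  assume "F t \<noteq> G t"
  then obtain A B where AB: "open A" "open B" "F t \<in> A" "G t \<in> B" "A \<inter> B = {}"
    by (meson hausdorff)
  let ?N = "(N \<inter> F -` A) \<inter> (N \<inter> G -` B)"
  have "open ?N" using assms AB by (intro open_Int continuous_open_preimage)
  moreover have "?N \<noteq> {}" using assms AB by auto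
  ultimately obtain u where "u \<in> ?N" "u dvd 1" using dense_units by blast
  then show False using eq[of u] AB by auto
qed

context topological_module
begin

lemma open_line:
  assumes "open U"
  shows "open {t. x + smul t v \<in> U}"
proof -
  have "continuous_on UNIV (\<lambda>t. x + smul t v)"
    by (intro cont_add cont_scale continuous_on_const continuous_on_id)
  then show ?thesis using open_vimage[OF assms, of "\<lambda>t. x + smul t v"] by (simp add: vimage_def)
qed

lemma open_quotient_domain:
  assumes "open U"
  shows "open {(x, v, t). x \<in> U \<and> x + smul t v \<in> U}"
proof -
  have "continuous_on UNIV (\<lambda>p :: 'v \<times> 'v \<times> 'k. fst p + smul (snd (snd p)) (fst (snd p)))"
    by (intro cont_add cont_scale continuous_on_fst continuous_on_snd continuous_on_id)
  then have "open ((\<lambda>p :: 'v \<times> 'v \<times> 'k. fst p + smul (snd (snd p)) (fst (snd p))) -` U)"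
    using assms open_vimage by blast
  moreover have "open (fst -` U :: ('v \<times> 'v \<times> 'k) set)" by (rule open_vimage_fst[OF assms])
  moreover have "{(x, v, t). x \<in> U \<and> x + smul t v \<in> U}
      = (fst -` U :: ('v \<times> 'v \<times> 'k) set) \<inter> (\<lambda>p. fst p + smul (snd (snd p)) (fst (snd p))) -` U"
    by auto
  ultimately show ?thesis by (simp add: open_Int)
qed

end

lemma difference_quotient_unique:
  assumes s: "topological_module s" and s': "topological_module s'" and "open U"
    and f1: "difference_quotient s s' 0 (Base ` U) f f1" and f2: "difference_quotient s s' 0 (Base ` U) f f2"
    and z: "z \<in> quotient_domain s 0 (Base ` U)"
  shows "f1 z = f2 z"
proof -
  interpret V: topological_module s by fact
  interpret W: topological_module s' by fact
  obtain x v t where xvt: "z = Node (Base x) (Base v) t" "x \<in> U" "x + s t v \<in> U"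
    using z by (auto elim!: quotient_domainE)
  let ?N = "{t. x + s t v \<in> U}"
  have N: "open ?N" by (rule V.open_line) fact
  have c: "continuous_on ?N (\<lambda>t. Node (Base x) (Base v) t :: ('b, 'a) jet)"
    by (intro continuous_intros)
  have img: "(\<lambda>t. Node (Base x) (Base v) t) ` ?N \<subseteq> quotient_domain s 0 (Base ` U)"
    using xvt by auto
  have "f1 (Node (Base x) (Base v) t) = f2 (Node (Base x) (Base v) t)"
  proof (rule eq_by_dense_units[OF N, of t])
    show "continuous_on ?N (\<lambda>t. f1 (Node (Base x) (Base v) t))"
      using f1 c img by (auto simp: difference_quotient_def intro: continuous_on_compose2)
    show "continuous_on ?N (\<lambda>t. f2 (Node (Base x) (Base v) t))"
      using f2 c img by (auto simp: difference_quotient_def intro: continuous_on_compose2)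
    fix u assume u: "u \<in> ?N" "u dvd 1"
    then have "Node (Base x) (Base v) u \<in> quotient_domain s 0 (Base ` U)" using img by blast
    then have "s' u (f1 (Node (Base x) (Base v) u)) = s' u (f2 (Node (Base x) (Base v) u))"
      using f1 f2 unfolding difference_quotient_def by metis
    then show "f1 (Node (Base x) (Base v) u) = f2 (Node (Base x) (Base v) u)"
      using W.unit_cancel u(2) by blast
  qed (use xvt in auto)
  then show ?thesis using xvt by simp
qed

definition smooth_quotient ::
  "('k::dense_unit_ring \<Rightarrow> 'v::{ab_group_add,t2_space} \<Rightarrow> 'v) \<Rightarrow>
   ('k \<Rightarrow> 'w::{ab_group_add,t2_space} \<Rightarrow> 'w) \<Rightarrow> 'v set \<Rightarrow> ('v \<Rightarrow> 'w) \<Rightarrow> ('v \<times> 'v \<times> 'k \<Rightarrow> 'w) \<Rightarrow> bool" where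
  "smooth_quotient s s' U f g \<longleftrightarrow>
    smooth_on (prod_scale s (prod_scale s (*))) s' {(x, v, t). x \<in> U \<and> x + s t v \<in> U} g \<and>
    (\<forall>x v t. x \<in> U \<longrightarrow> x + s t v \<in> U \<longrightarrow> f (x + s t v) - f x = s' t (g (x, v, t))) \<and>
    (\<forall>x v. x \<in> U \<longrightarrow> differential s s' U f x v = g (x, v, 0))"

lemma smooth_quotientD:
  assumes "smooth_quotient s s' U f g"
  shows "smooth_on (prod_scale s (prod_scale s (*))) s' {(x, v, t). x \<in> U \<and> x + s t v \<in> U} g"
    and "\<And>x t v. x \<in> U \<Longrightarrow> x + s t v \<in> U \<Longrightarrow> f (x + s t v) - f x = s' t (g (x, v, t))"
    and "\<And>x v. x \<in> U \<Longrightarrow> differential s s' U f x v = g (x, v, 0)"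
  using assms by (auto simp: smooth_quotient_def)

text \<open>
  The difference quotient of a smooth map is again a smooth map, now on an open subset of the
  product type \<open>V \<times> V \<times> K\<close>. Indeed, the quotients that exist for the various degrees of
  differentiability agree by uniqueness, and \<open>(x, v, t) \<mapsto> Node (Base x) (Base v) t\<close> is a linear map
  from \<open>V \<times> V \<times> K\<close> to the jets over \<open>V\<close>. As the result is a statement about product types only, it can
  be applied repeatedly without reference to jets.
\<close>

lemma smooth_on_difference_quotient:
  fixes s :: "'k::dense_unit_ring \<Rightarrow> 'v::{ab_group_add,t2_space} \<Rightarrow> 'v"
    and s' :: "'k \<Rightarrow> 'w::{ab_group_add,t2_space} \<Rightarrow> 'w"
  assumes s: "topological_module s" and s': "topological_module s'" and f: "smooth_on s s' U f"
  shows "\<exists>g. smooth_quotient s s' U f g"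
proof -
  interpret V: topological_module s by fact
  interpret W: topological_module s' by fact
  have U: "open U" by (rule smooth_on_open) fact
  let ?B = "Base ` U :: ('v, 'k) jet set"
  let ?Q = "quotient_domain s 0 ?B"
  let ?U1 = "{(x, v, t). x \<in> U \<and> x + s t v \<in> U}"
  \<comment> \<open>the quotient that is selected in the definition of \<open>differential\<close>\<close>
  define f1 where "f1 = (SOME f1. difference_quotient s s' 0 ?B (f \<circ> base) f1)"
  have "C_jet s s' (Suc 0) 0 ?B (f \<circ> base)" using f unfolding smooth_on_def by blast
  then have dq: "difference_quotient s s' 0 ?B (f \<circ> base) f1"
    unfolding f1_def by (intro someI_ex[of "difference_quotient s s' 0 ?B (f \<circ> base)"]) auto
  have C1: "C_jet s s' j (Suc 0) ?Q f1" for j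
  proof -
    have "C_jet s s' (Suc j) 0 ?B (f \<circ> base)" using f unfolding smooth_on_def by blast
    then obtain h where "difference_quotient s s' 0 ?B (f \<circ> base) h" "C_jet s s' j (Suc 0) ?Q h" by auto
    then show ?thesis using difference_quotient_unique[OF s s' U _ dq] C_jet_cong by blast
  qed
  define \<rho> where "\<rho> = (\<lambda>z :: ('v \<times> 'v \<times> 'k, 'k) jet.
    Node (Base (fst (base z))) (Base (fst (snd (base z)))) (snd (snd (base z))) :: ('v, 'k) jet)"
  have "jet_linear (prod_scale s (prod_scale s (*))) s 0 (Suc 0) \<rho>"
    unfolding jet_linear_def \<rho>_def
    by (auto intro!: continuous_intros continuous_on_base simp: prod_scale_def)
  then have "C_jet (prod_scale s (prod_scale s (*))) s' j 0 (Base ` ?U1) (\<lambda>z. f1 (\<rho> z))" for j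
    by (rule C_jet_precompose_linear[OF C1]) (auto simp: \<rho>_def)
  then have "smooth_on (prod_scale s (prod_scale s (*))) s' ?U1
      (\<lambda>(x, v, t). f1 (Node (Base x) (Base v) t))"
    using V.open_quotient_domain[OF U] by (simp add: smooth_on_def comp_def \<rho>_def case_prod_beta)
  moreover have "f (x + s t v) - f x = s' t ((\<lambda>(x, v, t). f1 (Node (Base x) (Base v) t)) (x, v, t))"
    if "x \<in> U" "x + s t v \<in> U" for x v t
  proof -
    have "Node (Base x) (Base v) t \<in> ?Q" using that by auto
    then show ?thesis using dq unfolding difference_quotient_def by fastforce
  qed
  moreover have "differential s s' U f x v = (\<lambda>(x, v, t). f1 (Node (Base x) (Base v) t)) (x, v, 0)" for x v
    by (simp add: differential_def f1_def)
  ultimately show ?thesis unfolding smooth_quotient_def by blast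
qed

text \<open>
  The differential can be read off from any continuous \<open>h\<close> with \<open>f (x + t v) - f x = t h(t)\<close>, in
  particular from one that is only defined for \<open>t\<close> near \<open>0\<close>.
\<close>

lemma differential_eqI:
  fixes s :: "'k::dense_unit_ring \<Rightarrow> 'v::{ab_group_add,t2_space} \<Rightarrow> 'v"
    and s' :: "'k \<Rightarrow> 'w::{ab_group_add,t2_space} \<Rightarrow> 'w"
  assumes s: "topological_module s" and s': "topological_module s'" and f: "smooth_on s s' U f"
    and x: "x \<in> U" and N: "open N" "0 \<in> N" and h: "continuous_on N h"
    and eq: "\<And>t. t \<in> N \<Longrightarrow> x + s t v \<in> U \<Longrightarrow> f (x + s t v) - f x = s' t (h t)"
  shows "differential s s' U f x v = h 0"
proof -
  interpret V: topological_module s by fact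
  interpret W: topological_module s' by fact
  obtain g where "smooth_quotient s s' U f g"
    using smooth_on_difference_quotient[OF s s' f] by blast
  note g = smooth_quotientD[OF this]
  let ?N = "N \<inter> {t. x + s t v \<in> U}"
  have "g (x, v, 0) = h 0"
  proof (rule eq_by_dense_units[of ?N])
    show "open ?N" using N V.open_line smooth_on_open[OF f] by blast
    show "continuous_on ?N (\<lambda>t. g (x, v, t))"
      using x by (intro continuous_on_compose2[OF smooth_on_continuous[OF g(1)]] continuous_intros) auto
    show "continuous_on ?N h" using h by (rule continuous_on_subset) simp
    fix u assume "u \<in> ?N" "u dvd 1"
    moreover from this have "s' u (g (x, v, u)) = s' u (h u)" using eq[of u] g(2)[OF x] by simp
    ultimately show "g (x, v, u) = h u" using W.unit_cancel by blast
  qed (use x N in auto)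
  then show ?thesis using g(3)[OF x] by simp
qed

lemma differential_cong:
  assumes "\<And>x. x \<in> U \<Longrightarrow> f x = g x" "U = U'"
  shows "differential s s' U f = differential s s' U' g"
proof -
  have "difference_quotient s s' 0 (Base ` U) (f \<circ> base) f1 = difference_quotient s s' 0 (Base ` U') (g \<circ> base) f1" for f1
  proof -
    have "f (base z) = g (base z)" if "z \<in> Base ` U" for z :: "('a, 'b) jet" using assms(1) that by auto
    then show ?thesis unfolding difference_quotient_def assms(2)[symmetric] quotient_domain_iff o_apply
      by (intro conj_cong refl all_cong1 imp_cong) (auto simp: assms(1))
  qed
  then show ?thesis by (simp add: differential_def fun_eq_iff)
qed

text \<open>
  The difference quotient of \<open>f\<close> on \<open>U\<close> restricts to one on \<open>U'\<close>. Smoothness itself cannot be glued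
  from smaller sets in general; see the remark on composites of maps between manifolds.
\<close>

lemma differential_subset:
  assumes s: "topological_module s" and s': "topological_module s'" and f: "smooth_on s s' U f"
    and "open U'" "U' \<subseteq> U" "x \<in> U'"
  shows "differential s s' U' f x v = differential s s' U f x v"
proof -
  interpret V: topological_module s by fact
  obtain g where "smooth_quotient s s' U f g"
    using smooth_on_difference_quotient[OF s s' f] by blast
  note g = smooth_quotientD[OF this]
  let ?N = "{t. x + s t v \<in> U}"
  have "differential s s' U' f x v = (\<lambda>t. g (x, v, t)) 0"
  proof (rule differential_eqI[OF s s' smooth_on_subset[OF f assms(4,5)] assms(6), where N = ?N])
    show "open ?N" using V.open_line smooth_on_open[OF f] by blast
    show "continuous_on ?N (\<lambda>t. g (x, v, t))"
      using assms by (intro continuous_on_compose2[OF smooth_on_continuous[OF g(1)]] continuous_intros) auto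
  qed (use assms g in auto)
  then show ?thesis using g(3) assms by auto
qed

lemma differential_local:
  assumes s: "topological_module s" and s': "topological_module s'"
    and f: "smooth_on s s' U f" and g: "smooth_on s s' U' g"
    and "open W" "x \<in> W" "W \<subseteq> U" "W \<subseteq> U'" "\<And>y. y \<in> W \<Longrightarrow> f y = g y"
  shows "differential s s' U f x v = differential s s' U' g x v"
  using differential_subset[OF s s' f assms(5,7,6)] differential_subset[OF s s' g assms(5,8,6)]
    differential_cong[of W f g W s s'] assms(9) by metis

lemma differential_linear:
  assumes "topological_module s" "topological_module s'" "continuous_linear s s' l" "open U" "x \<in> U"
  shows "differential s s' U l x v = l v"
  by (rule differential_eqI[OF assms(1,2) smooth_on_linear[OF assms(1-4)] assms(5), where N = UNIV and h = "\<lambda>_. l v"])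
    (use assms(3) in \<open>auto simp: continuous_linear_def\<close>)

lemma differential_id:
  assumes "topological_module s" "open U" "x \<in> U"
  shows "differential s s U (\<lambda>x. x) x v = v"
  by (rule differential_linear[OF assms(1,1) _ assms(2,3)]) (simp add: continuous_linear_def continuous_on_id)

lemma differential_const:
  assumes "topological_module s" "topological_module s'" "open U" "x \<in> U"
  shows "differential s s' U (\<lambda>_. c) x v = 0"
proof -
  interpret W: topological_module s' by fact
  show ?thesis
    by (rule differential_eqI[OF assms(1,2) smooth_on_const[OF assms(2,3)] assms(4), where N = UNIV and h = "\<lambda>_. 0"])
      auto
qed

lemma differential_Pair:
  assumes s: "topological_module s" and s': "topological_module s'" and s'': "topological_module s''"
    and f: "smooth_on s s' U f" and g: "smooth_on s s'' U g" and x: "x \<in> U"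
  shows "differential s (prod_scale s' s'') U (\<lambda>x. (f x, g x)) x v
    = (differential s s' U f x v, differential s s'' U g x v)"
proof -
  interpret V: topological_module s by fact
  obtain f1 where "smooth_quotient s s' U f f1"
    using smooth_on_difference_quotient[OF s s' f] by blast
  note f1 = smooth_quotientD[OF this]
  obtain g1 where "smooth_quotient s s'' U g g1"
    using smooth_on_difference_quotient[OF s s'' g] by blast
  note g1 = smooth_quotientD[OF this]
  let ?N = "{t. x + s t v \<in> U}"
  have "differential s (prod_scale s' s'') U (\<lambda>x. (f x, g x)) x v = (\<lambda>t. (f1 (x, v, t), g1 (x, v, t))) 0"
  proof (rule differential_eqI[OF s topological_module_prod[OF s' s''] smooth_on_Pair[OF f g] x, where N = ?N])
    show "open ?N" using V.open_line smooth_on_open[OF f] by blast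
    show "continuous_on ?N (\<lambda>t. (f1 (x, v, t), g1 (x, v, t)))"
      using x by (intro continuous_on_Pair continuous_on_compose2[OF smooth_on_continuous[OF f1(1)]]
        continuous_on_compose2[OF smooth_on_continuous[OF g1(1)]] continuous_on_const continuous_on_id) auto
  qed (use x f1 g1 in \<open>auto simp: prod_scale_def\<close>)
  then show ?thesis using f1(3) g1(3) x by auto
qed

lemma differential_compose:
  assumes s: "topological_module s" and s': "topological_module s'" and s'': "topological_module s''"
    and f: "smooth_on s s' U f" and g: "smooth_on s' s'' U' g" and fU: "f ` U \<subseteq> U'" and x: "x \<in> U"
  shows "differential s s'' U (\<lambda>x. g (f x)) x v
    = differential s' s'' U' g (f x) (differential s s' U f x v)"
proof -
  interpret V: topological_module s by fact
  obtain f1 where "smooth_quotient s s' U f f1"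
    using smooth_on_difference_quotient[OF s s' f] by blast
  note f1 = smooth_quotientD[OF this]
  obtain g1 where "smooth_quotient s' s'' U' g g1"
    using smooth_on_difference_quotient[OF s' s'' g] by blast
  note g1 = smooth_quotientD[OF this]
  let ?N = "{t. x + s t v \<in> U}"
  have step: "f (x + s t v) = f x + s' t (f1 (x, v, t))" if "x + s t v \<in> U" for t
    using f1(2)[OF x that] by (simp add: algebra_simps)
  then have inU': "f x + s' t (f1 (x, v, t)) \<in> U'" "f x \<in> U'" if "x + s t v \<in> U" for t
    using fU that x by (metis image_subset_iff)+
  have "differential s s'' U (\<lambda>x. g (f x)) x v = (\<lambda>t. g1 (f x, f1 (x, v, t), t)) 0"
  proof (rule differential_eqI[OF s s'' smooth_on_compose[OF s s' s'' f g fU] x, where N = ?N])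
    show "open ?N" using V.open_line smooth_on_open[OF f] by blast
    have c: "continuous_on ?N (\<lambda>t. f1 (x, v, t))"
      using x by (intro continuous_on_compose2[OF smooth_on_continuous[OF f1(1)]] continuous_intros) auto
    show "continuous_on ?N (\<lambda>t. g1 (f x, f1 (x, v, t), t))"
      using inU' by (intro continuous_on_compose2[OF smooth_on_continuous[OF g1(1)]] continuous_on_Pair c
        continuous_on_const continuous_on_id) auto
    fix t assume "x + s t v \<in> U"
    then show "g (f (x + s t v)) - g (f x) = s'' t (g1 (f x, f1 (x, v, t), t))"
      using step inU' g1(2) by simp
  qed (use x in auto)
  moreover have "f x \<in> U'" using fU x by auto
  ultimately show ?thesis using f1(3) g1(3) x by auto
qed

text \<open>
  Go from \<open>x\<close> to \<open>x + t v + t w\<close> in two steps: \<open>h(t) = f\<^sup>[\<^sup>1\<^sup>](x, v, t) + f\<^sup>[\<^sup>1\<^sup>](x + t v, w, t)\<close>.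
\<close>

lemma differential_add:
  assumes s: "topological_module s" and s': "topological_module s'" and f: "smooth_on s s' U f" and x: "x \<in> U"
  shows "differential s s' U f x (v + w) = differential s s' U f x v + differential s s' U f x w"
proof -
  interpret V: topological_module s by fact
  interpret W: topological_module s' by fact
  obtain f1 where "smooth_quotient s s' U f f1"
    using smooth_on_difference_quotient[OF s s' f] by blast
  note f1 = smooth_quotientD[OF this]
  have U: "open U" by (rule smooth_on_open) fact
  let ?N = "{t. x + s t v \<in> U} \<inter> {t. x + s t (v + w) \<in> U}"
  have "differential s s' U f x (v + w) = (\<lambda>t. f1 (x, v, t) + f1 (x + s t v, w, t)) 0"
  proof (rule differential_eqI[OF s s' f x, where N = ?N])
    show "open ?N" using V.open_line U by blast
    show "continuous_on ?N (\<lambda>t. f1 (x, v, t) + f1 (x + s t v, w, t))"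
      using x by (intro W.cont_add continuous_on_compose2[OF smooth_on_continuous[OF f1(1)]]
        continuous_on_Pair V.cont_add V.cont_scale continuous_on_const continuous_on_id)
        (auto simp: V.scale_right_distrib add.assoc)
    fix t assume t: "t \<in> ?N"
    have e: "x + s t (v + w) = (x + s t v) + s t w" by (simp add: V.scale_right_distrib add.assoc)
    have "x + s t v \<in> U" using t by simp
    moreover have "(x + s t v) + s t w \<in> U" using t e by (metis (mono_tags) IntD2 mem_Collect_eq)
    ultimately have "f ((x + s t v) + s t w) - f (x + s t v) = s' t (f1 (x + s t v, w, t))"
      "f (x + s t v) - f x = s' t (f1 (x, v, t))"
      using x f1(2) by blast+
    then show "f (x + s t (v + w)) - f x = s' t (f1 (x, v, t) + f1 (x + s t v, w, t))"
      unfolding e by (simp add: W.scale_right_distrib algebra_simps)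
  qed (use x in auto)
  then show ?thesis using f1(3) x by auto
qed

text \<open>
  The increments \<open>t (r v)\<close> and \<open>(t r) v\<close> coincide: \<open>h(t) = r f\<^sup>[\<^sup>1\<^sup>](x, v, t r)\<close>.
\<close>

lemma differential_scale:
  assumes s: "topological_module s" and s': "topological_module s'" and f: "smooth_on s s' U f" and x: "x \<in> U"
  shows "differential s s' U f x (s r v) = s' r (differential s s' U f x v)"
proof -
  interpret V: topological_module s by fact
  interpret W: topological_module s' by fact
  obtain f1 where "smooth_quotient s s' U f f1"
    using smooth_on_difference_quotient[OF s s' f] by blast
  note f1 = smooth_quotientD[OF this]
  have U: "open U" by (rule smooth_on_open) fact
  let ?N = "{t. x + s t (s r v) \<in> U}"
  have "differential s s' U f x (s r v) = (\<lambda>t. s' r (f1 (x, v, t * r))) 0"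
  proof (rule differential_eqI[OF s s' f x, where N = ?N])
    show "open ?N" using V.open_line U by blast
    show "continuous_on ?N (\<lambda>t. s' r (f1 (x, v, t * r)))"
      using x by (intro W.cont_scale continuous_on_compose2[OF smooth_on_continuous[OF f1(1)]]
        continuous_on_Pair topological_module.cont_scale[OF topological_module_ring]
        continuous_on_const continuous_on_id) auto
    fix t assume t: "t \<in> ?N"
    then show "f (x + s t (s r v)) - f x = s' t (s' r (f1 (x, v, t * r)))"
      using f1(2)[of x "t * r" v] x by auto
  qed (use x in auto)
  then show ?thesis using f1(3) x by auto
qed

lemma differential_zero:
  assumes "topological_module s" "topological_module s'" "smooth_on s s' U f" "x \<in> U"
  shows "differential s s' U f x 0 = 0"
  using differential_add[OF assms, of 0 0] by simp

lemma differential_minus: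
  assumes "topological_module s" "topological_module s'" "smooth_on s s' U f" "x \<in> U"
  shows "differential s s' U f x (- v) = - differential s s' U f x v"
proof -
  have "differential s s' U f x (- v) + differential s s' U f x v = 0"
    using differential_add[OF assms, of "- v" v] differential_zero[OF assms] by simp
  then show ?thesis by (simp add: eq_neg_iff_add_eq_0)
qed

definition tangent_rep ::
  "('k::dense_unit_ring \<Rightarrow> 'v::{ab_group_add,t2_space} \<Rightarrow> 'v) \<Rightarrow>
   ('k \<Rightarrow> 'w::{ab_group_add,t2_space} \<Rightarrow> 'w) \<Rightarrow> 'v set \<Rightarrow> ('v \<Rightarrow> 'w) \<Rightarrow> 'v \<times> 'v \<Rightarrow> 'w \<times> 'w" where
  "tangent_rep s s' U f = (\<lambda>(x, v). (f x, differential s s' U f x v))"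

lemma smooth_on_differential:
  assumes s: "topological_module s" and s': "topological_module s'" and f: "smooth_on s s' U f"
  shows "smooth_on (prod_scale s s) s' (U \<times> UNIV) (\<lambda>(x, v). differential s s' U f x v)"
proof -
  interpret V: topological_module s by fact
  obtain f1 where "smooth_quotient s s' U f f1"
    using smooth_on_difference_quotient[OF s s' f] by blast
  note f1 = smooth_quotientD[OF this]
  note tm = s s' topological_module_ring topological_module_prod
  have "open (U \<times> UNIV)" using smooth_on_open[OF f] by (intro open_Times) auto
  then have "smooth_on (prod_scale s s) (prod_scale s (prod_scale s (*))) (U \<times> UNIV) (\<lambda>p. (fst p, snd p, 0))"
    by (intro smooth_on_Pair smooth_on_linear continuous_linear_fst continuous_linear_snd smooth_on_const tm)
  then have "smooth_on (prod_scale s s) s' (U \<times> UNIV) (\<lambda>p. f1 (fst p, snd p, 0))"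
    by (rule smooth_on_compose[rotated 3, OF _ f1(1)]) (auto intro!: tm)
  then show ?thesis by (rule smooth_on_cong) (use f1(3) in auto)
qed

lemma smooth_on_tangent_rep:
  assumes s: "topological_module s" and s': "topological_module s'" and f: "smooth_on s s' U f"
  shows "smooth_on (prod_scale s s) (prod_scale s' s') (U \<times> UNIV) (tangent_rep s s' U f)"
proof -
  have U: "open (U \<times> (UNIV :: 'b set))" using smooth_on_open[OF f] by (intro open_Times) auto
  have "smooth_on (prod_scale s s) s' (U \<times> UNIV) (\<lambda>p. f (fst p))"
    by (rule smooth_on_compose[OF topological_module_prod[OF s s] s s' smooth_on_linear f])
      (auto intro!: continuous_linear_fst topological_module_prod s U)
  from smooth_on_Pair[OF this smooth_on_differential[OF assms]] show ?thesis
    by (simp add: tangent_rep_def case_prod_unfold)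
qed

section \<open>The second differential\<close>

definition second_differential ::
  "('k::dense_unit_ring \<Rightarrow> 'v::{ab_group_add,t2_space} \<Rightarrow> 'v) \<Rightarrow>
   ('k \<Rightarrow> 'w::{ab_group_add,t2_space} \<Rightarrow> 'w) \<Rightarrow> 'v set \<Rightarrow> ('v \<Rightarrow> 'w) \<Rightarrow> 'v \<Rightarrow> 'v \<Rightarrow> 'v \<Rightarrow> 'w" where
  "second_differential s s' U f x u v = differential s s' U (\<lambda>y. differential s s' U f y u) x v"

lemma smooth_on_slice:
  assumes s: "topological_module s" and s': "topological_module s'" and "open U"
  shows "smooth_on s (prod_scale s s') U (\<lambda>y. (y, u))"
  using assms by (intro smooth_on_Pair smooth_on_id smooth_on_const)

lemma smooth_on_differential_fixed:
  assumes s: "topological_module s" and s': "topological_module s'" and f: "smooth_on s s' U f"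
  shows "smooth_on s s' U (\<lambda>y. differential s s' U f y u)"
  using smooth_on_compose[OF s topological_module_prod[OF s s] s' smooth_on_slice[OF s s smooth_on_open[OF f]]
    smooth_on_differential[OF assms]] by auto

text \<open>
  Split the direction \<open>(v, w)\<close> as \<open>(v, 0) + (0, w)\<close>. The first part is the second differential by
  definition, the second one is the differential of the linear map \<open>df(x)\<close>.
\<close>

lemma differential_of_differential:
  assumes s: "topological_module s" and s': "topological_module s'" and f: "smooth_on s s' U f" and x: "x \<in> U"
  shows "differential (prod_scale s s) s' (U \<times> UNIV) (\<lambda>(x, v). differential s s' U f x v) (x, u) (v, w)
    = second_differential s s' U f x u v + differential s s' U f x w"
proof -
  note ss = topological_module_prod[OF s s]
  let ?d = "\<lambda>(x, v). differential s s' U f x v"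
  have U: "open U" by (rule smooth_on_open) fact
  have d: "smooth_on (prod_scale s s) s' (U \<times> UNIV) ?d" by (rule smooth_on_differential) fact+
  have "second_differential s s' U f x u v = differential s s' U (\<lambda>y. ?d (y, u)) x v"
    by (simp add: second_differential_def)
  also have "\<dots> = differential (prod_scale s s) s' (U \<times> UNIV) ?d (x, u) (differential s (prod_scale s s) U (\<lambda>y. (y, u)) x v)"
    by (rule differential_compose[OF s ss s' smooth_on_slice[OF s s U] d]) (use x in auto)
  also have "differential s (prod_scale s s) U (\<lambda>y. (y, u)) x v = (v, 0)"
    using differential_Pair[OF s s s smooth_on_id[OF s U] smooth_on_const[OF s U] x]
      differential_id[OF s U x] differential_const[OF s s U x] by simp
  finally have 1: "differential (prod_scale s s) s' (U \<times> UNIV) ?d (x, u) (v, 0)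
      = second_differential s s' U f x u v" by simp
  have slice: "smooth_on s (prod_scale s s) UNIV (\<lambda>y. (x, y))"
    by (intro smooth_on_Pair smooth_on_id smooth_on_const s) auto
  have lin: "continuous_linear s s' (\<lambda>w. differential s s' U f x w)"
  proof -
    have "continuous_on UNIV (\<lambda>w. ?d (x, w))"
      by (rule continuous_on_compose2[OF smooth_on_continuous[OF d]]) (use x in \<open>auto intro!: continuous_intros\<close>)
    then show ?thesis using differential_add[OF s s' f x] differential_scale[OF s s' f x]
      by (simp add: continuous_linear_def)
  qed
  have "differential s s' U f x w = differential s s' UNIV (\<lambda>y. ?d (x, y)) u w"
    using differential_linear[OF s s' lin, of UNIV u w] by simp
  also have "\<dots> = differential (prod_scale s s) s' (U \<times> UNIV) ?d (x, u) (differential s (prod_scale s s) UNIV (\<lambda>y. (x, y)) u w)"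
    by (rule differential_compose[OF s ss s' slice d]) (use x in auto)
  also have "differential s (prod_scale s s) UNIV (\<lambda>y. (x, y)) u w = (0, w)"
    using differential_Pair[OF s s s smooth_on_const[OF s] smooth_on_id[OF s]]
      differential_id[OF s] differential_const[OF s s] by simp
  finally have 2: "differential (prod_scale s s) s' (U \<times> UNIV) ?d (x, u) (0, w) = differential s s' U f x w"
    by simp
  show ?thesis using differential_add[OF ss s' d, of "(x, u)" "(v, 0)" "(0, w)"] 1 2 x by simp
qed

lemma differential_tangent_rep:
  assumes s: "topological_module s" and s': "topological_module s'" and f: "smooth_on s s' U f" and x: "x \<in> U"
  shows "differential (prod_scale s s) (prod_scale s' s') (U \<times> UNIV) (tangent_rep s s' U f) (x, u) (v, w)
    = (differential s s' U f x v, second_differential s s' U f x u v + differential s s' U f x w)"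
proof -
  note ss = topological_module_prod[OF s s]
  have U: "open U" by (rule smooth_on_open) fact
  then have U2: "open (U \<times> (UNIV :: 'b set))" by (intro open_Times) auto
  have fst: "smooth_on (prod_scale s s) s (U \<times> UNIV) fst"
    by (rule smooth_on_linear[OF ss s continuous_linear_fst U2])
  have ff: "smooth_on (prod_scale s s) s' (U \<times> UNIV) (\<lambda>p. f (fst p))"
    by (rule smooth_on_compose[OF ss s s' fst f]) auto
  have "differential (prod_scale s s) s' (U \<times> UNIV) (\<lambda>p. f (fst p)) (x, u) (v, w) = differential s s' U f x v"
    using differential_compose[OF ss s s' fst f, of "(x, u)" "(v, w)"]
      differential_linear[OF ss s continuous_linear_fst U2, of "(x, u)" "(v, w)"] x by auto
  then show ?thesis
    using differential_Pair[OF ss s' s' ff smooth_on_differential[OF s s' f], of "(x, u)" "(v, w)"]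
      differential_of_differential[OF assms] x
    by (simp add: tangent_rep_def case_prod_unfold)
qed

lemma smooth_on_second_differential:
  assumes s: "topological_module s" and s': "topological_module s'" and f: "smooth_on s s' U f"
  shows "smooth_on (prod_scale s (prod_scale s s)) s' (U \<times> UNIV)
    (\<lambda>(x, u, v). second_differential s s' U f x u v)"
proof -
  interpret V: topological_module s by fact
  note tm = s s' topological_module_prod
  let ?d = "\<lambda>(x, v). differential s s' U f x v"
  have U: "open U" by (rule smooth_on_open) fact
  then have U3: "open (U \<times> (UNIV :: ('b \<times> 'b) set))" by (intro open_Times) auto
  have dd: "smooth_on (prod_scale (prod_scale s s) (prod_scale s s)) s' ((U \<times> UNIV) \<times> UNIV)
      (\<lambda>(p, q). differential (prod_scale s s) s' (U \<times> UNIV) ?d p q)"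
    by (intro smooth_on_differential tm f)
  have lin: "continuous_linear (prod_scale s (prod_scale s s)) (prod_scale (prod_scale s s) (prod_scale s s))
      (\<lambda>p. ((fst p, fst (snd p)), (snd (snd p), 0)))"
    by (auto simp: continuous_linear_def prod_scale_def intro!: continuous_intros)
  have sh: "smooth_on (prod_scale s (prod_scale s s)) (prod_scale (prod_scale s s) (prod_scale s s)) (U \<times> UNIV)
      (\<lambda>p. ((fst p, fst (snd p)), (snd (snd p), 0)))"
    by (intro smooth_on_linear tm lin U3)
  have "smooth_on (prod_scale s (prod_scale s s)) s' (U \<times> UNIV)
      (\<lambda>p. (\<lambda>(p, q). differential (prod_scale s s) s' (U \<times> UNIV) ?d p q) ((fst p, fst (snd p)), (snd (snd p), 0)))"
    by (rule smooth_on_compose[OF _ _ _ sh dd]) (auto intro!: tm)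
  then show ?thesis
    by (rule smooth_on_cong) (auto simp: differential_of_differential[OF s s' f] differential_zero[OF s s' f])
qed

text \<open>
  The map \<open>y \<mapsto> d(g \<circ> f)(y)u\<close> is the composite of \<open>y \<mapsto> (f y, df(y)u)\<close> and \<open>(z, w) \<mapsto> dg(z)w\<close>, so the first
  order chain rule applies to it.
\<close>

lemma second_differential_compose:
  assumes s: "topological_module s" and s': "topological_module s'" and s'': "topological_module s''"
    and f: "smooth_on s s' U f" and g: "smooth_on s' s'' U' g" and fU: "f ` U \<subseteq> U'" and x: "x \<in> U"
  shows "second_differential s s'' U (\<lambda>x. g (f x)) x u v
    = second_differential s' s'' U' g (f x) (differential s s' U f x u) (differential s s' U f x v)
      + differential s' s'' U' g (f x) (second_differential s s' U f x u v)"
proof -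
  let ?d = "\<lambda>(x, v). differential s' s'' U' g x v"
  let ?F = "\<lambda>y. (f y, differential s s' U f y u)"
  have df: "smooth_on s s' U (\<lambda>y. differential s s' U f y u)" by (rule smooth_on_differential_fixed) fact+
  have F: "smooth_on s (prod_scale s' s') U ?F" by (rule smooth_on_Pair[OF f df])
  have "second_differential s s'' U (\<lambda>x. g (f x)) x u v = differential s s'' U (\<lambda>y. ?d (?F y)) x v"
    unfolding second_differential_def
    by (rule fun_cong, rule fun_cong, rule differential_cong)
      (auto simp: differential_compose[OF s s' s'' f g fU])
  also have "\<dots> = differential (prod_scale s' s') s'' (U' \<times> UNIV) ?d (?F x) (differential s (prod_scale s' s') U ?F x v)"
    by (rule differential_compose[OF s topological_module_prod[OF s' s'] s'' F smooth_on_differential[OF s' s'' g] _ x])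
      (use fU in auto)
  also have "differential s (prod_scale s' s') U ?F x v = (differential s s' U f x v, second_differential s s' U f x u v)"
    using differential_Pair[OF s s' s' f df x] by (simp add: second_differential_def)
  finally show ?thesis
    using differential_of_differential[OF s' s'' g, of "f x"] fU x by (auto simp: image_subset_iff)
qed

text \<open>
  Schwarz's theorem: the twofold difference quotient
  \<open>(f (x + t u + r v) - f (x + t u) - f (x + r v) + f x) / (t r)\<close> is symmetric for units \<open>t\<close>, \<open>r\<close>,
  and it extends continuously to \<open>(t, r) = (0, 0)\<close>, where its value is the second differential.
\<close>

lemma second_differential_symmetric:
  fixes s :: "'k::dense_unit_ring \<Rightarrow> 'v::{ab_group_add,t2_space} \<Rightarrow> 'v"
    and s' :: "'k \<Rightarrow> 'w::{ab_group_add,t2_space} \<Rightarrow> 'w"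
  assumes s: "topological_module s" and s': "topological_module s'" and f: "smooth_on s s' U f" and x: "x \<in> U"
  shows "second_differential s s' U f x u v = second_differential s s' U f x v u"
proof -
  interpret V: topological_module s by fact
  interpret W: topological_module s' by fact
  have U: "open U" by (rule smooth_on_open) fact
  let ?S = "prod_scale s (prod_scale s (*))"
  let ?U1 = "{(x, v, t). x \<in> U \<and> x + s t v \<in> U}"
  have S: "topological_module ?S" by (intro topological_module_prod topological_module_ring s)
  obtain g where "smooth_quotient s s' U f g"
    using smooth_on_difference_quotient[OF s s' f] by blast
  note g = smooth_quotientD[OF this]
  obtain h where "smooth_quotient ?S s' ?U1 g h"
    using smooth_on_difference_quotient[OF S s' g(1)] by blast
  note h = smooth_quotientD[OF this]
  have hq: "g (y + s r w, z, t) - g (y, z, t) = s' r (h ((y, z, t), (w, 0, 0), r))"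
    if "y \<in> U" "y + s t z \<in> U" "y + s r w \<in> U" "y + s r w + s t z \<in> U" for y w z t r
    using h(2)[of "(y, z, t)" r "(w, 0, 0)"] that by (simp add: prod_scale_def)
  have d2: "second_differential s s' U f x u' v' = h ((x, u', 0), (v', 0, 0), 0)" for u' v'
  proof -
    have "second_differential s s' U f x u' v' = (\<lambda>r. h ((x, u', 0), (v', 0, 0), r)) 0"
      unfolding second_differential_def
    proof (rule differential_eqI[OF s s' smooth_on_differential_fixed[OF s s' f] x, where N = "{r. x + s r v' \<in> U}"
        and h = "\<lambda>r. h ((x, u', 0), (v', 0, 0), r)"])
      show "open {r. x + s r v' \<in> U}" using V.open_line[OF U] .
      show "continuous_on {r. x + s r v' \<in> U} (\<lambda>r. h ((x, u', 0), (v', 0, 0), r))"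
        using x by (intro continuous_on_compose2[OF smooth_on_continuous[OF h(1)]] continuous_intros)
          (auto simp: prod_scale_def)
      fix r assume "x + s r v' \<in> U"
      then show "differential s s' U f (x + s r v') u' - differential s s' U f x u' = s' r (h ((x, u', 0), (v', 0, 0), r))"
        using hq[of x 0 u' r v'] g(3) x by simp
    qed (use x in auto)
    then show ?thesis by simp
  qed
  let ?D = "{(t, r). x + s t u \<in> U \<and> x + s r v \<in> U \<and> x + s t u + s r v \<in> U}"
  have "open ?D"
  proof -
    let ?a = "\<lambda>p :: 'k \<times> 'k. x + s (fst p) u" and ?b = "\<lambda>p :: 'k \<times> 'k. x + s (snd p) v"
      and ?c = "\<lambda>p :: 'k \<times> 'k. x + s (fst p) u + s (snd p) v"
    have "continuous_on UNIV ?a" "continuous_on UNIV ?b" "continuous_on UNIV ?c"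
      by (intro V.cont_add V.cont_scale continuous_on_const continuous_on_fst continuous_on_snd continuous_on_id)+
    then have "open (?a -` U \<inter> (?b -` U \<inter> ?c -` U))"
      using U by (intro open_Int open_vimage)
    moreover have "?a -` U \<inter> (?b -` U \<inter> ?c -` U) = ?D" by auto
    ultimately show ?thesis by simp
  qed
  moreover have "(0, 0) \<in> ?D" using x by simp
  ultimately obtain N1 N2 where N: "open N1" "open N2" "(0, 0) \<in> N1 \<times> N2" "N1 \<times> N2 \<subseteq> ?D"
    by (rule open_prod_elim)
  then have D: "x + s t u \<in> U" "x + s r v \<in> U" "x + s t u + s r v \<in> U" "x + s r v + s t u \<in> U"
    if "t \<in> N1" "r \<in> N2" for t r
    using that by (auto simp: add.assoc add.commute[of "s r v"])
  \<comment> \<open>the twofold difference quotient, taken first in the direction \<open>u\<close> or first in the direction \<open>v\<close>\<close>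
  let ?\<Phi> = "\<lambda>t r. h ((x, u, t), (v, 0, 0), r)" and ?\<Psi> = "\<lambda>t r. h ((x, v, r), (u, 0, 0), t)"
  have c\<Phi>: "continuous_on (N1 \<times> N2) (\<lambda>p. ?\<Phi> (fst p) (snd p))"
    using D x by (intro continuous_on_compose2[OF smooth_on_continuous[OF h(1)]] continuous_on_Pair
      continuous_on_fst continuous_on_snd continuous_on_id continuous_on_const) (auto simp: prod_scale_def)
  have c\<Psi>: "continuous_on (N1 \<times> N2) (\<lambda>p. ?\<Psi> (fst p) (snd p))"
    using D x by (intro continuous_on_compose2[OF smooth_on_continuous[OF h(1)]] continuous_on_Pair
      continuous_on_fst continuous_on_snd continuous_on_id continuous_on_const) (auto simp: prod_scale_def)
  have units: "?\<Phi> t r = ?\<Psi> t r" if tr: "t \<in> N1" "r \<in> N2" "t dvd 1" "r dvd 1" for t r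
  proof -
    have "s' t (s' r (?\<Phi> t r)) = s' t (g (x + s r v, u, t) - g (x, u, t))"
      using hq[of x t u r v] D[OF tr(1,2)] x by simp
    also have "\<dots> = (f (x + s r v + s t u) - f (x + s r v)) - (f (x + s t u) - f x)"
      using g(2)[of "x + s r v" t u] g(2)[of x t u] D[OF tr(1,2)] x by (simp add: W.scale_right_diff_distrib)
    also have "\<dots> = (f (x + s t u + s r v) - f (x + s t u)) - (f (x + s r v) - f x)"
      by (simp add: algebra_simps)
    also have "\<dots> = s' r (g (x + s t u, v, r) - g (x, v, r))"
      using g(2)[of "x + s t u" r v] g(2)[of x r v] D[OF tr(1,2)] x by (simp add: W.scale_right_diff_distrib)
    also have "\<dots> = s' r (s' t (?\<Psi> t r))"
      using hq[of x r v t u] D[OF tr(1,2)] x by simp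
    also have "\<dots> = s' t (s' r (?\<Psi> t r))" by (simp add: mult.commute)
    finally show ?thesis using W.unit_cancel tr(3,4) by blast
  qed
  have zero_left: "?\<Phi> 0 r = ?\<Psi> 0 r" if "r \<in> N2" "r dvd 1" for r
  proof (rule eq_by_dense_units[OF N(1), of 0 "\<lambda>t. ?\<Phi> t r" "\<lambda>t. ?\<Psi> t r"])
    have "continuous_on N1 (\<lambda>t. (t, r))" "(\<lambda>t. (t, r)) ` N1 \<subseteq> N1 \<times> N2"
      using that by (auto intro!: continuous_intros)
    then show "continuous_on N1 (\<lambda>t. ?\<Phi> t r)" "continuous_on N1 (\<lambda>t. ?\<Psi> t r)"
      using continuous_on_compose2[OF c\<Phi>, of N1 "\<lambda>t. (t, r)"] continuous_on_compose2[OF c\<Psi>, of N1 "\<lambda>t. (t, r)"]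
      by simp_all
  qed (use N that units in auto)
  have "?\<Phi> 0 0 = ?\<Psi> 0 0"
  proof (rule eq_by_dense_units[OF N(2), of 0 "\<lambda>r. ?\<Phi> 0 r" "\<lambda>r. ?\<Psi> 0 r"])
    have "continuous_on N2 (\<lambda>r. (0 :: 'k, r))" "(\<lambda>r. (0, r)) ` N2 \<subseteq> N1 \<times> N2"
      using N by (auto intro!: continuous_intros)
    then show "continuous_on N2 (\<lambda>r. ?\<Phi> 0 r)" "continuous_on N2 (\<lambda>r. ?\<Psi> 0 r)"
      using continuous_on_compose2[OF c\<Phi>, of N2 "\<lambda>r. (0, r)"] continuous_on_compose2[OF c\<Psi>, of N2 "\<lambda>r. (0, r)"]
      by simp_all
  qed (use N zero_left in auto)
  then show ?thesis using d2 by simp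
qed

lemma second_differential_bilinear:
  assumes s: "topological_module s" and s': "topological_module s'" and f: "smooth_on s s' U f" and x: "x \<in> U"
  shows "second_differential s s' U f x (u + u') v = second_differential s s' U f x u v + second_differential s s' U f x u' v"
    and "second_differential s s' U f x u (v + v') = second_differential s s' U f x u v + second_differential s s' U f x u v'"
    and "second_differential s s' U f x (s r u) v = s' r (second_differential s s' U f x u v)"
    and "second_differential s s' U f x u (s r v) = s' r (second_differential s s' U f x u v)"
proof -
  note d = smooth_on_differential_fixed[OF s s' f]
  have right: "second_differential s s' U f x u (v + v') = second_differential s s' U f x u v + second_differential s s' U f x u v'"
    "second_differential s s' U f x u (s r v) = s' r (second_differential s s' U f x u v)" for u v v' r
    unfolding second_differential_def
    by (rule differential_add[OF s s' d x], rule differential_scale[OF s s' d x])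
  then show "second_differential s s' U f x u (v + v') = second_differential s s' U f x u v + second_differential s s' U f x u v'"
    "second_differential s s' U f x u (s r v) = s' r (second_differential s s' U f x u v)" by auto
  show "second_differential s s' U f x (u + u') v = second_differential s s' U f x u v + second_differential s s' U f x u' v"
    "second_differential s s' U f x (s r u) v = s' r (second_differential s s' U f x u v)"
    using right second_differential_symmetric[OF assms] by metis+
qed

lemma second_differential_local:
  assumes s: "topological_module s" and s': "topological_module s'"
    and f: "smooth_on s s' U f" and g: "smooth_on s s' U' g"
    and W: "open W" "x \<in> W" "W \<subseteq> U" "W \<subseteq> U'" "\<And>y. y \<in> W \<Longrightarrow> f y = g y"
  shows "second_differential s s' U f x u v = second_differential s s' U' g x u v"
  unfolding second_differential_def
  by (rule differential_local[OF s s' smooth_on_differential_fixed[OF s s' f] smooth_on_differential_fixed[OF s s' g] W(1-4)],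
    rule differential_local[OF s s' f g W(1) _ W(3-5)])


section \<open>Manifolds and maps in charts\<close>

text \<open>
  The part of the structure of a smooth manifold on which the calculus in charts rests; it passes to
  products and to tangent bundles. Chart images are open because the transition from a chart to
  itself is smooth, and smoothness presupposes an open domain.
\<close>

locale smooth_atlas =
  fixes M :: "('k::dense_unit_ring, 'm, 'i, 'v::{ab_group_add,t2_space}) manifold"
  assumes tm: "topological_module (smul M)"
    and points_eq: "points M = (\<Union>i\<in>index M. cdom M i)"
    and chart_inj: "\<And>i. i \<in> index M \<Longrightarrow> inj_on (chart M i) (cdom M i)"
    and cdom_open: "\<And>i. i \<in> index M \<Longrightarrow> openin (mtop M) (cdom M i)"
    and chart_continuous: "\<And>i. i \<in> index M \<Longrightarrow>
      continuous_map (subtopology (mtop M) (cdom M i)) euclidean (chart M i)"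
    and transition_smooth: "\<And>i j. i \<in> index M \<Longrightarrow> j \<in> index M \<Longrightarrow>
      smooth_on (smul M) (smul M) (local_dom M M id i j) (local_rep M M id i j)"

lemma smooth_manifold_atlas:
  assumes "smooth_manifold M"
  shows "smooth_atlas M"
proof (rule smooth_atlas.intro)
  fix i assume i: "i \<in> index M"
  then have h: "openin (mtop M) (cdom M i)"
    "homeomorphic_map (subtopology (mtop M) (cdom M i)) (top_of_set (chart M i ` cdom M i)) (chart M i)"
    using assms by (auto simp: smooth_manifold_def)
  show "openin (mtop M) (cdom M i)" by (rule h)
  then have "points M \<inter> cdom M i = cdom M i" using openin_subset by blast
  then show "inj_on (chart M i) (cdom M i)"
    using homeomorphic_imp_injective_map[OF h(2)] by simp
  show "continuous_map (subtopology (mtop M) (cdom M i)) euclidean (chart M i)"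
    using homeomorphic_imp_continuous_map[OF h(2)] by (simp add: continuous_map_in_subtopology)
qed (use assms in \<open>auto simp: smooth_manifold_def\<close>)

definition smooth_reps ::
  "('k::dense_unit_ring, 'm, 'i, 'v::{ab_group_add,t2_space}) manifold \<Rightarrow>
   ('k, 'n, 'j, 'w::{ab_group_add,t2_space}) manifold \<Rightarrow> ('m \<Rightarrow> 'n) \<Rightarrow> bool" where
  "smooth_reps M N f \<longleftrightarrow> (\<forall>p\<in>points M. f p \<in> points N) \<and>
    (\<forall>i\<in>index M. \<forall>j\<in>index N.
      smooth_on (smul M) (smul N) (local_dom M N f i j) (local_rep M N f i j))"

lemma smooth_map_reps: "smooth_map M N f \<Longrightarrow> smooth_reps M N f"
  by (auto simp: smooth_map_def smooth_reps_def continuous_map_def)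

definition rep_differential ::
  "('k::dense_unit_ring, 'm, 'i, 'v::{ab_group_add,t2_space}) manifold \<Rightarrow>
   ('k, 'n, 'j, 'w::{ab_group_add,t2_space}) manifold \<Rightarrow> ('m \<Rightarrow> 'n) \<Rightarrow> 'i \<Rightarrow> 'j \<Rightarrow> 'm \<Rightarrow> 'v \<Rightarrow> 'w" where
  "rep_differential M N f i j p =
    differential (smul M) (smul N) (local_dom M N f i j) (local_rep M N f i j) (chart M i p)"

definition rep_second_differential ::
  "('k::dense_unit_ring, 'm, 'i, 'v::{ab_group_add,t2_space}) manifold \<Rightarrow>
   ('k, 'n, 'j, 'w::{ab_group_add,t2_space}) manifold \<Rightarrow> ('m \<Rightarrow> 'n) \<Rightarrow> 'i \<Rightarrow> 'j \<Rightarrow> 'm \<Rightarrow> 'v \<Rightarrow> 'v \<Rightarrow> 'w" where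
  "rep_second_differential M N f i j p =
    second_differential (smul M) (smul N) (local_dom M N f i j) (local_rep M N f i j) (chart M i p)"

lemma charts_at_iff [simp]: "i \<in> charts_at M p \<longleftrightarrow> i \<in> index M \<and> p \<in> cdom M i"
  by (simp add: charts_at_def)

context smooth_atlas
begin

lemma cdom_points: "i \<in> index M \<Longrightarrow> p \<in> cdom M i \<Longrightarrow> p \<in> points M"
  using points_eq by auto

lemma chart_exists:
  assumes "p \<in> points M"
  obtains i where "i \<in> index M" "p \<in> cdom M i"
  using assms points_eq by auto

lemma inv_chart [simp]: "i \<in> index M \<Longrightarrow> p \<in> cdom M i \<Longrightarrow> inv_into (cdom M i) (chart M i) (chart M i p) = p"
  by (simp add: chart_inj inv_into_f_f)

lemma local_rep_chart:
  assumes "i \<in> index M" "p \<in> cdom M i"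
  shows "local_rep M N f i j (chart M i p) = chart N j (f p)"
  using assms by (simp add: local_rep_def)

lemma chart_in_local_dom:
  assumes "i \<in> index M" "p \<in> cdom M i"
  shows "chart M i p \<in> local_dom M N f i j \<longleftrightarrow> f p \<in> cdom N j"
  using assms chart_inj by (auto simp: local_dom_def inj_on_def)

lemma local_domE:
  assumes "x \<in> local_dom M N f i j"
  obtains p where "p \<in> cdom M i" "f p \<in> cdom N j" "x = chart M i p"
  using assms by (auto simp: local_dom_def)

lemma smooth_reps_id: "smooth_reps M M id"
  using transition_smooth by (auto simp: smooth_reps_def)

lemma local_dom_id_same: "local_dom M M id i i = chart M i ` cdom M i"
  by (auto simp: local_dom_def)

lemma open_chart_image: "i \<in> index M \<Longrightarrow> open (chart M i ` cdom M i)"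
  using smooth_on_open[OF transition_smooth[of i i]] by (simp add: local_dom_id_same)

lemma rep_id_same:
  assumes "i \<in> index M" "p \<in> cdom M i"
  shows "rep_differential M M id i i p u = u" "rep_second_differential M M id i i p u v = 0"
proof -
  let ?U = "local_dom M M id i i"
  have U: "open ?U" by (simp add: local_dom_id_same open_chart_image assms)
  have x: "chart M i p \<in> ?U" using assms by (simp add: local_dom_id_same)
  have eq: "local_rep M M id i i y = y" if "y \<in> ?U" for y
    using that assms by (auto elim!: local_domE simp: local_rep_chart)
  have d: "differential (smul M) (smul M) ?U (local_rep M M id i i) y u = u" if "y \<in> ?U" for y u
    using differential_cong[of ?U "local_rep M M id i i" "\<lambda>y. y" ?U "smul M" "smul M"] eq
      differential_id[OF tm U that] by simp
  then show "rep_differential M M id i i p u = u" using x by (simp add: rep_differential_def)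
  show "rep_second_differential M M id i i p u v = 0"
    using differential_cong[of ?U "\<lambda>y. differential (smul M) (smul M) ?U (local_rep M M id i i) y u" "\<lambda>y. u" ?U "smul M" "smul M"]
      d differential_const[OF tm tm U x]
    by (simp add: rep_second_differential_def second_differential_def)
qed

end

lemma smooth_reps_smooth_on:
  "smooth_reps M N f \<Longrightarrow> i \<in> index M \<Longrightarrow> j \<in> index N \<Longrightarrow>
    smooth_on (smul M) (smul N) (local_dom M N f i j) (local_rep M N f i j)"
  by (simp add: smooth_reps_def)

lemma smooth_reps_points: "smooth_reps M N f \<Longrightarrow> p \<in> points M \<Longrightarrow> f p \<in> points N"
  by (simp add: smooth_reps_def)

text \<open>
  Smoothness is not a local property over rings with non-units. For instance, over the dual numbers
  \<open>\<real>[\<epsilon>]\<close> a locally constant \<open>f\<close> is smooth near every point, but \<open>f (x + \<epsilon> v) - f x\<close> need not be divisible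
  by \<open>\<epsilon>\<close>. For this reason the composite of two maps with smooth representatives need not have smooth
  representatives. What remains true is the following: near a given point the composite of the
  representatives is smooth, and the chain rules hold there.
\<close>

lemma local_composite:
  assumes M: "smooth_atlas M" and N: "smooth_atlas N" and P: "smooth_atlas P"
    and f: "smooth_reps M N f" and g: "smooth_reps N P g"
    and i: "i \<in> index M" "p \<in> cdom M i" and j: "j \<in> index N" "f p \<in> cdom N j"
    and k: "k \<in> index P" "g (f p) \<in> cdom P k"
  shows "\<exists>W. open W \<and> chart M i p \<in> W \<and> W \<subseteq> chart M i ` cdom M i \<and>
    (\<forall>W'. open W' \<longrightarrow> chart M i p \<in> W' \<longrightarrow> W' \<subseteq> W \<longrightarrow>
      smooth_on (smul M) (smul P) W' (\<lambda>y. chart P k (g (f (inv_into (cdom M i) (chart M i) y)))) \<and>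
      differential (smul M) (smul P) W' (\<lambda>y. chart P k (g (f (inv_into (cdom M i) (chart M i) y)))) (chart M i p) u
        = rep_differential N P g j k (f p) (rep_differential M N f i j p u) \<and>
      second_differential (smul M) (smul P) W' (\<lambda>y. chart P k (g (f (inv_into (cdom M i) (chart M i) y)))) (chart M i p) u v
        = rep_second_differential N P g j k (f p) (rep_differential M N f i j p u) (rep_differential M N f i j p v)
          + rep_differential N P g j k (f p) (rep_second_differential M N f i j p u v))"
proof -
  interpret M: smooth_atlas M by fact
  interpret N: smooth_atlas N by fact
  interpret P: smooth_atlas P by fact
  let ?U = "local_dom M N f i j" and ?f = "local_rep M N f i j"
  let ?V = "local_dom N P g j k" and ?g = "local_rep N P g j k"
  have sf: "smooth_on (smul M) (smul N) ?U ?f" and sg: "smooth_on (smul N) (smul P) ?V ?g"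
    using f g i j k by (auto intro: smooth_reps_smooth_on)
  define W where "W = ?U \<inter> ?f -` ?V"
  have W: "open W" unfolding W_def
    by (rule continuous_open_preimage[OF smooth_on_continuous[OF sf] smooth_on_open[OF sf] smooth_on_open[OF sg]])
  have x: "chart M i p \<in> ?U" and fx: "?f (chart M i p) = chart N j (f p)"
    using i j by (auto simp: M.chart_in_local_dom M.local_rep_chart)
  then have xW: "chart M i p \<in> W" using j k by (simp add: W_def N.chart_in_local_dom)
  have WU: "W \<subseteq> chart M i ` cdom M i" by (auto simp: W_def local_dom_def)
  have comp: "?g (?f y) = chart P k (g (f (inv_into (cdom M i) (chart M i) y)))" if "y \<in> W" for y
    using that i j by (auto simp: W_def M.local_rep_chart N.local_rep_chart elim!: M.local_domE)
  show ?thesis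
  proof (intro exI[of _ W] conjI W xW WU allI impI)
    fix W' assume W': "open W'" "chart M i p \<in> W'" "W' \<subseteq> W"
    let ?h = "\<lambda>y. chart P k (g (f (inv_into (cdom M i) (chart M i) y)))"
    have sub: "W' \<subseteq> ?U" "?f ` W' \<subseteq> ?V" using W' by (auto simp: W_def)
    have sf': "smooth_on (smul M) (smul N) W' ?f" by (rule smooth_on_subset[OF sf W'(1) sub(1)])
    have h: "?g (?f y) = ?h y" if "y \<in> W'" for y using comp that W' by blast
    have sc: "smooth_on (smul M) (smul P) W' (\<lambda>y. ?g (?f y))"
      by (rule smooth_on_compose[OF M.tm N.tm P.tm sf' sg sub(2)])
    then show sh: "smooth_on (smul M) (smul P) W' ?h" by (rule smooth_on_cong) (rule h)
    have df: "differential (smul M) (smul N) W' ?f (chart M i p) u = rep_differential M N f i j p u" for u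
      using differential_subset[OF M.tm N.tm sf W'(1) sub(1) W'(2)] by (simp add: rep_differential_def)
    have ddf: "second_differential (smul M) (smul N) W' ?f (chart M i p) u v = rep_second_differential M N f i j p u v"
      using second_differential_local[OF M.tm N.tm sf' sf W'(1,2) subset_refl sub(1) refl]
      by (simp add: rep_second_differential_def)
    have "differential (smul M) (smul P) W' ?h (chart M i p) u
        = differential (smul M) (smul P) W' (\<lambda>y. ?g (?f y)) (chart M i p) u"
      by (rule differential_local[OF M.tm P.tm sh sc W'(1,2)]) (auto simp: h)
    also have "\<dots> = rep_differential N P g j k (f p) (rep_differential M N f i j p u)"
      using differential_compose[OF M.tm N.tm P.tm sf' sg sub(2) W'(2)] df fx
      by (simp add: rep_differential_def)
    finally show "differential (smul M) (smul P) W' ?h (chart M i p) u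
      = rep_differential N P g j k (f p) (rep_differential M N f i j p u)" .
    have "second_differential (smul M) (smul P) W' ?h (chart M i p) u v
        = second_differential (smul M) (smul P) W' (\<lambda>y. ?g (?f y)) (chart M i p) u v"
      by (rule second_differential_local[OF M.tm P.tm sh sc W'(1,2)]) (auto simp: h)
    then show "second_differential (smul M) (smul P) W' ?h (chart M i p) u v
        = rep_second_differential N P g j k (f p) (rep_differential M N f i j p u) (rep_differential M N f i j p v)
          + rep_differential N P g j k (f p) (rep_second_differential M N f i j p u v)"
      using second_differential_compose[OF M.tm N.tm P.tm sf' sg sub(2) W'(2), of u v] df ddf fx
      by (simp add: rep_differential_def rep_second_differential_def)
  qed
qed

text \<open>
  Two factorisations of the same map have the same local composite, hence the same first and
  second differentials at a point. Only restrictions of representatives to smaller open sets occur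
  in the proof. The changes of charts, and the identities obtained by differentiating the equations
  for the product of a symmetric space, are instances of this comparison.
\<close>

lemma commuting_square:
  assumes M: "smooth_atlas M" and N: "smooth_atlas N" and N': "smooth_atlas N'" and P: "smooth_atlas P"
    and f: "smooth_reps M N f" and g: "smooth_reps N P g"
    and f': "smooth_reps M N' f'" and g': "smooth_reps N' P g'"
    and i: "i \<in> index M" "p \<in> cdom M i" and j: "j \<in> index N" "f p \<in> cdom N j"
    and j': "j' \<in> index N'" "f' p \<in> cdom N' j'"
    and k: "k \<in> index P" "g (f p) \<in> cdom P k"
    and eq: "\<And>q. q \<in> points M \<Longrightarrow> g (f q) = g' (f' q)"
  shows "rep_differential N P g j k (f p) (rep_differential M N f i j p u)
      = rep_differential N' P g' j' k (f' p) (rep_differential M N' f' i j' p u)" (is ?first)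
    and "rep_second_differential N P g j k (f p) (rep_differential M N f i j p u) (rep_differential M N f i j p v)
        + rep_differential N P g j k (f p) (rep_second_differential M N f i j p u v)
      = rep_second_differential N' P g' j' k (f' p) (rep_differential M N' f' i j' p u) (rep_differential M N' f' i j' p v)
        + rep_differential N' P g' j' k (f' p) (rep_second_differential M N' f' i j' p u v)" (is ?second)
proof -
  interpret M: smooth_atlas M by fact
  interpret P: smooth_atlas P by fact
  have k': "g' (f' p) \<in> cdom P k" using k eq[of p] i M.cdom_points by simp
  let ?h = "\<lambda>y. chart P k (g (f (inv_into (cdom M i) (chart M i) y)))"
  let ?h' = "\<lambda>y. chart P k (g' (f' (inv_into (cdom M i) (chart M i) y)))"
  obtain W where W: "open W" "chart M i p \<in> W" "W \<subseteq> chart M i ` cdom M i"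
    and 1: "\<forall>W'. open W' \<longrightarrow> chart M i p \<in> W' \<longrightarrow> W' \<subseteq> W \<longrightarrow>
      smooth_on (smul M) (smul P) W' ?h \<and>
      differential (smul M) (smul P) W' ?h (chart M i p) u
        = rep_differential N P g j k (f p) (rep_differential M N f i j p u) \<and>
      second_differential (smul M) (smul P) W' ?h (chart M i p) u v
        = rep_second_differential N P g j k (f p) (rep_differential M N f i j p u) (rep_differential M N f i j p v)
          + rep_differential N P g j k (f p) (rep_second_differential M N f i j p u v)"
    using local_composite[OF M N P f g i j k, of u v] by blast
  obtain W2 where W2: "open W2" "chart M i p \<in> W2" "W2 \<subseteq> chart M i ` cdom M i"
    and 2: "\<forall>W'. open W' \<longrightarrow> chart M i p \<in> W' \<longrightarrow> W' \<subseteq> W2 \<longrightarrow>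
      smooth_on (smul M) (smul P) W' ?h' \<and>
      differential (smul M) (smul P) W' ?h' (chart M i p) u
        = rep_differential N' P g' j' k (f' p) (rep_differential M N' f' i j' p u) \<and>
      second_differential (smul M) (smul P) W' ?h' (chart M i p) u v
        = rep_second_differential N' P g' j' k (f' p) (rep_differential M N' f' i j' p u) (rep_differential M N' f' i j' p v)
          + rep_differential N' P g' j' k (f' p) (rep_second_differential M N' f' i j' p u v)"
    using local_composite[OF M N' P f' g' i j' k(1) k', of u v] by blast
  let ?W = "W \<inter> W2"
  have oW: "open ?W" "chart M i p \<in> ?W" using W W2 by auto
  have hh: "?h y = ?h' y" if "y \<in> ?W" for y
  proof -
    have "y \<in> chart M i ` cdom M i" using W that by auto
    then show ?thesis using eq i M.cdom_points by auto
  qed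
  note A = 1[rule_format, OF oW Int_lower1] and B = 2[rule_format, OF oW Int_lower2]
  have sh: "smooth_on (smul M) (smul P) ?W ?h" and sh': "smooth_on (smul M) (smul P) ?W ?h'"
    using A B by auto
  have "differential (smul M) (smul P) ?W ?h (chart M i p) u = differential (smul M) (smul P) ?W ?h' (chart M i p) u"
    by (rule differential_local[OF M.tm P.tm sh sh' oW subset_refl subset_refl]) (rule hh)
  then show ?first using A B by simp
  have "second_differential (smul M) (smul P) ?W ?h (chart M i p) u v
      = second_differential (smul M) (smul P) ?W ?h' (chart M i p) u v"
    by (rule second_differential_local[OF M.tm P.tm sh sh' oW subset_refl subset_refl]) (rule hh)
  then show ?second using A B by simp
qed

lemma rep_differential_linear:
  assumes "smooth_atlas M" "smooth_atlas N" "smooth_reps M N f"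
    "i \<in> index M" "p \<in> cdom M i" "j \<in> index N" "f p \<in> cdom N j"
  shows "rep_differential M N f i j p (u + v) = rep_differential M N f i j p u + rep_differential M N f i j p v"
    and "rep_differential M N f i j p (smul M r u) = smul N r (rep_differential M N f i j p u)"
    and "rep_differential M N f i j p 0 = 0"
    and "rep_differential M N f i j p (- u) = - rep_differential M N f i j p u"
proof -
  have x: "chart M i p \<in> local_dom M N f i j" using assms by (simp add: smooth_atlas.chart_in_local_dom)
  note A = smooth_atlas.tm[OF assms(1)] smooth_atlas.tm[OF assms(2)] smooth_reps_smooth_on[OF assms(3,4,6)] x
  show "rep_differential M N f i j p (u + v) = rep_differential M N f i j p u + rep_differential M N f i j p v"
    "rep_differential M N f i j p (smul M r u) = smul N r (rep_differential M N f i j p u)"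
    "rep_differential M N f i j p 0 = 0"
    "rep_differential M N f i j p (- u) = - rep_differential M N f i j p u"
    unfolding rep_differential_def
    by (simp_all only: differential_add[OF A] differential_scale[OF A] differential_zero[OF A] differential_minus[OF A])
qed

lemma rep_second_differential_bilinear:
  assumes "smooth_atlas M" "smooth_atlas N" "smooth_reps M N f"
    "i \<in> index M" "p \<in> cdom M i" "j \<in> index N" "f p \<in> cdom N j"
  shows "rep_second_differential M N f i j p (u + u') v = rep_second_differential M N f i j p u v + rep_second_differential M N f i j p u' v"
    and "rep_second_differential M N f i j p u (v + v') = rep_second_differential M N f i j p u v + rep_second_differential M N f i j p u v'"
    and "rep_second_differential M N f i j p (smul M r u) v = smul N r (rep_second_differential M N f i j p u v)"
    and "rep_second_differential M N f i j p u (smul M r v) = smul N r (rep_second_differential M N f i j p u v)"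
    and "rep_second_differential M N f i j p u v = rep_second_differential M N f i j p v u"
proof -
  have x: "chart M i p \<in> local_dom M N f i j" using assms by (simp add: smooth_atlas.chart_in_local_dom)
  note A = smooth_atlas.tm[OF assms(1)] smooth_atlas.tm[OF assms(2)] smooth_reps_smooth_on[OF assms(3,4,6)] x
  show "rep_second_differential M N f i j p (u + u') v = rep_second_differential M N f i j p u v + rep_second_differential M N f i j p u' v"
    "rep_second_differential M N f i j p u (v + v') = rep_second_differential M N f i j p u v + rep_second_differential M N f i j p u v'"
    "rep_second_differential M N f i j p (smul M r u) v = smul N r (rep_second_differential M N f i j p u v)"
    "rep_second_differential M N f i j p u (smul M r v) = smul N r (rep_second_differential M N f i j p u v)"
    "rep_second_differential M N f i j p u v = rep_second_differential M N f i j p v u"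
    unfolding rep_second_differential_def
    by (rule second_differential_bilinear[OF A] second_differential_symmetric[OF A])+
qed


section \<open>Tangent vectors\<close>

definition tangent_vector ::
  "('k::dense_unit_ring, 'm, 'i, 'v::{ab_group_add,t2_space}) manifold \<Rightarrow> 'i \<Rightarrow> 'm \<Rightarrow> 'v \<Rightarrow> 'm \<times> ('i \<Rightarrow> 'v)" where
  "tangent_vector M i p u = (p, \<lambda>j\<in>charts_at M p. rep_differential M M id i j p u)"

lemma tangent_vectors_iff:
  "z \<in> tangent_vectors M \<longleftrightarrow> fst z \<in> points M \<and> snd z \<in> extensional (charts_at M (fst z)) \<and>
    (\<forall>i\<in>charts_at M (fst z). \<forall>j\<in>charts_at M (fst z).
      snd z j = rep_differential M M id i j (fst z) (snd z i))"
  by (cases z) (simp add: tangent_vectors_def rep_differential_def)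

lemma tangent_vectors_transition:
  "z \<in> tangent_vectors M \<Longrightarrow> i \<in> charts_at M (fst z) \<Longrightarrow> j \<in> charts_at M (fst z) \<Longrightarrow>
    snd z j = rep_differential M M id i j (fst z) (snd z i)"
  unfolding tangent_vectors_iff by blast

lemma tangent_vectors_point: "z \<in> tangent_vectors M \<Longrightarrow> fst z \<in> points M"
  unfolding tangent_vectors_iff by blast

lemma fst_tangent_vector [simp]: "fst (tangent_vector M i p u) = p"
  by (simp add: tangent_vector_def)

context smooth_atlas
begin

lemma rep_id_cocycle:
  assumes "i \<in> charts_at M p" "j \<in> charts_at M p" "k \<in> charts_at M p"
  shows "rep_differential M M id j k p (rep_differential M M id i j p u) = rep_differential M M id i k p u"
  using commuting_square(1)[OF smooth_atlas_axioms smooth_atlas_axioms smooth_atlas_axioms smooth_atlas_axioms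
      smooth_reps_id smooth_reps_id smooth_reps_id smooth_reps_id, of i p j k k u]
    rep_id_same[of k p] assms by simp

lemma tangent_vector_in: "i \<in> charts_at M p \<Longrightarrow> tangent_vector M i p u \<in> tangent_vectors M"
  using cdom_points by (auto simp: tangent_vectors_iff tangent_vector_def rep_id_cocycle)

lemma tangent_vector_component [simp]: "i \<in> charts_at M p \<Longrightarrow> snd (tangent_vector M i p u) i = u"
  by (simp add: tangent_vector_def rep_id_same)

lemma tangent_vectors_eqI:
  assumes "z \<in> tangent_vectors M" "z' \<in> tangent_vectors M" "fst z = fst z'" "i \<in> charts_at M (fst z)"
    "snd z i = snd z' i"
  shows "z = z'"
proof (rule prod_eqI)
  show "snd z = snd z'"
  proof (rule extensionalityI[of _ "charts_at M (fst z)"])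
    fix j assume "j \<in> charts_at M (fst z)"
    then show "snd z j = snd z' j"
      using tangent_vectors_transition[OF assms(1,4), of j] tangent_vectors_transition[OF assms(2), of i j] assms(3-5)
      by simp
  next
    show "snd z \<in> extensional (charts_at M (fst z))"
      using assms(1) unfolding tangent_vectors_iff by blast
    show "snd z' \<in> extensional (charts_at M (fst z))"
      using assms(2) unfolding tangent_vectors_iff assms(3) by blast
  qed
qed fact

lemma tangent_vector_snd:
  assumes "z \<in> tangent_vectors M" "i \<in> charts_at M (fst z)"
  shows "tangent_vector M i (fst z) (snd z i) = z"
  by (rule tangent_vectors_eqI[OF tangent_vector_in assms(1)]) (use assms in auto)

end

lemma tangent_bundle_simps [simp]:
  "smul (tangent_bundle M) = prod_scale (smul M) (smul M)"
  "index (tangent_bundle M) = index M"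
  "cdom (tangent_bundle M) = tangent_cdom M"
  "chart (tangent_bundle M) = tangent_chart M"
  by (simp_all add: tangent_bundle_def)

lemma tangent_cdom_iff [simp]: "z \<in> tangent_cdom M i \<longleftrightarrow> z \<in> tangent_vectors M \<and> fst z \<in> cdom M i"
  by (auto simp: tangent_cdom_def)

lemma tangent_chart_apply [simp]: "tangent_chart M i z = (chart M i (fst z), snd z i)"
  by (simp add: tangent_chart_def case_prod_beta)

lemma (in smooth_atlas) points_tangent_bundle [simp]: "points (tangent_bundle M) = tangent_vectors M"
proof -
  have "points (tangent_bundle M)
      = \<Union>{tangent_cdom M i \<inter> tangent_chart M i -` W | i W. i \<in> index M \<and> open W}"
    by (simp add: tangent_bundle_def)
  also have "\<dots> = tangent_vectors M"
  proof
    show "tangent_vectors M \<subseteq> \<Union>{tangent_cdom M i \<inter> tangent_chart M i -` W | i W. i \<in> index M \<and> open W}"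
    proof
      fix z assume z: "z \<in> tangent_vectors M"
      then obtain i where "i \<in> index M" "fst z \<in> cdom M i"
        using chart_exists tangent_vectors_point by blast
      then show "z \<in> \<Union>{tangent_cdom M i \<inter> tangent_chart M i -` W | i W. i \<in> index M \<and> open W}"
        using z open_UNIV by (intro UnionI[of "tangent_cdom M i \<inter> tangent_chart M i -` UNIV"]) auto
    qed
  qed auto
  finally show ?thesis .
qed

text \<open>
  Maps between tangent bundles which in charts are given by the differential of a map between the
  manifolds. The identity is treated on a par with tangent maps; it yields the transition maps.
\<close>

definition tangent_lift ::
  "('k::dense_unit_ring, 'm, 'i, 'v::{ab_group_add,t2_space}) manifold \<Rightarrow>
   ('k, 'n, 'j, 'w::{ab_group_add,t2_space}) manifold \<Rightarrow> ('m \<times> ('i \<Rightarrow> 'v) \<Rightarrow> 'n \<times> ('j \<Rightarrow> 'w)) \<Rightarrow>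
   ('m \<Rightarrow> 'n) \<Rightarrow> bool" where
  "tangent_lift M N F f \<longleftrightarrow> (\<forall>z\<in>tangent_vectors M. F z \<in> tangent_vectors N \<and> fst (F z) = f (fst z) \<and>
    (\<forall>i\<in>charts_at M (fst z). \<forall>j\<in>charts_at N (f (fst z)).
      snd (F z) j = rep_differential M N f i j (fst z) (snd z i)))"

lemma tangent_liftD:
  assumes "tangent_lift M N F f" "z \<in> tangent_vectors M"
  shows "F z \<in> tangent_vectors N" "fst (F z) = f (fst z)"
    and "\<lbrakk>i \<in> index M; fst z \<in> cdom M i; j \<in> index N; f (fst z) \<in> cdom N j\<rbrakk> \<Longrightarrow>
      snd (F z) j = rep_differential M N f i j (fst z) (snd z i)"
proof -
  show "F z \<in> tangent_vectors N" "fst (F z) = f (fst z)"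
    using assms unfolding tangent_lift_def by blast+
  have "snd (F z) j = rep_differential M N f i j (fst z) (snd z i)"
    if "i \<in> charts_at M (fst z)" "j \<in> charts_at N (f (fst z))" for i j
    using assms that unfolding tangent_lift_def by blast
  then show "snd (F z) j = rep_differential M N f i j (fst z) (snd z i)"
    if "i \<in> index M" "fst z \<in> cdom M i" "j \<in> index N" "f (fst z) \<in> cdom N j"
    using that unfolding charts_at_iff by blast
qed

lemma tangent_lift_id: "tangent_lift M M id id"
  unfolding tangent_lift_def
  by (intro ballI conjI) (auto intro: tangent_vectors_transition)

lemma (in smooth_atlas) tangent_chart_inj:
  assumes "i \<in> index M"
  shows "inj_on (tangent_chart M i) (tangent_cdom M i)"
proof (rule inj_onI)
  fix z z' assume z: "z \<in> tangent_cdom M i" "z' \<in> tangent_cdom M i" "tangent_chart M i z = tangent_chart M i z'"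
  then have "fst z = fst z'" using chart_inj[OF assms] by (auto simp: inj_on_def)
  then show "z = z'" using z assms by (intro tangent_vectors_eqI[of z z' i]) auto
qed

lemma tangent_lift_local:
  assumes M: "smooth_atlas M" and i: "i \<in> index M" and j: "j \<in> index N" and F: "tangent_lift M N F f"
  shows "local_dom (tangent_bundle M) (tangent_bundle N) F i j = local_dom M N f i j \<times> UNIV"
    and "p \<in> local_dom M N f i j \<times> UNIV \<Longrightarrow>
      local_rep (tangent_bundle M) (tangent_bundle N) F i j p
        = tangent_rep (smul M) (smul N) (local_dom M N f i j) (local_rep M N f i j) p"
proof -
  interpret M: smooth_atlas M by fact
  have ex: "\<exists>z. z \<in> tangent_cdom M i \<and> f (fst z) \<in> cdom N j \<and> tangent_chart M i z = p"
    if "p \<in> local_dom M N f i j \<times> UNIV" for p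
  proof -
    from that have "fst p \<in> local_dom M N f i j" by auto
    then obtain q where "q \<in> cdom M i" "f q \<in> cdom N j" "fst p = chart M i q"
      by (rule M.local_domE)
    then show ?thesis using i
      by (intro exI[of _ "tangent_vector M i q (snd p)"]) (auto simp: M.tangent_vector_in prod_eq_iff)
  qed
  show "local_dom (tangent_bundle M) (tangent_bundle N) F i j = local_dom M N f i j \<times> UNIV"
  proof safe
    fix x u assume "(x, u) \<in> local_dom (tangent_bundle M) (tangent_bundle N) F i j"
    then obtain z where "z \<in> tangent_cdom M i" "F z \<in> tangent_cdom N j" "(x, u) = tangent_chart M i z"
      by (auto simp: local_dom_def)
    then show "x \<in> local_dom M N f i j" using tangent_liftD(2)[OF F] by (auto simp: local_dom_def)
  next
    fix x u assume "x \<in> local_dom M N f i j"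
    then obtain z where z: "z \<in> tangent_cdom M i" "f (fst z) \<in> cdom N j" "tangent_chart M i z = (x, u)"
      using ex[of "(x, u)"] by auto
    then have "F z \<in> tangent_cdom N j" using tangent_liftD[OF F, of z] by simp
    then show "(x, u) \<in> local_dom (tangent_bundle M) (tangent_bundle N) F i j"
      using z(1,3) unfolding local_dom_def by (intro image_eqI[of _ _ z]) auto
  qed simp
  assume p: "p \<in> local_dom M N f i j \<times> UNIV"
  obtain z where z: "z \<in> tangent_cdom M i" "f (fst z) \<in> cdom N j" "tangent_chart M i z = p"
    using ex[OF p] by auto
  have "local_rep (tangent_bundle M) (tangent_bundle N) F i j p = tangent_chart N j (F z)"
    using inv_into_f_f[OF M.tangent_chart_inj[OF i] z(1)] z(3) by (simp add: local_rep_def)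
  also have "\<dots> = (chart N j (f (fst z)), rep_differential M N f i j (fst z) (snd z i))"
    using tangent_liftD(2)[OF F, of z] tangent_liftD(3)[OF F, of z i j] z(1,2) i j by simp
  also have "\<dots> = tangent_rep (smul M) (smul N) (local_dom M N f i j) (local_rep M N f i j) p"
    using z i by (auto simp: tangent_rep_def M.local_rep_chart rep_differential_def case_prod_beta)
  finally show "local_rep (tangent_bundle M) (tangent_bundle N) F i j p
      = tangent_rep (smul M) (smul N) (local_dom M N f i j) (local_rep M N f i j) p" .
qed

lemma tangent_lift_smooth_on:
  assumes M: "smooth_atlas M" and N: "smooth_atlas N" and f: "smooth_reps M N f" and F: "tangent_lift M N F f"
    and i: "i \<in> index M" and j: "j \<in> index N"
  shows "smooth_on (smul (tangent_bundle M)) (smul (tangent_bundle N))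
    (local_dom (tangent_bundle M) (tangent_bundle N) F i j)
    (local_rep (tangent_bundle M) (tangent_bundle N) F i j)"
proof -
  note L = tangent_lift_local[OF M i j F]
  show ?thesis
    unfolding L(1) tangent_bundle_simps
    by (rule smooth_on_cong[OF smooth_on_tangent_rep[OF smooth_atlas.tm[OF M] smooth_atlas.tm[OF N]
          smooth_reps_smooth_on[OF f i j]]]) (rule L(2)[symmetric])
qed

lemma rep_differential_tangent_lift:
  assumes M: "smooth_atlas M" and N: "smooth_atlas N" and f: "smooth_reps M N f" and F: "tangent_lift M N F f"
    and i: "i \<in> index M" and j: "j \<in> index N" and a: "a \<in> tangent_cdom M i" "f (fst a) \<in> cdom N j"
  shows "rep_differential (tangent_bundle M) (tangent_bundle N) F i j a (v, w)
    = (rep_differential M N f i j (fst a) v,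
       rep_second_differential M N f i j (fst a) (snd a i) v + rep_differential M N f i j (fst a) w)"
proof -
  note L = tangent_lift_local[OF M i j F]
  have x: "chart M i (fst a) \<in> local_dom M N f i j" using a i by (simp add: smooth_atlas.chart_in_local_dom M)
  have "rep_differential (tangent_bundle M) (tangent_bundle N) F i j a (v, w)
      = differential (prod_scale (smul M) (smul M)) (prod_scale (smul N) (smul N)) (local_dom M N f i j \<times> UNIV)
        (tangent_rep (smul M) (smul N) (local_dom M N f i j) (local_rep M N f i j)) (chart M i (fst a), snd a i) (v, w)"
    unfolding rep_differential_def L(1) tangent_bundle_simps tangent_chart_apply
    by (rule fun_cong[OF fun_cong[OF differential_cong]]) (auto intro: L(2))
  then show ?thesis
    using differential_tangent_rep[OF smooth_atlas.tm[OF M] smooth_atlas.tm[OF N] smooth_reps_smooth_on[OF f i j] x]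
    by (simp add: rep_differential_def rep_second_differential_def)
qed

lemma smooth_atlas_tangent_bundle:
  assumes "smooth_atlas M"
  shows "smooth_atlas (tangent_bundle M)"
proof -
  interpret smooth_atlas M by fact
  have gen: "openin (mtop (tangent_bundle M)) (tangent_cdom M i \<inter> tangent_chart M i -` W)"
    if "i \<in> index M" "open W" for i W
    unfolding tangent_bundle_def manifold.simps
    by (rule topology_generated_by_Basis) (use that in blast)
  show ?thesis
  proof (rule smooth_atlas.intro)
    show "topological_module (smul (tangent_bundle M))" by (simp add: topological_module_prod tm)
    show "points (tangent_bundle M) = (\<Union>i\<in>index (tangent_bundle M). cdom (tangent_bundle M) i)"
      using tangent_vectors_point[of _ M] points_eq by fastforce
    fix i assume i': "i \<in> index (tangent_bundle M)"
    then have i: "i \<in> index M" by simp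
    show "inj_on (chart (tangent_bundle M) i) (cdom (tangent_bundle M) i)"
      using tangent_chart_inj[OF i] by simp
    show "openin (mtop (tangent_bundle M)) (cdom (tangent_bundle M) i)"
      using gen[OF i open_UNIV] by simp
    show "continuous_map (subtopology (mtop (tangent_bundle M)) (cdom (tangent_bundle M) i)) euclidean
        (chart (tangent_bundle M) i)"
    proof (clarsimp simp: continuous_map_def openin_subtopology simp del: tangent_chart_apply tangent_cdom_iff)
      fix W :: "('d \<times> 'd) set" assume "open W"
      then show "\<exists>T. openin (mtop (tangent_bundle M)) T \<and>
          {z \<in> tangent_vectors M. z \<in> tangent_cdom M i \<and> tangent_chart M i z \<in> W} = T \<inter> tangent_cdom M i"
        using gen[OF i] by (intro exI[of _ "tangent_cdom M i \<inter> tangent_chart M i -` W"]) auto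
    qed
    fix j assume "j \<in> index (tangent_bundle M)"
    then have j: "j \<in> index M" by simp
    show "smooth_on (smul (tangent_bundle M)) (smul (tangent_bundle M))
        (local_dom (tangent_bundle M) (tangent_bundle M) id i j)
        (local_rep (tangent_bundle M) (tangent_bundle M) id i j)"
      by (rule tangent_lift_smooth_on[OF assms assms smooth_reps_id tangent_lift_id i j])
  qed
qed

text \<open>
  By the commuting square with a change of charts at the source, the chart selected in the definition
  of the tangent map may be replaced by any other chart \<open>i\<close>.
\<close>

lemma tangent_map_eq:
  assumes M: "smooth_atlas M" and N: "smooth_atlas N" and f: "smooth_reps M N f"
    and z: "z \<in> tangent_vectors M" and i: "i \<in> charts_at M (fst z)"
  shows "tangent_map M N f z
    = (f (fst z), \<lambda>j\<in>charts_at N (f (fst z)). rep_differential M N f i j (fst z) (snd z i))"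
proof -
  interpret M: smooth_atlas M by fact
  interpret N: smooth_atlas N by fact
  define i' where "i' = (SOME i. i \<in> charts_at M (fst z))"
  have i': "i' \<in> charts_at M (fst z)" unfolding i'_def using i by (rule someI)
  have "rep_differential M N f i' j (fst z) (snd z i') = rep_differential M N f i j (fst z) (snd z i)"
    if j: "j \<in> charts_at N (f (fst z))" for j
  proof -
    have zi: "snd z i' = rep_differential M M id i i' (fst z) (snd z i)"
      by (rule tangent_vectors_transition[OF z i i'])
    have "rep_differential M N f i' j (id (fst z)) (rep_differential M M id i i' (fst z) (snd z i))
        = rep_differential M N f i j (id (fst z)) (rep_differential M M id i i (fst z) (snd z i))"
      by (rule commuting_square(1)[OF M M M N M.smooth_reps_id f M.smooth_reps_id f]) (use i i' j in auto)
    then show ?thesis using i zi by (simp add: M.rep_id_same)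
  qed
  then have "(\<lambda>j\<in>charts_at N (f (fst z)). rep_differential M N f i' j (fst z) (snd z i'))
      = (\<lambda>j\<in>charts_at N (f (fst z)). rep_differential M N f i j (fst z) (snd z i))"
    by (rule restrict_ext)
  moreover have "tangent_map M N f z
      = (f (fst z), \<lambda>j\<in>charts_at N (f (fst z)). rep_differential M N f i' j (fst z) (snd z i'))"
    by (simp add: tangent_map_def case_prod_beta Let_def i'_def rep_differential_def del: charts_at_iff)
  ultimately show ?thesis by simp
qed

lemma tangent_map_in:
  assumes M: "smooth_atlas M" and N: "smooth_atlas N" and f: "smooth_reps M N f"
    and z: "z \<in> tangent_vectors M"
  shows "tangent_map M N f z \<in> tangent_vectors N"
proof -
  interpret M: smooth_atlas M by fact
  interpret N: smooth_atlas N by fact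
  obtain i where i: "i \<in> index M" "fst z \<in> cdom M i" using M.chart_exists tangent_vectors_point[OF z] by blast
  have "rep_differential N N id j k (f (fst z)) (rep_differential M N f i j (fst z) u)
      = rep_differential M N f i k (fst z) u"
    if "j \<in> charts_at N (f (fst z))" "k \<in> charts_at N (f (fst z))" for j k u
  proof -
    have "rep_differential N N id j k (f (fst z)) (rep_differential M N f i j (fst z) u)
      = rep_differential N N id k k (f (fst z)) (rep_differential M N f i k (fst z) u)"
      by (rule commuting_square(1)[OF M N N N f N.smooth_reps_id f N.smooth_reps_id]) (use i that in auto)
    then show ?thesis using that by (simp add: N.rep_id_same)
  qed
  moreover have "f (fst z) \<in> points N" using smooth_reps_points[OF f tangent_vectors_point[OF z]] .
  ultimately show ?thesis using tangent_map_eq[OF M N f z, of i] i by (simp add: tangent_vectors_iff)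
qed

lemma tangent_lift_tangent_map:
  assumes "smooth_atlas M" "smooth_atlas N" "smooth_reps M N f"
  shows "tangent_lift M N (tangent_map M N f) f"
proof -
  have "fst (tangent_map M N f z) = f (fst z)" for z :: "'b \<times> ('c \<Rightarrow> 'd)"
    by (simp add: tangent_map_def case_prod_beta)
  then show ?thesis
    unfolding tangent_lift_def using tangent_map_in[OF assms] tangent_map_eq[OF assms] by simp
qed

lemma smooth_reps_tangent_map:
  assumes M: "smooth_atlas M" and N: "smooth_atlas N" and f: "smooth_reps M N f"
  shows "smooth_reps (tangent_bundle M) (tangent_bundle N) (tangent_map M N f)"
  unfolding smooth_reps_def
proof (intro conjI ballI)
  fix z assume "z \<in> points (tangent_bundle M)"
  then show "tangent_map M N f z \<in> points (tangent_bundle N)"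
    using tangent_map_in[OF assms] by (simp add: smooth_atlas.points_tangent_bundle M N)
qed (rule tangent_lift_smooth_on[OF assms tangent_lift_tangent_map[OF assms]], simp_all)


section \<open>Products of manifolds\<close>

lemma prod_manifold_simps [simp]:
  "mtop (prod_manifold M N) = prod_topology (mtop M) (mtop N)"
  "smul (prod_manifold M N) = prod_scale (smul M) (smul N)"
  "index (prod_manifold M N) = index M \<times> index N"
  "cdom (prod_manifold M N) (i, j) = cdom M i \<times> cdom N j"
  "chart (prod_manifold M N) (i, j) = map_prod (chart M i) (chart N j)"
  by (simp_all add: prod_manifold_def)

lemma smooth_on_fst_snd_compose:
  assumes s: "topological_module s" and t: "topological_module t" and s': "topological_module s'"
    and t': "topological_module t'"
    and f: "smooth_on s s' U f" and g: "smooth_on t t' V g"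
  shows "smooth_on (prod_scale s t) s' (U \<times> V) (\<lambda>p. f (fst p))"
    and "smooth_on (prod_scale s t) t' (U \<times> V) (\<lambda>p. g (snd p))"
    and "x \<in> U \<times> V \<Longrightarrow> differential (prod_scale s t) s' (U \<times> V) (\<lambda>p. f (fst p)) x w = differential s s' U f (fst x) (fst w)"
    and "x \<in> U \<times> V \<Longrightarrow> differential (prod_scale s t) t' (U \<times> V) (\<lambda>p. g (snd p)) x w = differential t t' V g (snd x) (snd w)"
proof -
  note st = topological_module_prod[OF s t]
  have UV: "open (U \<times> V)" using smooth_on_open[OF f] smooth_on_open[OF g] by (rule open_Times)
  have fst: "smooth_on (prod_scale s t) s (U \<times> V) fst"
    by (rule smooth_on_linear[OF st s continuous_linear_fst UV])
  have snd: "smooth_on (prod_scale s t) t (U \<times> V) snd"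
    by (rule smooth_on_linear[OF st t continuous_linear_snd UV])
  show "smooth_on (prod_scale s t) s' (U \<times> V) (\<lambda>p. f (fst p))"
    by (rule smooth_on_compose[OF st s s' fst f]) auto
  show "smooth_on (prod_scale s t) t' (U \<times> V) (\<lambda>p. g (snd p))"
    by (rule smooth_on_compose[OF st t t' snd g]) auto
  show "differential (prod_scale s t) s' (U \<times> V) (\<lambda>p. f (fst p)) x w = differential s s' U f (fst x) (fst w)"
    if x: "x \<in> U \<times> V"
    using differential_compose[OF st s s' fst f _ x, of w] differential_linear[OF st s continuous_linear_fst UV x]
    by auto
  show "differential (prod_scale s t) t' (U \<times> V) (\<lambda>p. g (snd p)) x w = differential t t' V g (snd x) (snd w)"
    if x: "x \<in> U \<times> V"
    using differential_compose[OF st t t' snd g _ x, of w] differential_linear[OF st t continuous_linear_snd UV x]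
    by auto
qed

lemma prod_chart_inj:
  assumes "smooth_atlas M" "smooth_atlas N" "i \<in> index M" "j \<in> index N"
  shows "inj_on (map_prod (chart M i) (chart N j)) (cdom M i \<times> cdom N j)"
  using assms by (intro map_prod_inj_on smooth_atlas.chart_inj)

lemma prod_transition:
  assumes M: "smooth_atlas M" and N: "smooth_atlas N"
    and i: "i \<in> index M" and j: "j \<in> index N"
  shows "local_dom (prod_manifold M N) (prod_manifold M N) id (i, j) (i', j')
      = local_dom M M id i i' \<times> local_dom N N id j j'"
    and "p \<in> local_dom M M id i i' \<times> local_dom N N id j j' \<Longrightarrow>
      local_rep (prod_manifold M N) (prod_manifold M N) id (i, j) (i', j') p
        = (local_rep M M id i i' (fst p), local_rep N N id j j' (snd p))"
proof -
  show "local_dom (prod_manifold M N) (prod_manifold M N) id (i, j) (i', j')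
      = local_dom M M id i i' \<times> local_dom N N id j j'"
    by (auto simp: local_dom_def)
  assume "p \<in> local_dom M M id i i' \<times> local_dom N N id j j'"
  then obtain a b where ab: "a \<in> cdom M i" "b \<in> cdom N j" "p = (chart M i a, chart N j b)"
    by (auto simp: local_dom_def)
  then have "inv_into (cdom M i \<times> cdom N j) (map_prod (chart M i) (chart N j)) p = (a, b)"
    using inv_into_f_f[OF prod_chart_inj[OF M N i j], of "(a, b)"] by simp
  then show "local_rep (prod_manifold M N) (prod_manifold M N) id (i, j) (i', j') p
        = (local_rep M M id i i' (fst p), local_rep N N id j j' (snd p))"
    using ab smooth_atlas.inv_chart[OF M i] smooth_atlas.inv_chart[OF N j] by (simp add: local_rep_def)
qed

lemma smooth_atlas_prod:
  assumes M: "smooth_atlas M" and N: "smooth_atlas N"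
  shows "smooth_atlas (prod_manifold M N)"
proof (rule smooth_atlas.intro)
  interpret M: smooth_atlas M by fact
  interpret N: smooth_atlas N by fact
  show "topological_module (smul (prod_manifold M N))" by (simp add: topological_module_prod M.tm N.tm)
  show "points (prod_manifold M N) = (\<Union>i\<in>index (prod_manifold M N). cdom (prod_manifold M N) i)"
    by (auto simp: M.points_eq N.points_eq)
  fix ij assume "ij \<in> index (prod_manifold M N)"
  then obtain i j where ij: "ij = (i, j)" "i \<in> index M" "j \<in> index N" by auto
  show "inj_on (chart (prod_manifold M N) ij) (cdom (prod_manifold M N) ij)"
    using prod_chart_inj[OF M N ij(2,3)] ij(1) by simp
  show "openin (mtop (prod_manifold M N)) (cdom (prod_manifold M N) ij)"
    using M.cdom_open N.cdom_open ij by (simp add: openin_prod_Times_iff)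
  have "continuous_map (prod_topology (subtopology (mtop M) (cdom M i)) (subtopology (mtop N) (cdom N j)))
      (prod_topology euclidean euclidean) (\<lambda>p. (chart M i (fst p), chart N j (snd p)))"
    by (intro continuous_map_pairedI continuous_map_compose[OF continuous_map_fst, unfolded comp_def]
      continuous_map_compose[OF continuous_map_snd, unfolded comp_def] M.chart_continuous N.chart_continuous ij)
  then show "continuous_map (subtopology (mtop (prod_manifold M N)) (cdom (prod_manifold M N) ij)) euclidean
      (chart (prod_manifold M N) ij)"
    using ij by (simp add: subtopology_Times map_prod_def case_prod_unfold)
  fix ij' assume "ij' \<in> index (prod_manifold M N)"
  then obtain i' j' where ij': "ij' = (i', j')" "i' \<in> index M" "j' \<in> index N" by auto
  note T = prod_transition[OF M N ij(2,3), where i' = i' and j' = j']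
  note S = smooth_on_fst_snd_compose[OF M.tm N.tm M.tm N.tm M.transition_smooth[OF ij(2) ij'(2)]
      N.transition_smooth[OF ij(3) ij'(3)]]
  show "smooth_on (smul (prod_manifold M N)) (smul (prod_manifold M N))
      (local_dom (prod_manifold M N) (prod_manifold M N) id ij ij')
      (local_rep (prod_manifold M N) (prod_manifold M N) id ij ij')"
    unfolding ij(1) ij'(1) T(1) prod_manifold_simps
    by (rule smooth_on_cong[OF smooth_on_Pair[OF S(1,2)]]) (rule T(2)[symmetric])
qed

lemma rep_differential_prod_id:
  assumes M: "smooth_atlas M" and N: "smooth_atlas N"
    and "i \<in> charts_at M p" "i' \<in> charts_at M p" "j \<in> charts_at N q" "j' \<in> charts_at N q"
  shows "rep_differential (prod_manifold M N) (prod_manifold M N) id (i, j) (i', j') (p, q) (u, v)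
    = (rep_differential M M id i i' p u, rep_differential N N id j j' q v)"
proof -
  interpret M: smooth_atlas M by fact
  interpret N: smooth_atlas N by fact
  have ij: "i \<in> index M" "j \<in> index N" "i' \<in> index M" "j' \<in> index N" using assms by auto
  note T = prod_transition[OF M N ij(1,2), where i' = i' and j' = j']
  note S = smooth_on_fst_snd_compose[OF M.tm N.tm M.tm N.tm M.transition_smooth[OF ij(1,3)]
      N.transition_smooth[OF ij(2,4)]]
  let ?U = "local_dom M M id i i' \<times> local_dom N N id j j'"
  have x: "(chart M i p, chart N j q) \<in> ?U"
    using assms by (auto simp: M.chart_in_local_dom N.chart_in_local_dom)
  have "rep_differential (prod_manifold M N) (prod_manifold M N) id (i, j) (i', j') (p, q) (u, v)
    = differential (prod_scale (smul M) (smul N)) (prod_scale (smul M) (smul N)) ?U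
       (\<lambda>p. (local_rep M M id i i' (fst p), local_rep N N id j j' (snd p))) (chart M i p, chart N j q) (u, v)"
    unfolding rep_differential_def T(1) prod_manifold_simps map_prod_simp
    by (rule fun_cong[OF fun_cong[OF differential_cong]]) (auto intro: T(2))
  also have "\<dots> = (rep_differential M M id i i' p u, rep_differential N N id j j' q v)"
    using differential_Pair[OF topological_module_prod[OF M.tm N.tm] M.tm N.tm S(1,2) x] S(3,4)[OF x]
    by (simp add: rep_differential_def)
  finally show ?thesis .
qed

subsection \<open>Maps into and out of products\<close>

text \<open>
  Unlike composites, pairs cause no problem with locality: the representative of a pair in a product
  chart is the pair of the representatives on the intersection of their domains.
\<close>

lemma smooth_reps_Pair:
  assumes A: "smooth_atlas A" and f: "smooth_reps A M f" and g: "smooth_reps A N g"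
  shows "smooth_reps A (prod_manifold M N) (\<lambda>q. (f q, g q))"
proof -
  interpret A: smooth_atlas A by fact
  have "smooth_on (smul A) (prod_scale (smul M) (smul N))
      (local_dom A (prod_manifold M N) (\<lambda>q. (f q, g q)) i (j, k))
      (local_rep A (prod_manifold M N) (\<lambda>q. (f q, g q)) i (j, k))"
    if i: "i \<in> index A" "j \<in> index M" "k \<in> index N" for i j k
  proof -
    let ?U = "local_dom A M f i j \<inter> local_dom A N g i k"
    have dom: "local_dom A (prod_manifold M N) (\<lambda>q. (f q, g q)) i (j, k) = ?U"
      using A.chart_inj[OF i(1)] by (auto simp: local_dom_def inj_on_def)
    have rep: "local_rep A (prod_manifold M N) (\<lambda>q. (f q, g q)) i (j, k)
      = (\<lambda>x. (local_rep A M f i j x, local_rep A N g i k x))"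
      by (auto simp: local_rep_def)
    have sf: "smooth_on (smul A) (smul M) (local_dom A M f i j) (local_rep A M f i j)"
      and sg: "smooth_on (smul A) (smul N) (local_dom A N g i k) (local_rep A N g i k)"
      using f g i by (auto intro: smooth_reps_smooth_on)
    then have "open ?U" by (intro open_Int smooth_on_open)
    then show ?thesis unfolding dom rep
      by (intro smooth_on_Pair smooth_on_subset[OF sf] smooth_on_subset[OF sg]) auto
  qed
  then show ?thesis using f g by (auto simp: smooth_reps_def)
qed

lemma rep_differential_Pair:
  assumes A: "smooth_atlas A" and M: "smooth_atlas M" and N: "smooth_atlas N"
    and f: "smooth_reps A M f" and g: "smooth_reps A N g"
    and i: "i \<in> index A" "p \<in> cdom A i" and j: "j \<in> index M" "f p \<in> cdom M j"
    and k: "k \<in> index N" "g p \<in> cdom N k"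
  shows "rep_differential A (prod_manifold M N) (\<lambda>q. (f q, g q)) i (j, k) p u
      = (rep_differential A M f i j p u, rep_differential A N g i k p u)"
    and "rep_second_differential A (prod_manifold M N) (\<lambda>q. (f q, g q)) i (j, k) p u v
      = (rep_second_differential A M f i j p u v, rep_second_differential A N g i k p u v)"
proof -
  interpret A: smooth_atlas A by fact
  interpret M: smooth_atlas M by fact
  interpret N: smooth_atlas N by fact
  let ?U = "local_dom A M f i j \<inter> local_dom A N g i k" and ?s = "prod_scale (smul M) (smul N)"
  let ?f = "local_rep A M f i j" and ?g = "local_rep A N g i k"
  have dom: "local_dom A (prod_manifold M N) (\<lambda>q. (f q, g q)) i (j, k) = ?U"
    using A.chart_inj[OF i(1)] by (auto simp: local_dom_def inj_on_def)
  have rep: "local_rep A (prod_manifold M N) (\<lambda>q. (f q, g q)) i (j, k) = (\<lambda>x. (?f x, ?g x))"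
    by (auto simp: local_rep_def)
  have sf: "smooth_on (smul A) (smul M) (local_dom A M f i j) ?f"
    and sg: "smooth_on (smul A) (smul N) (local_dom A N g i k) ?g"
    using f g i j k by (auto intro: smooth_reps_smooth_on)
  then have U: "open ?U" by (intro open_Int smooth_on_open)
  have x: "chart A i p \<in> ?U" using i j k by (simp add: A.chart_in_local_dom)
  have sf': "smooth_on (smul A) (smul M) ?U ?f" and sg': "smooth_on (smul A) (smul N) ?U ?g"
    using smooth_on_subset[OF sf U] smooth_on_subset[OF sg U] by auto
  have df: "differential (smul A) (smul M) ?U ?f y u = differential (smul A) (smul M) (local_dom A M f i j) ?f y u"
    if "y \<in> ?U" for y u by (rule differential_subset[OF A.tm M.tm sf U Int_lower1 that])
  have dg: "differential (smul A) (smul N) ?U ?g y u = differential (smul A) (smul N) (local_dom A N g i k) ?g y u"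
    if "y \<in> ?U" for y u by (rule differential_subset[OF A.tm N.tm sg U Int_lower2 that])
  have d: "differential (smul A) ?s ?U (\<lambda>x. (?f x, ?g x)) y u
      = (differential (smul A) (smul M) ?U ?f y u, differential (smul A) (smul N) ?U ?g y u)"
    if "y \<in> ?U" for y u by (rule differential_Pair[OF A.tm M.tm N.tm sf' sg' that])
  show "rep_differential A (prod_manifold M N) (\<lambda>q. (f q, g q)) i (j, k) p u
      = (rep_differential A M f i j p u, rep_differential A N g i k p u)"
    using d[OF x] df[OF x] dg[OF x] by (simp add: rep_differential_def dom rep)
  have "second_differential (smul A) ?s ?U (\<lambda>x. (?f x, ?g x)) (chart A i p) u v
      = differential (smul A) ?s ?U
         (\<lambda>y. (differential (smul A) (smul M) ?U ?f y u, differential (smul A) (smul N) ?U ?g y u)) (chart A i p) v"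
    unfolding second_differential_def
    by (rule fun_cong[OF fun_cong[OF differential_cong]]) (auto simp: d)
  also have "\<dots> = (second_differential (smul A) (smul M) ?U ?f (chart A i p) u v,
      second_differential (smul A) (smul N) ?U ?g (chart A i p) u v)"
    unfolding second_differential_def
    by (rule differential_Pair[OF A.tm M.tm N.tm smooth_on_differential_fixed[OF A.tm M.tm sf']
      smooth_on_differential_fixed[OF A.tm N.tm sg'] x])
  also have "second_differential (smul A) (smul M) ?U ?f (chart A i p) u v = rep_second_differential A M f i j p u v"
    unfolding rep_second_differential_def
    by (rule second_differential_local[OF A.tm M.tm sf' sf U x subset_refl Int_lower1 refl])
  also have "second_differential (smul A) (smul N) ?U ?g (chart A i p) u v = rep_second_differential A N g i k p u v"
    unfolding rep_second_differential_def
    by (rule second_differential_local[OF A.tm N.tm sg' sg U x subset_refl Int_lower2 refl])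
  finally show "rep_second_differential A (prod_manifold M N) (\<lambda>q. (f q, g q)) i (j, k) p u v
      = (rep_second_differential A M f i j p u v, rep_second_differential A N g i k p u v)"
    by (simp add: rep_second_differential_def dom rep)
qed

lemma second_differential_linear_zero:
  assumes "topological_module s" "topological_module s'" "continuous_linear s s' l" "open U" "x \<in> U"
  shows "second_differential s s' U l x u v = 0"
proof -
  have "second_differential s s' U l x u v = differential s s' U (\<lambda>_. l u) x v"
    unfolding second_differential_def
    by (rule fun_cong[OF fun_cong[OF differential_cong]]) (auto simp: differential_linear assms)
  then show ?thesis using differential_const[OF assms(1,2,4,5)] by simp
qed

lemma fst_snd_local:
  assumes M: "smooth_atlas M" and N: "smooth_atlas N" and i: "i \<in> index M" and j: "j \<in> index N"
  shows "local_dom (prod_manifold M N) M fst (i, j) i' = local_dom M M id i i' \<times> chart N j ` cdom N j"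
    and "p \<in> local_dom M M id i i' \<times> chart N j ` cdom N j \<Longrightarrow>
      local_rep (prod_manifold M N) M fst (i, j) i' p = local_rep M M id i i' (fst p)"
    and "local_dom (prod_manifold M N) N snd (i, j) j' = chart M i ` cdom M i \<times> local_dom N N id j j'"
    and "p \<in> chart M i ` cdom M i \<times> local_dom N N id j j' \<Longrightarrow>
      local_rep (prod_manifold M N) N snd (i, j) j' p = local_rep N N id j j' (snd p)"
proof -
  have inv: "inv_into (cdom M i \<times> cdom N j) (map_prod (chart M i) (chart N j)) p = (a, b)"
    if "a \<in> cdom M i" "b \<in> cdom N j" "p = (chart M i a, chart N j b)" for a b p
    using inv_into_f_f[OF prod_chart_inj[OF M N i j], of "(a, b)"] that by simp
  show "local_dom (prod_manifold M N) M fst (i, j) i' = local_dom M M id i i' \<times> chart N j ` cdom N j"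
    "local_dom (prod_manifold M N) N snd (i, j) j' = chart M i ` cdom M i \<times> local_dom N N id j j'"
    by (force simp: local_dom_def)+
  show "p \<in> local_dom M M id i i' \<times> chart N j ` cdom N j \<Longrightarrow>
      local_rep (prod_manifold M N) M fst (i, j) i' p = local_rep M M id i i' (fst p)"
    "p \<in> chart M i ` cdom M i \<times> local_dom N N id j j' \<Longrightarrow>
      local_rep (prod_manifold M N) N snd (i, j) j' p = local_rep N N id j j' (snd p)"
    using smooth_atlas.inv_chart[OF M i] smooth_atlas.inv_chart[OF N j]
    by (auto simp: local_dom_def local_rep_def inv)
qed

lemma smooth_reps_fst_snd:
  assumes M: "smooth_atlas M" and N: "smooth_atlas N"
  shows "smooth_reps (prod_manifold M N) M fst" and "smooth_reps (prod_manifold M N) N snd"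
proof -
  interpret M: smooth_atlas M by fact
  interpret N: smooth_atlas N by fact
  have "smooth_on (prod_scale (smul M) (smul N)) (smul M) (local_dom (prod_manifold M N) M fst (i, j) i')
      (local_rep (prod_manifold M N) M fst (i, j) i')"
    "smooth_on (prod_scale (smul M) (smul N)) (smul N) (local_dom (prod_manifold M N) N snd (i, j) j')
      (local_rep (prod_manifold M N) N snd (i, j) j')"
    if ij: "i \<in> index M" "j \<in> index N" "i' \<in> index M" "j' \<in> index N" for i j i' j'
  proof -
    note L = fst_snd_local[OF M N ij(1,2)]
    note S = smooth_on_fst_snd_compose(1)[OF M.tm N.tm M.tm N.tm M.transition_smooth[OF ij(1,3)] smooth_on_id[OF N.tm N.open_chart_image[OF ij(2)]]]
      smooth_on_fst_snd_compose(2)[OF M.tm N.tm M.tm N.tm smooth_on_id[OF M.tm M.open_chart_image[OF ij(1)]] N.transition_smooth[OF ij(2,4)]]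
    show "smooth_on (prod_scale (smul M) (smul N)) (smul M) (local_dom (prod_manifold M N) M fst (i, j) i')
      (local_rep (prod_manifold M N) M fst (i, j) i')"
      unfolding L(1) by (rule smooth_on_cong[OF S(1)]) (rule L(2)[symmetric])
    show "smooth_on (prod_scale (smul M) (smul N)) (smul N) (local_dom (prod_manifold M N) N snd (i, j) j')
      (local_rep (prod_manifold M N) N snd (i, j) j')"
      unfolding L(3) by (rule smooth_on_cong[OF S(2)]) (rule L(4)[symmetric])
  qed
  then show "smooth_reps (prod_manifold M N) M fst" "smooth_reps (prod_manifold M N) N snd"
    by (auto simp: smooth_reps_def)
qed

lemma rep_differential_fst_snd:
  assumes M: "smooth_atlas M" and N: "smooth_atlas N"
    and "i \<in> index M" "p \<in> cdom M i" "j \<in> index N" "q \<in> cdom N j"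
  shows "rep_differential (prod_manifold M N) M fst (i, j) i (p, q) u = fst u"
    and "rep_second_differential (prod_manifold M N) M fst (i, j) i (p, q) u v = 0"
    and "rep_differential (prod_manifold M N) N snd (i, j) j (p, q) u = snd u"
    and "rep_second_differential (prod_manifold M N) N snd (i, j) j (p, q) u v = 0"
proof -
  interpret M: smooth_atlas M by fact
  interpret N: smooth_atlas N by fact
  let ?U = "chart M i ` cdom M i \<times> chart N j ` cdom N j" and ?s = "prod_scale (smul M) (smul N)"
  note L = fst_snd_local[OF M N assms(3,5)] and s = topological_module_prod[OF M.tm N.tm]
  have U: "open ?U" using assms by (intro open_Times M.open_chart_image N.open_chart_image)
  have x: "(chart M i p, chart N j q) \<in> ?U" using assms by auto
  have fst: "local_dom (prod_manifold M N) M fst (i, j) i = ?U"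
    "y \<in> ?U \<Longrightarrow> local_rep (prod_manifold M N) M fst (i, j) i y = fst y"
    and snd: "local_dom (prod_manifold M N) N snd (i, j) j = ?U"
    "y \<in> ?U \<Longrightarrow> local_rep (prod_manifold M N) N snd (i, j) j y = snd y" for y
    using L(1)[of i] L(2)[of y i] L(3)[of j] L(4)[of y j] assms
    by (auto simp: M.local_dom_id_same N.local_dom_id_same M.local_rep_chart N.local_rep_chart)
  have cfst: "differential ?s (smul M) ?U (local_rep (prod_manifold M N) M fst (i, j) i) = differential ?s (smul M) ?U fst"
    and csnd: "differential ?s (smul N) ?U (local_rep (prod_manifold M N) N snd (i, j) j) = differential ?s (smul N) ?U snd"
    by (rule differential_cong; use fst(2) snd(2) in auto)+
  show "rep_differential (prod_manifold M N) M fst (i, j) i (p, q) u = fst u"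
    "rep_differential (prod_manifold M N) N snd (i, j) j (p, q) u = snd u"
    using differential_linear[OF s M.tm continuous_linear_fst U x] differential_linear[OF s N.tm continuous_linear_snd U x]
    by (simp_all add: rep_differential_def fst(1) snd(1) cfst csnd)
  show "rep_second_differential (prod_manifold M N) M fst (i, j) i (p, q) u v = 0"
    "rep_second_differential (prod_manifold M N) N snd (i, j) j (p, q) u v = 0"
    using second_differential_linear_zero[OF s M.tm continuous_linear_fst U x]
      second_differential_linear_zero[OF s N.tm continuous_linear_snd U x]
    by (simp_all add: rep_second_differential_def second_differential_def fst(1) snd(1) cfst csnd)
qed

lemma const_local:
  assumes A: "smooth_atlas A" and M: "smooth_atlas M" and i: "i \<in> index A"
  shows "local_dom A M (\<lambda>_. x) i j = (if x \<in> cdom M j then chart A i ` cdom A i else {})"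
    and "local_rep A M (\<lambda>_. x) i j = (\<lambda>_. chart M j x)"
  by (auto simp: local_dom_def local_rep_def)

lemma smooth_reps_const:
  assumes A: "smooth_atlas A" and M: "smooth_atlas M" and x: "x \<in> points M"
  shows "smooth_reps A M (\<lambda>_. x)"
  using x smooth_atlas.open_chart_image[OF A]
  by (auto simp: smooth_reps_def const_local[OF A M] intro!: smooth_on_const smooth_atlas.tm[OF M])

lemma rep_differential_const:
  assumes A: "smooth_atlas A" and M: "smooth_atlas M"
    and i: "i \<in> index A" "p \<in> cdom A i" and x: "x \<in> cdom M j"
  shows "rep_differential A M (\<lambda>_. x) i j p u = 0" and "rep_second_differential A M (\<lambda>_. x) i j p u v = 0"
proof -
  interpret A: smooth_atlas A by fact
  interpret M: smooth_atlas M by fact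
  let ?U = "chart A i ` cdom A i"
  have U: "open ?U" "chart A i p \<in> ?U" using i A.open_chart_image by auto
  have d: "differential (smul A) (smul M) ?U (\<lambda>_. c) y u = 0" if "y \<in> ?U" for c y u
    by (rule differential_const[OF A.tm M.tm U(1) that])
  show "rep_differential A M (\<lambda>_. x) i j p u = 0"
    using d U x by (simp add: rep_differential_def const_local[OF A M i(1)])
  have "differential (smul A) (smul M) ?U (\<lambda>y. differential (smul A) (smul M) ?U (\<lambda>_. chart M j x) y u)
      = differential (smul A) (smul M) ?U (\<lambda>y. 0)"
    by (rule differential_cong) (auto simp: d)
  then show "rep_second_differential A M (\<lambda>_. x) i j p u v = 0"
    using d[OF U(2)] x by (simp add: rep_second_differential_def second_differential_def const_local[OF A M i(1)])
qed

text \<open>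
  A composite does have a smooth representative in the charts \<open>i\<close> and \<open>l\<close> if one single chart \<open>j\<close>
  serves for all intermediate points.
\<close>

lemma smooth_on_local_composite:
  assumes M: "smooth_atlas M" and N: "smooth_atlas N" and P: "smooth_atlas P"
    and f: "smooth_reps M N f" and g: "smooth_reps N P g"
    and i: "i \<in> index M" and j: "j \<in> index N" and l: "l \<in> index P"
    and via: "\<And>q. q \<in> cdom M i \<Longrightarrow> g (f q) \<in> cdom P l \<Longrightarrow> f q \<in> cdom N j"
  shows "smooth_on (smul M) (smul P) (local_dom M P (\<lambda>q. g (f q)) i l) (local_rep M P (\<lambda>q. g (f q)) i l)"
proof -
  interpret M: smooth_atlas M by fact
  interpret N: smooth_atlas N by fact
  interpret P: smooth_atlas P by fact
  have sf: "smooth_on (smul M) (smul N) (local_dom M N f i j) (local_rep M N f i j)"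
    and sg: "smooth_on (smul N) (smul P) (local_dom N P g j l) (local_rep N P g j l)"
    using f g i j l by (auto intro: smooth_reps_smooth_on)
  let ?W = "local_dom M N f i j \<inter> local_rep M N f i j -` local_dom N P g j l"
  have dom: "local_dom M P (\<lambda>q. g (f q)) i l = ?W"
  proof (intro equalityI subsetI)
    fix x assume "x \<in> local_dom M P (\<lambda>q. g (f q)) i l"
    then obtain q where "q \<in> cdom M i" "g (f q) \<in> cdom P l" "x = chart M i q" by (rule M.local_domE)
    then show "x \<in> ?W"
      using via i j by (auto simp: M.chart_in_local_dom M.local_rep_chart N.chart_in_local_dom)
  next
    fix x assume x: "x \<in> ?W"
    then obtain q where "q \<in> cdom M i" "f q \<in> cdom N j" "x = chart M i q" by (blast elim: M.local_domE)
    then show "x \<in> local_dom M P (\<lambda>q. g (f q)) i l"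
      using x i j by (auto simp: M.chart_in_local_dom M.local_rep_chart N.chart_in_local_dom)
  qed
  have W: "open ?W"
    by (rule continuous_open_preimage[OF smooth_on_continuous[OF sf] smooth_on_open[OF sf] smooth_on_open[OF sg]])
  have "smooth_on (smul M) (smul P) ?W (\<lambda>y. local_rep N P g j l (local_rep M N f i j y))"
    by (rule smooth_on_compose[OF M.tm N.tm P.tm smooth_on_subset[OF sf W] sg]) auto
  then show ?thesis unfolding dom
    by (rule smooth_on_cong) (use i j in \<open>auto elim!: M.local_domE simp: M.local_rep_chart N.local_rep_chart\<close>)
qed


section \<open>The tangent product\<close>

lemma tangent_pair_in:
  assumes M: "smooth_atlas M" and N: "smooth_atlas N" and z: "z \<in> tangent_vectors M" and w: "w \<in> tangent_vectors N"
  shows "tangent_pair M N (z, w) \<in> tangent_vectors (prod_manifold M N)"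
proof -
  have ch: "charts_at (prod_manifold M N) (p, q) = charts_at M p \<times> charts_at N q" for p q
    by (auto simp: charts_at_def)
  have pair: "tangent_pair M N (z, w)
      = ((fst z, fst w), \<lambda>(i, j)\<in>charts_at M (fst z) \<times> charts_at N (fst w). (snd z i, snd w j))"
    by (simp add: tangent_pair_def case_prod_beta)
  have trans: "(snd z i', snd w j') = rep_differential (prod_manifold M N) (prod_manifold M N) id (i, j) (i', j')
      (fst z, fst w) (snd z i, snd w j)"
    if "i \<in> charts_at M (fst z)" "i' \<in> charts_at M (fst z)" "j \<in> charts_at N (fst w)" "j' \<in> charts_at N (fst w)" for i i' j j'
    using rep_differential_prod_id[OF M N that] tangent_vectors_transition[OF z that(1,2)]
      tangent_vectors_transition[OF w that(3,4)] by simp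
  show ?thesis
    unfolding tangent_vectors_iff pair fst_conv snd_conv ch
  proof (intro conjI ballI)
    show "(fst z, fst w) \<in> points (prod_manifold M N)"
      using tangent_vectors_point[OF z] tangent_vectors_point[OF w] by simp
    fix a b assume "a \<in> charts_at M (fst z) \<times> charts_at N (fst w)" "b \<in> charts_at M (fst z) \<times> charts_at N (fst w)"
    then obtain i j i' j' where ab: "a = (i, j)" "b = (i', j')" "i \<in> charts_at M (fst z)" "j \<in> charts_at N (fst w)"
      "i' \<in> charts_at M (fst z)" "j' \<in> charts_at N (fst w)" by blast
    show "(\<lambda>(i, j)\<in>charts_at M (fst z) \<times> charts_at N (fst w). (snd z i, snd w j)) b
        = rep_differential (prod_manifold M N) (prod_manifold M N) id a b (fst z, fst w)
          ((\<lambda>(i, j)\<in>charts_at M (fst z) \<times> charts_at N (fst w). (snd z i, snd w j)) a)"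
      using trans[OF ab(3,5,4,6)] ab by (simp del: charts_at_iff)
  qed simp
qed

lemma tangent_product_eq:
  assumes M: "smooth_atlas M" and \<mu>: "smooth_reps (prod_manifold M M) M \<mu>"
    and z: "z \<in> tangent_vectors M" "z' \<in> tangent_vectors M"
    and i: "i \<in> charts_at M (fst z)" and j: "j \<in> charts_at M (fst z')"
  shows "tangent_product M \<mu> (z, z') = (\<mu> (fst z, fst z'), \<lambda>k\<in>charts_at M (\<mu> (fst z, fst z')).
      rep_differential (prod_manifold M M) M \<mu> (i, j) k (fst z, fst z') (snd z i, snd z' j))"
    and "tangent_product M \<mu> (z, z') \<in> tangent_vectors M"
proof -
  note MM = smooth_atlas_prod[OF M M] and P = tangent_pair_in[OF M M z]
  have fst: "fst (tangent_pair M M (z, z')) = (fst z, fst z')"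
    and snd: "snd (tangent_pair M M (z, z')) (i, j) = (snd z i, snd z' j)"
    using i j by (simp_all add: tangent_pair_def case_prod_beta)
  show "tangent_product M \<mu> (z, z') \<in> tangent_vectors M"
    unfolding tangent_product_def comp_apply by (rule tangent_map_in[OF MM M \<mu> P])
  have ij: "(i, j) \<in> charts_at (prod_manifold M M) (fst (tangent_pair M M (z, z')))" using i j fst by simp
  show "tangent_product M \<mu> (z, z') = (\<mu> (fst z, fst z'), \<lambda>k\<in>charts_at M (\<mu> (fst z, fst z')).
      rep_differential (prod_manifold M M) M \<mu> (i, j) k (fst z, fst z') (snd z i, snd z' j))"
    using tangent_map_eq[OF MM M \<mu> P ij] by (simp add: tangent_product_def fst snd)
qed

text \<open>
  In charts, \<open>T\<mu>\<close> is the tangent map of the representative of \<open>\<mu>\<close>, up to the exchange of the two middle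
  components in \<open>((x, u), (y, v)) \<mapsto> ((x, y), (u, v))\<close>.
\<close>

lemma tangent_product_local:
  fixes M :: "('k::dense_unit_ring, 'm, 'i, 'v::{ab_group_add,t2_space}) manifold"
  assumes M: "smooth_atlas M" and \<mu>: "smooth_reps (prod_manifold M M) M \<mu>"
    and i: "i \<in> index M" and j: "j \<in> index M" and k: "k \<in> index M"
  defines "U \<equiv> local_dom (prod_manifold M M) M \<mu> (i, j) k"
    and "PT \<equiv> prod_manifold (tangent_bundle M) (tangent_bundle M)"
    and "sh \<equiv> \<lambda>p :: ('v \<times> 'v) \<times> ('v \<times> 'v). ((fst (fst p), fst (snd p)), (snd (fst p), snd (snd p)))"
  shows "local_dom PT (tangent_bundle M) (tangent_product M \<mu>) (i, j) k = sh -` (U \<times> UNIV)"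
    and "p \<in> sh -` (U \<times> UNIV) \<Longrightarrow>
      local_rep PT (tangent_bundle M) (tangent_product M \<mu>) (i, j) k p
        = tangent_rep (prod_scale (smul M) (smul M)) (smul M) U (local_rep (prod_manifold M M) M \<mu> (i, j) k) (sh p)"
proof -
  interpret M: smooth_atlas M by fact
  interpret MM: smooth_atlas "prod_manifold M M" by (rule smooth_atlas_prod[OF M M])
  interpret PT: smooth_atlas PT unfolding PT_def by (intro smooth_atlas_prod smooth_atlas_tangent_bundle M)
  have ex: "\<exists>z z'. z \<in> tangent_cdom M i \<and> z' \<in> tangent_cdom M j \<and> \<mu> (fst z, fst z') \<in> cdom M k \<and>
      p = (tangent_chart M i z, tangent_chart M j z')"
    if "p \<in> sh -` (U \<times> UNIV)" for p
  proof -
    have "(fst (fst p), fst (snd p)) \<in> local_dom (prod_manifold M M) M \<mu> (i, j) k"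
      using that by (auto simp: sh_def U_def)
    then obtain a where "a \<in> cdom (prod_manifold M M) (i, j)" "\<mu> a \<in> cdom M k"
      "(fst (fst p), fst (snd p)) = chart (prod_manifold M M) (i, j) a" by (rule MM.local_domE)
    then show ?thesis using i j
      by (intro exI[of _ "tangent_vector M i (fst a) (snd (fst p))"] exI[of _ "tangent_vector M j (snd a) (snd (snd p))"])
        (auto simp: M.tangent_vector_in prod_eq_iff mem_Times_iff)
  qed
  have eq: "tangent_product M \<mu> (z, z') \<in> tangent_vectors M" "fst (tangent_product M \<mu> (z, z')) = \<mu> (fst z, fst z')"
    "\<mu> (fst z, fst z') \<in> cdom M k \<Longrightarrow> snd (tangent_product M \<mu> (z, z')) k
      = rep_differential (prod_manifold M M) M \<mu> (i, j) k (fst z, fst z') (snd z i, snd z' j)"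
    if "z \<in> tangent_cdom M i" "z' \<in> tangent_cdom M j" for z z'
    using tangent_product_eq[OF M \<mu>, of z z' i j] that i j k by simp_all
  have chart: "chart PT (i, j) (z, z') = (tangent_chart M i z, tangent_chart M j z')" for z z'
    by (simp add: PT_def)
  show "local_dom PT (tangent_bundle M) (tangent_product M \<mu>) (i, j) k = sh -` (U \<times> UNIV)"
  proof (intro equalityI subsetI)
    fix p assume "p \<in> local_dom PT (tangent_bundle M) (tangent_product M \<mu>) (i, j) k"
    then obtain zz where zz: "zz \<in> cdom PT (i, j)" "tangent_product M \<mu> zz \<in> cdom (tangent_bundle M) k"
      "p = chart PT (i, j) zz" by (rule PT.local_domE)
    obtain z z' where z: "zz = (z, z')" by (cases zz)
    then have *: "z \<in> tangent_cdom M i" "z' \<in> tangent_cdom M j" using zz(1) by (auto simp: PT_def)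
    then have "\<mu> (fst z, fst z') \<in> cdom M k" using zz(2) eq(2)[OF *] z by simp
    then have "chart (prod_manifold M M) (i, j) (fst z, fst z') \<in> U"
      using * i j unfolding U_def by (subst MM.chart_in_local_dom) auto
    then show "p \<in> sh -` (U \<times> UNIV)" using zz(3) z by (simp add: chart sh_def)
  next
    fix p assume "p \<in> sh -` (U \<times> UNIV)"
    then obtain z z' where *: "z \<in> tangent_cdom M i" "z' \<in> tangent_cdom M j" "\<mu> (fst z, fst z') \<in> cdom M k"
      "p = (tangent_chart M i z, tangent_chart M j z')" using ex by blast
    then have "tangent_product M \<mu> (z, z') \<in> cdom (tangent_bundle M) k" using eq(1,2)[OF *(1,2)] by simp
    then have "chart PT (i, j) (z, z') \<in> local_dom PT (tangent_bundle M) (tangent_product M \<mu>) (i, j) k"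
      using * i j by (subst PT.chart_in_local_dom) (auto simp: PT_def)
    then show "p \<in> local_dom PT (tangent_bundle M) (tangent_product M \<mu>) (i, j) k"
      using *(4) by (simp add: chart)
  qed
  assume "p \<in> sh -` (U \<times> UNIV)"
  then obtain z z' where *: "z \<in> tangent_cdom M i" "z' \<in> tangent_cdom M j" "\<mu> (fst z, fst z') \<in> cdom M k"
    "p = (tangent_chart M i z, tangent_chart M j z')" using ex by blast
  have "local_rep PT (tangent_bundle M) (tangent_product M \<mu>) (i, j) k p
      = tangent_chart M k (tangent_product M \<mu> (z, z'))"
    using PT.local_rep_chart[of "(i, j)" "(z, z')" "tangent_bundle M" "tangent_product M \<mu>" k] * i j
    by (simp add: chart PT_def)
  also have "\<dots> = (chart M k (\<mu> (fst z, fst z')),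
      rep_differential (prod_manifold M M) M \<mu> (i, j) k (fst z, fst z') (snd z i, snd z' j))"
    using eq(2,3)[OF *(1,2)] *(3) by simp
  also have "chart M k (\<mu> (fst z, fst z'))
      = local_rep (prod_manifold M M) M \<mu> (i, j) k (chart M i (fst z), chart M j (fst z'))"
    using MM.local_rep_chart[of "(i, j)" "(fst z, fst z')" M \<mu> k] * i j by simp
  finally show "local_rep PT (tangent_bundle M) (tangent_product M \<mu>) (i, j) k p
        = tangent_rep (prod_scale (smul M) (smul M)) (smul M) U (local_rep (prod_manifold M M) M \<mu> (i, j) k) (sh p)"
    using *(4) by (simp add: tangent_rep_def sh_def rep_differential_def U_def)
qed

lemma tangent_product_smooth:
  fixes M :: "('k::dense_unit_ring, 'm, 'i, 'v::{ab_group_add,t2_space}) manifold"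
  assumes M: "smooth_atlas M" and \<mu>: "smooth_reps (prod_manifold M M) M \<mu>"
  shows "smooth_reps (prod_manifold (tangent_bundle M) (tangent_bundle M)) (tangent_bundle M) (tangent_product M \<mu>)"
    (is ?smooth)
    and "\<lbrakk>i \<in> index M; j \<in> index M; k \<in> index M; a \<in> tangent_cdom M i; a' \<in> tangent_cdom M j; \<mu> (fst a, fst a') \<in> cdom M k\<rbrakk> \<Longrightarrow>
      rep_differential (prod_manifold (tangent_bundle M) (tangent_bundle M)) (tangent_bundle M) (tangent_product M \<mu>)
          (i, j) k (a, a') ((v, w), (v', w'))
      = (rep_differential (prod_manifold M M) M \<mu> (i, j) k (fst a, fst a') (v, v'),
         rep_second_differential (prod_manifold M M) M \<mu> (i, j) k (fst a, fst a') (snd a i, snd a' j) (v, v')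
          + rep_differential (prod_manifold M M) M \<mu> (i, j) k (fst a, fst a') (w, w'))"
proof -
  interpret M: smooth_atlas M by fact
  interpret MM: smooth_atlas "prod_manifold M M" by (rule smooth_atlas_prod[OF M M])
  let ?sh = "\<lambda>p :: ('v \<times> 'v) \<times> ('v \<times> 'v). ((fst (fst p), fst (snd p)), (snd (fst p), snd (snd p)))"
  let ?s = "prod_scale (smul M) (smul M)"
  let ?m = "\<lambda>i j k. local_rep (prod_manifold M M) M \<mu> (i, j) k"
    and ?U = "\<lambda>i j k. local_dom (prod_manifold M M) M \<mu> (i, j) k"
  have lin: "continuous_linear (prod_scale ?s ?s) (prod_scale ?s ?s) ?sh"
    by (auto simp: continuous_linear_def prod_scale_def intro!: continuous_intros)
  note tms = topological_module_prod[OF M.tm M.tm]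
  note tmss = topological_module_prod[OF tms tms]
  have sm: "smooth_on ?s (smul M) (?U i j k) (?m i j k)" if "i \<in> index M" "j \<in> index M" "k \<in> index M" for i j k
    using smooth_reps_smooth_on[OF \<mu>, of "(i, j)" k] that by simp
  have V: "open (?sh -` (?U i j k \<times> UNIV))" if "i \<in> index M" "j \<in> index M" "k \<in> index M" for i j k
    by (rule open_vimage) (use lin smooth_on_open[OF sm[OF that]] in \<open>auto simp: continuous_linear_def intro: open_Times\<close>)
  have sh: "smooth_on (prod_scale ?s ?s) (prod_scale ?s ?s) (?sh -` (?U i j k \<times> UNIV)) ?sh"
    if "i \<in> index M" "j \<in> index M" "k \<in> index M" for i j k
    by (rule smooth_on_linear[OF tmss tmss lin V[OF that]])
  have S: "smooth_on (prod_scale ?s ?s) ?s (?sh -` (?U i j k \<times> UNIV)) (\<lambda>p. tangent_rep ?s (smul M) (?U i j k) (?m i j k) (?sh p))"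
    if "i \<in> index M" "j \<in> index M" "k \<in> index M" for i j k
    by (rule smooth_on_compose[OF tmss tmss tms sh[OF that] smooth_on_tangent_rep[OF tms M.tm sm[OF that]]]) auto
  show ?smooth
    unfolding smooth_reps_def
  proof (intro conjI ballI)
    fix zz assume "zz \<in> points (prod_manifold (tangent_bundle M) (tangent_bundle M))"
    then have z: "fst zz \<in> tangent_vectors M" "snd zz \<in> tangent_vectors M" by auto
    obtain i j where "i \<in> charts_at M (fst (fst zz))" "j \<in> charts_at M (fst (snd zz))"
      using M.chart_exists tangent_vectors_point[OF z(1)] tangent_vectors_point[OF z(2)] by (metis charts_at_iff)
    from tangent_product_eq(2)[OF M \<mu> z this]
    show "tangent_product M \<mu> zz \<in> points (tangent_bundle M)" by simp
  next
    fix ij k assume "ij \<in> index (prod_manifold (tangent_bundle M) (tangent_bundle M))" "k \<in> index (tangent_bundle M)"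
    then obtain i j where ij: "ij = (i, j)" and ijk: "i \<in> index M" "j \<in> index M" "k \<in> index M" by auto
    note L = tangent_product_local[OF M \<mu> ijk]
    show "smooth_on (smul (prod_manifold (tangent_bundle M) (tangent_bundle M))) (smul (tangent_bundle M))
        (local_dom (prod_manifold (tangent_bundle M) (tangent_bundle M)) (tangent_bundle M) (tangent_product M \<mu>) ij k)
        (local_rep (prod_manifold (tangent_bundle M) (tangent_bundle M)) (tangent_bundle M) (tangent_product M \<mu>) ij k)"
      unfolding ij L(1) prod_manifold_simps tangent_bundle_simps
      by (rule smooth_on_cong[OF S[OF ijk]]) (rule L(2)[symmetric])
  qed
  assume ijk: "i \<in> index M" "j \<in> index M" "k \<in> index M"
    and a: "a \<in> tangent_cdom M i" "a' \<in> tangent_cdom M j" "\<mu> (fst a, fst a') \<in> cdom M k"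
  note L = tangent_product_local[OF M \<mu> ijk]
  have x: "(chart M i (fst a), chart M j (fst a')) \<in> ?U i j k"
    using MM.chart_in_local_dom[of "(i, j)" "(fst a, fst a')" M \<mu> k] a ijk by simp
  let ?p = "((chart M i (fst a), snd a i), (chart M j (fst a'), snd a' j))"
  have p: "?p \<in> ?sh -` (?U i j k \<times> UNIV)" using x by simp
  have "rep_differential (prod_manifold (tangent_bundle M) (tangent_bundle M)) (tangent_bundle M) (tangent_product M \<mu>)
          (i, j) k (a, a') ((v, w), (v', w'))
    = differential (prod_scale ?s ?s) ?s (?sh -` (?U i j k \<times> UNIV))
        (\<lambda>p. tangent_rep ?s (smul M) (?U i j k) (?m i j k) (?sh p)) ?p ((v, w), (v', w'))"
    unfolding rep_differential_def L(1) prod_manifold_simps tangent_bundle_simps map_prod_simp tangent_chart_apply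
    by (rule fun_cong[OF fun_cong[OF differential_cong]]) (auto intro: L(2))
  also have "\<dots> = differential (prod_scale ?s ?s) ?s (?U i j k \<times> UNIV) (tangent_rep ?s (smul M) (?U i j k) (?m i j k))
      (?sh ?p) (?sh ((v, w), (v', w')))"
    using differential_compose[OF tmss tmss tms sh[OF ijk] smooth_on_tangent_rep[OF tms M.tm sm[OF ijk]] _ p]
      differential_linear[OF tmss tmss lin V[OF ijk] p] by auto
  finally show "rep_differential (prod_manifold (tangent_bundle M) (tangent_bundle M)) (tangent_bundle M) (tangent_product M \<mu>)
          (i, j) k (a, a') ((v, w), (v', w'))
      = (rep_differential (prod_manifold M M) M \<mu> (i, j) k (fst a, fst a') (v, v'),
         rep_second_differential (prod_manifold M M) M \<mu> (i, j) k (fst a, fst a') (snd a i, snd a' j) (v, v')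
          + rep_differential (prod_manifold M M) M \<mu> (i, j) k (fst a, fst a') (w, w'))"
    using differential_tangent_rep[OF tms M.tm sm[OF ijk] x]
    by (simp add: rep_differential_def rep_second_differential_def)
qed


section \<open>The second tangent bundle in charts\<close>

text \<open>
  The inverse of the chart \<open>i\<close> on the fiber over \<open>p\<close>.
\<close>

definition fiber_point ::
  "('k::dense_unit_ring, 'm, 'i, 'v::{ab_group_add,t2_space}) manifold \<Rightarrow> 'i \<Rightarrow> 'm \<Rightarrow>
   'v \<times> 'v \<times> 'v \<Rightarrow> ('m, 'i, 'v) second_tangent" where
  "fiber_point M i p = (\<lambda>(u, v, w). tangent_vector (tangent_bundle M) i (tangent_vector M i p u) (v, w))"

text \<open>
  The shape of \<open>TTf\<close> on a fiber in charts, where \<open>S\<close> and \<open>B\<close> are the first and the second differential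
  of \<open>f\<close>.
\<close>

definition second_tangent_rep :: "('v \<Rightarrow> 'w) \<Rightarrow> ('v \<Rightarrow> 'v \<Rightarrow> 'w::plus) \<Rightarrow> 'v \<times> 'v \<times> 'v \<Rightarrow> 'w \<times> 'w \<times> 'w" where
  "second_tangent_rep S B = (\<lambda>(u, v, w). (S u, S v, B u v + S w))"

lemma fiber_chart_eq: "fiber_chart i z = (snd (fst z) i, snd z i)"
  by (simp add: fiber_chart_def case_prod_beta)

context smooth_atlas
begin

lemma smooth_atlas_TM: "smooth_atlas (tangent_bundle M)"
  by (rule smooth_atlas_tangent_bundle) (rule smooth_atlas_axioms)

lemma TT_fiber_iff:
  "z \<in> TT_fiber M p \<longleftrightarrow> z \<in> tangent_vectors (tangent_bundle M) \<and> fst z \<in> tangent_vectors M \<and> fst (fst z) = p"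
  using tangent_vectors_point[of z "tangent_bundle M"]
  by (auto simp: TT_fiber_def TT_def foot_def smooth_atlas.points_tangent_bundle[OF smooth_atlas_TM])

lemma fiber_point:
  assumes "i \<in> charts_at M p"
  shows "fiber_point M i p t \<in> TT_fiber M p" and "fiber_chart i (fiber_point M i p t) = t"
proof -
  obtain u v w where t: "t = (u, v, w)" by (cases t)
  have "i \<in> charts_at (tangent_bundle M) (tangent_vector M i p u)"
    using assms tangent_vector_in[OF assms] by simp
  then show "fiber_point M i p t \<in> TT_fiber M p" "fiber_chart i (fiber_point M i p t) = t"
    using assms tangent_vector_in[OF assms] smooth_atlas.tangent_vector_in[OF smooth_atlas_TM]
      smooth_atlas.tangent_vector_component[OF smooth_atlas_TM]
    by (simp_all add: TT_fiber_iff t fiber_point_def fiber_chart_eq)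
qed

lemma fiber_point_chart:
  assumes "i \<in> charts_at M p" "z \<in> TT_fiber M p"
  shows "fiber_point M i p (fiber_chart i z) = z"
proof -
  have z: "z \<in> tangent_vectors (tangent_bundle M)" "fst z \<in> tangent_vectors M" "fst (fst z) = p"
    using assms(2) by (auto simp: TT_fiber_iff)
  have 1: "tangent_vector M i p (snd (fst z) i) = fst z"
    using tangent_vector_snd[OF z(2), of i] z(3) assms(1) by simp
  have "tangent_vector (tangent_bundle M) i (fst z) (snd z i) = z"
    using smooth_atlas.tangent_vector_snd[OF smooth_atlas_TM z(1), of i] z(2,3) assms(1) by simp
  then show ?thesis by (simp add: fiber_point_def fiber_chart_eq 1 case_prod_beta)
qed

lemma fiber_chart_bij:
  assumes "i \<in> charts_at M p"
  shows "bij_betw (fiber_chart i) (TT_fiber M p) UNIV"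
  by (rule bij_betw_byWitness[where f' = "fiber_point M i p"])
    (use fiber_point[OF assms] fiber_point_chart[OF assms] in auto)

lemma inv_fiber_chart:
  assumes "i \<in> charts_at M p"
  shows "inv_into (TT_fiber M p) (fiber_chart i) = fiber_point M i p"
proof
  fix t
  show "inv_into (TT_fiber M p) (fiber_chart i) t = fiber_point M i p t"
    using fiber_point[OF assms, of t] inv_into_f_f[OF bij_betw_imp_inj_on[OF fiber_chart_bij[OF assms]]] by metis
qed

lemma fiber_chart_transition:
  assumes "i \<in> charts_at M p" "j \<in> charts_at M p" "z \<in> TT_fiber M p"
  shows "fiber_chart j z = second_tangent_rep (rep_differential M M id i j p)
    (rep_second_differential M M id i j p) (fiber_chart i z)"
proof -
  have z: "z \<in> tangent_vectors (tangent_bundle M)" "fst z \<in> tangent_vectors M" "fst (fst z) = p"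
    using assms(3) by (auto simp: TT_fiber_iff)
  obtain v w where vw: "snd z i = (v, w)" by (cases "snd z i")
  have "snd z j = rep_differential (tangent_bundle M) (tangent_bundle M) id i j (fst z) (snd z i)"
    by (rule tangent_vectors_transition[OF z(1)]) (use assms z in auto)
  moreover have "snd (fst z) j = rep_differential M M id i j p (snd (fst z) i)"
    using tangent_vectors_transition[OF z(2), of i j] assms z(3) by simp
  ultimately show ?thesis
    using rep_differential_tangent_lift[OF smooth_atlas_axioms smooth_atlas_axioms smooth_reps_id tangent_lift_id,
        of i j "fst z" v w] assms z vw
    by (simp add: fiber_chart_eq second_tangent_rep_def)
qed

lemma TT_map_chart:
  assumes f: "smooth_reps M M f" and z: "z \<in> TT_fiber M p" and i: "i \<in> charts_at M p" and k: "k \<in> charts_at M (f p)"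
  shows "TT_map M f z \<in> TT_fiber M (f p)"
    and "fiber_chart k (TT_map M f z) = second_tangent_rep (rep_differential M M f i k p)
      (rep_second_differential M M f i k p) (fiber_chart i z)"
proof -
  note A = smooth_atlas_axioms
  have z: "z \<in> tangent_vectors (tangent_bundle M)" "fst z \<in> tangent_vectors M" "fst (fst z) = p"
    using z by (auto simp: TT_fiber_iff)
  obtain v w where vw: "snd z i = (v, w)" by (cases "snd z i")
  have Tf: "smooth_reps (tangent_bundle M) (tangent_bundle M) (tangent_map M M f)"
    by (rule smooth_reps_tangent_map[OF A A f])
  have a: "tangent_map M M f (fst z) \<in> tangent_vectors M" by (rule tangent_map_in[OF A A f z(2)])
  have fstT: "fst (tangent_map M M f (fst z)) = f p"
    using tangent_liftD(2)[OF tangent_lift_tangent_map[OF A A f] z(2)] z(3) by simp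
  have TT: "TT_map M f z = (tangent_map M M f (fst z), \<lambda>j\<in>charts_at (tangent_bundle M) (tangent_map M M f (fst z)).
      rep_differential (tangent_bundle M) (tangent_bundle M) (tangent_map M M f) i j (fst z) (snd z i))"
    unfolding TT_map_def
    by (rule tangent_map_eq[OF smooth_atlas_TM smooth_atlas_TM Tf z(1)]) (use i z in simp)
  show "TT_map M f z \<in> TT_fiber M (f p)"
    unfolding TT_fiber_iff using tangent_map_in[OF smooth_atlas_TM smooth_atlas_TM Tf z(1)] a fstT TT
    by (simp add: TT_map_def)
  have "snd (tangent_map M M f (fst z)) k = rep_differential M M f i k p (snd (fst z) i)"
    using tangent_liftD(3)[OF tangent_lift_tangent_map[OF A A f] z(2), of i k] z(3) i k by simp
  moreover have "snd (TT_map M f z) k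
      = rep_differential (tangent_bundle M) (tangent_bundle M) (tangent_map M M f) i k (fst z) (v, w)"
    using TT a fstT k vw by simp
  ultimately show "fiber_chart k (TT_map M f z) = second_tangent_rep (rep_differential M M f i k p)
      (rep_second_differential M M f i k p) (fiber_chart i z)"
    using rep_differential_tangent_lift[OF A A f tangent_lift_tangent_map[OF A A f], of i k "fst z" v w] i k z vw TT
    by (simp add: fiber_chart_eq second_tangent_rep_def)
qed

lemma TT_product_chart:
  assumes \<mu>: "smooth_reps (prod_manifold M M) M \<mu>" and z: "z \<in> TT_fiber M p" and z': "z' \<in> TT_fiber M p'"
    and i: "i \<in> charts_at M p" and j: "j \<in> charts_at M p'" and k: "k \<in> charts_at M (\<mu> (p, p'))"
    and c: "fiber_chart i z = (u, v, w)" and c': "fiber_chart j z' = (u', v', w')"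
  shows "TT_product M \<mu> (z, z') \<in> TT_fiber M (\<mu> (p, p'))"
    and "fiber_chart k (TT_product M \<mu> (z, z')) =
      (rep_differential (prod_manifold M M) M \<mu> (i, j) k (p, p') (u, u'),
       rep_differential (prod_manifold M M) M \<mu> (i, j) k (p, p') (v, v'),
       rep_second_differential (prod_manifold M M) M \<mu> (i, j) k (p, p') (u, u') (v, v')
        + rep_differential (prod_manifold M M) M \<mu> (i, j) k (p, p') (w, w'))"
proof -
  note A = smooth_atlas_axioms
  have z: "z \<in> tangent_vectors (tangent_bundle M)" "fst z \<in> tangent_vectors M" "fst (fst z) = p"
    using z by (auto simp: TT_fiber_iff)
  have z': "z' \<in> tangent_vectors (tangent_bundle M)" "fst z' \<in> tangent_vectors M" "fst (fst z') = p'"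
    using z' by (auto simp: TT_fiber_iff)
  let ?a = "fst z" and ?a' = "fst z'" and ?T = "tangent_product M \<mu>"
  note T\<mu> = tangent_product_smooth(1)[OF A \<mu>]
  have T: "?T (?a, ?a') = (\<mu> (p, p'), \<lambda>k\<in>charts_at M (\<mu> (p, p')).
      rep_differential (prod_manifold M M) M \<mu> (i, j) k (p, p') (snd ?a i, snd ?a' j))"
    and Tin: "?T (?a, ?a') \<in> tangent_vectors M"
    using tangent_product_eq[OF A \<mu> z(2) z'(2), of i j] z(3) z'(3) i j by simp_all
  have TT: "TT_product M \<mu> (z, z') = (?T (?a, ?a'), \<lambda>k\<in>charts_at (tangent_bundle M) (?T (?a, ?a')).
      rep_differential (prod_manifold (tangent_bundle M) (tangent_bundle M)) (tangent_bundle M) ?T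
        (i, j) k (?a, ?a') (snd z i, snd z' j))"
    and TTin: "TT_product M \<mu> (z, z') \<in> tangent_vectors (tangent_bundle M)"
    unfolding TT_product_def
    using tangent_product_eq[OF smooth_atlas_TM T\<mu> z(1) z'(1), of i j] z z' i j by simp_all
  show "TT_product M \<mu> (z, z') \<in> TT_fiber M (\<mu> (p, p'))"
    unfolding TT_fiber_iff using TTin Tin TT T by simp
  have uvw: "snd ?a i = u" "snd z i = (v, w)" "snd ?a' j = u'" "snd z' j = (v', w')"
    using c c' by (auto simp: fiber_chart_eq)
  have "k \<in> charts_at (tangent_bundle M) (?T (?a, ?a'))" using k Tin T by simp
  then have 2: "snd (TT_product M \<mu> (z, z')) k = rep_differential (prod_manifold (tangent_bundle M) (tangent_bundle M))
      (tangent_bundle M) ?T (i, j) k (?a, ?a') ((v, w), (v', w'))"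
    using TT uvw by (simp del: charts_at_iff)
  have 1: "snd (fst (TT_product M \<mu> (z, z'))) k = rep_differential (prod_manifold M M) M \<mu> (i, j) k (p, p') (u, u')"
    using TT T k uvw by simp
  show "fiber_chart k (TT_product M \<mu> (z, z')) =
      (rep_differential (prod_manifold M M) M \<mu> (i, j) k (p, p') (u, u'),
       rep_differential (prod_manifold M M) M \<mu> (i, j) k (p, p') (v, v'),
       rep_second_differential (prod_manifold M M) M \<mu> (i, j) k (p, p') (u, u') (v, v')
        + rep_differential (prod_manifold M M) M \<mu> (i, j) k (p, p') (w, w'))"
    using tangent_product_smooth(2)[OF A \<mu>, of i j k ?a ?a' v w v' w'] i j k z z' uvw
    by (simp add: fiber_chart_eq 1 2)
qed

end


section \<open>The second order structure of a symmetric space\<close>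

lemma additive_neg:
  fixes h :: "'a::group_add \<Rightarrow> 'b::group_add"
  assumes "\<And>x y. h (x + y) = h x + h y"
  shows "h (- x) = - h x"
proof -
  have "h 0 + h 0 = h 0 + 0" using assms[of 0 0] by simp
  then have "h 0 = 0" by (rule add_left_imp_eq)
  then have "h x + h (- x) = 0" using assms[of x "- x"] by simp
  then show ?thesis by (simp add: eq_neg_iff_add_eq_0 minus_unique)
qed

context smooth_atlas
begin

text \<open>
  The inclusion \<open>q \<mapsto> (x, q)\<close>. It is written with the identity function so that it has the form of a
  pair of maps.
\<close>

lemma inclusion:
  assumes x: "x \<in> points M"
  shows "smooth_reps M (prod_manifold M M) (\<lambda>q. (x, id q))"
    and "\<lbrakk>i \<in> charts_at M p; k \<in> charts_at M x\<rbrakk> \<Longrightarrow>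
      rep_differential M (prod_manifold M M) (\<lambda>q. (x, id q)) i (k, i) p u = (0, u)"
    and "\<lbrakk>i \<in> charts_at M p; k \<in> charts_at M x\<rbrakk> \<Longrightarrow>
      rep_second_differential M (prod_manifold M M) (\<lambda>q. (x, id q)) i (k, i) p u v = 0"
proof -
  note A = smooth_atlas_axioms
  note c = smooth_reps_const[OF A A x]
  show "smooth_reps M (prod_manifold M M) (\<lambda>q. (x, id q))"
    by (rule smooth_reps_Pair[OF A c smooth_reps_id])
  assume "i \<in> charts_at M p" "k \<in> charts_at M x"
  then show "rep_differential M (prod_manifold M M) (\<lambda>q. (x, id q)) i (k, i) p u = (0, u)"
    "rep_second_differential M (prod_manifold M M) (\<lambda>q. (x, id q)) i (k, i) p u v = 0"
    using rep_differential_Pair[OF A A A c smooth_reps_id, of i p k i] rep_differential_const[OF A A, of i p x k]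
    by (simp_all add: rep_id_same zero_prod_def)
qed

text \<open>
  Although \<open>y \<mapsto> \<mu>(x, y)\<close> is a composite, it has smooth representatives: one fixed chart at \<open>x\<close> serves
  for all intermediate points \<open>(x, y)\<close>.
\<close>

lemma section_smooth:
  assumes \<mu>: "smooth_reps (prod_manifold M M) M \<mu>" and x: "x \<in> points M"
  shows "smooth_reps M M (\<lambda>y. \<mu> (x, y))"
proof -
  note PA = smooth_atlas_prod[OF smooth_atlas_axioms smooth_atlas_axioms]
  obtain k where k: "k \<in> index M" "x \<in> cdom M k" using chart_exists[OF x] .
  have "smooth_on (smul M) (smul M) (local_dom M M (\<lambda>y. \<mu> (x, id y)) i j) (local_rep M M (\<lambda>y. \<mu> (x, id y)) i j)"
    if "i \<in> index M" "j \<in> index M" for i j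
    by (rule smooth_on_local_composite[OF smooth_atlas_axioms PA smooth_atlas_axioms inclusion(1)[OF x] \<mu>,
        where j = "(k, i)"]) (use that k in auto)
  moreover have "\<mu> (x, y) \<in> points M" if "y \<in> points M" for y
    using smooth_reps_points[OF \<mu>, of "(x, y)"] x that by simp
  ultimately show ?thesis by (simp add: smooth_reps_def)
qed

end

locale symmetric =
  fixes M :: "('k::dense_unit_ring, 'm, 'i, 'v::{ab_group_add,t2_space}) manifold" and \<mu> :: "'m \<times> 'm \<Rightarrow> 'm"
  assumes symmetric_space: "symmetric_space M \<mu>"
begin

sublocale smooth_atlas M
  using symmetric_space by (intro smooth_manifold_atlas) (simp add: symmetric_space_def)

sublocale V: topological_module "smul M" by (rule tm)

lemma M1 [simp]: "x \<in> points M \<Longrightarrow> \<mu> (x, x) = x"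
  and M2: "x \<in> points M \<Longrightarrow> y \<in> points M \<Longrightarrow> \<mu> (x, \<mu> (x, y)) = y"
  and M3: "x \<in> points M \<Longrightarrow> y \<in> points M \<Longrightarrow> z \<in> points M \<Longrightarrow> \<mu> (x, \<mu> (y, z)) = \<mu> (\<mu> (x, y), \<mu> (x, z))"
  and M4: "x \<in> points M \<Longrightarrow> u \<in> tangent_vectors M \<Longrightarrow> fst u = x \<Longrightarrow>
      tangent_map M M (\<lambda>y. \<mu> (x, y)) u = tangent_uminus M u"
  using symmetric_space by (auto simp: symmetric_space_def)

lemma \<mu>_smooth: "smooth_reps (prod_manifold M M) M \<mu>"
  using symmetric_space by (intro smooth_map_reps) (simp add: symmetric_space_def)

lemma \<mu>_closed: "x \<in> points M \<Longrightarrow> y \<in> points M \<Longrightarrow> \<mu> (x, y) \<in> points M"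
  using smooth_reps_points[OF \<mu>_smooth, of "(x, y)"] by simp

lemma prod_atlas: "smooth_atlas (prod_manifold M M)"
  by (intro smooth_atlas_prod smooth_atlas_axioms)

definition half :: 'k where "half = (SOME h. h * 2 = 1)"

lemma half: "half * 2 = 1"
proof -
  have "(2::'k) dvd 1" using symmetric_space by (simp add: symmetric_space_def)
  then obtain h :: 'k where "1 = 2 * h" by (auto simp: dvd_def)
  then have "h * 2 = 1" by (simp add: mult.commute)
  then show ?thesis unfolding half_def by (rule someI[where P = "\<lambda>h. h * 2 = 1"])
qed

lemma half_double: "smul M half (x + x) = x" "smul M half x + smul M half x = x"
proof -
  have "smul M half x + smul M half x = smul M (half * 2) x"
    unfolding mult_2_right V.scale_left_distrib ..
  also have "\<dots> = x" unfolding half by (rule V.scale_one)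
  finally show "smul M half x + smul M half x = x" .
  then show "smul M half (x + x) = x" unfolding V.scale_right_distrib .
qed

lemma double_eq_zero: "x + x = 0 \<Longrightarrow> x = (0::'v)"
  using half_double(1)[of x] by simp

lemma \<sigma>_smooth: "x \<in> points M \<Longrightarrow> smooth_reps M M (\<lambda>y. \<mu> (x, y))"
  by (rule section_smooth[OF \<mu>_smooth])

text \<open>
  The symmetry factors as \<open>\<mu>\<close> after the inclusion \<open>q \<mapsto> (x, q)\<close>, which has the differential \<open>u \<mapsto> (0, u)\<close>
  and vanishing second differential.
\<close>

lemma \<sigma>_rep:
  assumes i: "i \<in> charts_at M p" and k: "k \<in> charts_at M x" and j: "j \<in> charts_at M (\<mu> (x, p))"
  shows "rep_differential M M (\<lambda>y. \<mu> (x, y)) i j p u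
      = rep_differential (prod_manifold M M) M \<mu> (k, i) j (x, p) (0, u)"
    and "rep_second_differential M M (\<lambda>y. \<mu> (x, y)) i j p u v
      = rep_second_differential (prod_manifold M M) M \<mu> (k, i) j (x, p) (0, u) (0, v)"
proof -
  note A = smooth_atlas_axioms
  have x: "x \<in> points M" using k cdom_points by auto
  note \<sigma> = \<sigma>_smooth[OF x]
  have ci: "i \<in> index M" "p \<in> cdom M i" and cj: "j \<in> index M" "\<mu> (x, p) \<in> cdom M j"
    and ck: "(k, i) \<in> index (prod_manifold M M)" "(x, id p) \<in> cdom (prod_manifold M M) (k, i)"
    and cj': "j \<in> index M" "\<mu> (x, id p) \<in> cdom M j"
    using i j k by auto
  note sq = commuting_square[OF A prod_atlas A A inclusion(1)[OF x] \<mu>_smooth \<sigma> smooth_reps_id ci ck cj cj']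
  show "rep_differential M M (\<lambda>y. \<mu> (x, y)) i j p u
      = rep_differential (prod_manifold M M) M \<mu> (k, i) j (x, p) (0, u)"
    using sq(1)[of u] inclusion(2)[OF x i k] rep_id_same[OF cj] by simp
  have "rep_differential (prod_manifold M M) M \<mu> (k, i) j (x, p) 0 = 0"
    using rep_differential_linear(3)[OF prod_atlas A \<mu>_smooth ck, of j] cj by simp
  then show "rep_second_differential M M (\<lambda>y. \<mu> (x, y)) i j p u v
      = rep_second_differential (prod_manifold M M) M \<mu> (k, i) j (x, p) (0, u) (0, v)"
    using sq(2)[of u v] inclusion(2,3)[OF x i k] rep_id_same[OF cj] by simp
qed

text \<open>This is the form \<open>A\<close>: both derivatives are taken at \<open>p\<close>, the fixed point of \<open>\<sigma>\<^sub>p\<close>.\<close>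

definition sym_form :: "'i \<Rightarrow> 'm \<Rightarrow> 'v \<Rightarrow> 'v \<Rightarrow> 'v" where
  "sym_form i p = rep_second_differential M M (\<lambda>y. \<mu> (p, y)) i i p"

lemma sym_form_bilinear:
  assumes i: "i \<in> charts_at M p"
  shows "sym_form i p (u + u') v = sym_form i p u v + sym_form i p u' v"
    and "sym_form i p u (v + v') = sym_form i p u v + sym_form i p u v'"
    and "sym_form i p (smul M r u) v = smul M r (sym_form i p u v)"
    and "sym_form i p u (smul M r v) = smul M r (sym_form i p u v)"
    and "sym_form i p u v = sym_form i p v u"
    and "sym_form i p (- u) v = - sym_form i p u v"
    and "sym_form i p u (- v) = - sym_form i p u v"
proof -
  have p: "p \<in> points M" using i cdom_points by auto
  have "i \<in> index M" "p \<in> cdom M i" "i \<in> index M" "\<mu> (p, p) \<in> cdom M i" using i p by auto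
  note B = rep_second_differential_bilinear[OF smooth_atlas_axioms smooth_atlas_axioms \<sigma>_smooth[OF p] this]
  show 1: "sym_form i p (u + u') v = sym_form i p u v + sym_form i p u' v" for u u'
    unfolding sym_form_def by (rule B)
  show 2: "sym_form i p u (v + v') = sym_form i p u v + sym_form i p u v'" for v v'
    unfolding sym_form_def by (rule B)
  show "sym_form i p (smul M r u) v = smul M r (sym_form i p u v)"
    "sym_form i p u (smul M r v) = smul M r (sym_form i p u v)" "sym_form i p u v = sym_form i p v u"
    unfolding sym_form_def by (rule B)+
  show "sym_form i p (- u) v = - sym_form i p u v" by (rule additive_neg[of "\<lambda>u. sym_form i p u v"]) (rule 1)
  show "sym_form i p u (- v) = - sym_form i p u v" by (rule additive_neg) (rule 2)
qed

lemma \<sigma>_differential: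
  assumes i: "i \<in> charts_at M p"
  shows "rep_differential M M (\<lambda>y. \<mu> (p, y)) i i p u = - u"
proof -
  have p: "p \<in> points M" using i cdom_points by auto
  let ?z = "tangent_vector M i p u"
  have "snd (tangent_map M M (\<lambda>y. \<mu> (p, y)) ?z) i = rep_differential M M (\<lambda>y. \<mu> (p, y)) i i p u"
    using tangent_map_eq[OF smooth_atlas_axioms smooth_atlas_axioms \<sigma>_smooth[OF p] tangent_vector_in[OF i], of i] i p
    by simp
  moreover have "snd (tangent_map M M (\<lambda>y. \<mu> (p, y)) ?z) i = - u"
    using M4[OF p tangent_vector_in[OF i]] i by (simp add: tangent_uminus_def case_prod_beta)
  ultimately show ?thesis by simp
qed

text \<open>
  The first two differentials of \<open>\<mu>\<close> at the diagonal. The second one vanishes on pairs of diagonal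
  vectors because of \<open>\<mu>(x, x) = x\<close>. In the decomposition \<open>(u, u') = (u, u) + (0, a)\<close>, the
  involution \<open>(x, y) \<mapsto> (x, \<mu>(x, y))\<close> has the differential \<open>(u, u) + (0, a) \<mapsto> (u, u) - (0, a)\<close>.
  As \<open>2\<close> is invertible, \<open>\<mu>(x, \<mu>(x, y)) = y\<close> therefore kills the mixed terms. There remains the second
  differential of the symmetry.
\<close>

lemma \<mu>_second_order:
  assumes i: "i \<in> charts_at M p"
  defines "m \<equiv> rep_differential (prod_manifold M M) M \<mu> (i, i) i (p, p)"
    and "D \<equiv> rep_second_differential (prod_manifold M M) M \<mu> (i, i) i (p, p)"
  shows "m (u, u') = u + u - u'" and "D (u, u') (v, v') = sym_form i p (u - u') (v - v')"
proof -
  note A = smooth_atlas_axioms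
  have p: "p \<in> points M" using i cdom_points by auto
  have ci: "i \<in> index M" "p \<in> cdom M i" and c\<mu>: "i \<in> index M" "\<mu> (p, p) \<in> cdom M i"
    and cii: "(i, i) \<in> index (prod_manifold M M)" "(p, p) \<in> cdom (prod_manifold M M) (i, i)"
    using i p by auto
  note lin = rep_differential_linear[OF prod_atlas A \<mu>_smooth cii c\<mu>, folded m_def]
  note bil = rep_second_differential_bilinear[OF prod_atlas A \<mu>_smooth cii c\<mu>, folded D_def]
  have D_add: "D (a + a') b = D a b + D a' b" "D a (b + b') = D a b + D a b'" for a a' b b' by (rule bil)+
  have D_neg: "D (- a) b = - D a b" "D a (- b) = - D a b" for a b
    using additive_neg[of "\<lambda>a. D a b"] additive_neg[of "D a"] D_add by auto
  have \<sigma>: "m (0, u) = - u" "D (0, u) (0, v) = sym_form i p u v" for u v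
    using \<sigma>_rep(1)[OF i i, of i u] \<sigma>_rep(2)[OF i i, of i u v] \<sigma>_differential[OF i] ci p by (simp_all add: m_def D_def sym_form_def)
  have diag: "rep_differential M (prod_manifold M M) (\<lambda>q. (id q, id q)) i (i, i) p u = (u, u)"
    "rep_second_differential M (prod_manifold M M) (\<lambda>q. (id q, id q)) i (i, i) p u v = 0" for u v
    using rep_differential_Pair[OF A A A smooth_reps_id smooth_reps_id, of i p i i] ci by (simp_all add: rep_id_same zero_prod_def)
  have m0: "m 0 = 0" and c1: "(i, i) \<in> index (prod_manifold M M)" "(id p, id p) \<in> cdom (prod_manifold M M) (i, i)"
    and c2: "i \<in> index M" "\<mu> (id p, id p) \<in> cdom M i" and c3: "i \<in> index M" "id p \<in> cdom M i"
    using lin(3) ci p by auto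
  note sq1 = commuting_square[OF A prod_atlas A A smooth_reps_Pair[OF A smooth_reps_id smooth_reps_id] \<mu>_smooth
      smooth_reps_id smooth_reps_id ci c1 c3 c2]
  have m_diag: "m (u, u) = u" and D_diag: "D (u, u) (v, v) = 0" for u v
    using sq1(1)[of u] sq1(2)[of u v] ci diag m0 rep_id_same[OF ci] rep_id_same[OF ci, unfolded id_def]
    by (simp_all add: m_def D_def)
  show m: "m (u, u') = u + u - u'" for u u'
    using lin(1)[of "(u, u)" "(0, u' - u)"] m_diag \<sigma>(1) by simp
  \<comment> \<open>the involution \<open>(x, y) \<mapsto> (x, \<mu>(x, y))\<close>; composed with \<open>\<mu>\<close> it is the second projection\<close>
  note fst\<mu> = smooth_reps_Pair[OF prod_atlas smooth_reps_fst_snd(1)[OF A A] \<mu>_smooth]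
  have inv: "rep_differential (prod_manifold M M) (prod_manifold M M) (\<lambda>q. (fst q, \<mu> q)) (i, i) (i, i) (p, p) a = (fst a, m a)"
    "rep_second_differential (prod_manifold M M) (prod_manifold M M) (\<lambda>q. (fst q, \<mu> q)) (i, i) (i, i) (p, p) a b = (0, D a b)" for a b
    using rep_differential_Pair[OF prod_atlas A A smooth_reps_fst_snd(1)[OF A A] \<mu>_smooth, of "(i, i)" "(p, p)" i i]
      rep_differential_fst_snd[OF A A, of i p i p] ci p by (simp_all add: m_def D_def)
  have c4: "(i, i) \<in> index (prod_manifold M M)" "(fst (p, p), \<mu> (p, p)) \<in> cdom (prod_manifold M M) (i, i)"
    and c5: "i \<in> index M" "snd (p, p) \<in> cdom M i"
    and c6: "i \<in> index M" "\<mu> (fst (p, p), \<mu> (p, p)) \<in> cdom M i" using ci p by auto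
  have M2': "\<mu> (fst q, \<mu> q) = snd q" if "q \<in> points M \<times> points M" for q
    using M2[of "fst q" "snd q"] that by auto
  have "D (fst a, m a) (fst b, m b) + m (0, D a b) = 0" for a b
    using commuting_square(2)[OF prod_atlas prod_atlas A A fst\<mu> \<mu>_smooth smooth_reps_fst_snd(2)[OF A A] smooth_reps_id
        cii c4 c5 c6, of a b] M2' ci p inv rep_differential_fst_snd[OF A A, of i p i p]
    by (simp add: rep_id_same m_def D_def)
  then have D_inv: "D (fst a, m a) (fst b, m b) = D a b" for a b
    by (simp add: \<sigma>(1))
  \<comment> \<open>the mixed terms \<open>?X\<close> change sign under the involution\<close>
  have key: "D (u, u + a) (v, v + b) = sym_form i p a b" for u v a b
  proof -
    let ?X = "D (u, u) (0, b) + D (0, a) (v, v)"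
    have e: "(u, u + a) = (u, u) + (0, a)" "(v, v + b) = (v, v) + (0, b)"
      "(u, m (u, u + a)) = (u, u) + - (0, a)" "(v, m (v, v + b)) = (v, v) + - (0, b)"
      by (simp_all add: m)
    have 1: "D (u, u + a) (v, v + b) = ?X + sym_form i p a b"
      unfolding e(1,2) by (simp only: D_add D_diag \<sigma>(2)) (simp add: algebra_simps)
    have "D (u, m (u, u + a)) (v, m (v, v + b)) = - ?X + sym_form i p a b"
      unfolding e(3,4) by (simp only: D_add D_neg D_diag \<sigma>(2)) (simp add: algebra_simps)
    moreover have "D (u, m (u, u + a)) (v, m (v, v + b)) = D (u, u + a) (v, v + b)"
      using D_inv[of "(u, u + a)" "(v, v + b)"] by simp
    ultimately have "- ?X + sym_form i p a b = ?X + sym_form i p a b" using 1 by metis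
    then have "- ?X = ?X" by (rule add_right_imp_eq)
    then have "?X + ?X = 0" by (metis add.left_inverse)
    then have "?X = 0" by (rule double_eq_zero)
    then show ?thesis unfolding 1 by (simp only: add_0)
  qed
  have "D (u, u') (v, v') = sym_form i p (u' - u) (v' - v)" using key[of u "u' - u" v "v' - v"] by simp
  also have "\<dots> = sym_form i p (u - u') (v - v')"
    using sym_form_bilinear(6,7)[OF i] by (metis minus_diff_eq minus_minus)
  finally show "D (u, u') (v, v') = sym_form i p (u - u') (v - v')" .
qed

text \<open>
  The second differential of a homomorphism \<open>f\<close> is determined by those of the symmetries: compare the
  second differentials of \<open>f \<circ> \<sigma>\<^sub>p\<close> and \<open>\<sigma>\<^bsub>f p\<^esub> \<circ> f\<close> at \<open>p\<close>.
\<close>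

lemma homomorphism_second_differential:
  assumes f: "smooth_reps M M f" and i: "i \<in> charts_at M p" and j: "j \<in> charts_at M (f p)"
    and hom: "\<And>q. q \<in> points M \<Longrightarrow> f (\<mu> (p, q)) = \<mu> (f p, f q)"
  shows "rep_second_differential M M f i j p u v + rep_second_differential M M f i j p u v
    = sym_form j (f p) (rep_differential M M f i j p u) (rep_differential M M f i j p v)
      - rep_differential M M f i j p (sym_form i p u v)"
proof -
  note A = smooth_atlas_axioms
  have p: "p \<in> points M" "f p \<in> points M" using i j cdom_points by auto
  have ci: "i \<in> index M" "p \<in> cdom M i" and cj: "j \<in> index M" "f p \<in> cdom M j"
    and c\<mu>: "i \<in> index M" "\<mu> (p, p) \<in> cdom M i" and cf: "j \<in> index M" "f (\<mu> (p, p)) \<in> cdom M j"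
    using i j p by auto
  have neg: "rep_second_differential M M f i j p (- u) (- v) = rep_second_differential M M f i j p u v"
    using rep_second_differential_bilinear(1,2)[OF A A f ci cj]
      additive_neg[of "\<lambda>u. rep_second_differential M M f i j p u (- v)"]
      additive_neg[of "rep_second_differential M M f i j p u"] by simp
  have "rep_second_differential M M f i j p u v + rep_differential M M f i j p (sym_form i p u v)
    = sym_form j (f p) (rep_differential M M f i j p u) (rep_differential M M f i j p v)
      + - rep_second_differential M M f i j p u v"
    using commuting_square(2)[OF A A A A \<sigma>_smooth[OF p(1)] f f \<sigma>_smooth[OF p(2)] ci c\<mu> cj cf, of u v] hom
      \<sigma>_differential[OF i] \<sigma>_differential[OF j] p neg by (simp add: sym_form_def)
  then show ?thesis by (simp add: algebra_simps)
qed

text \<open>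
  The form at the point with the coordinate \<open>x\<close> is the second differential of the representative of \<open>\<mu>\<close>
  at \<open>(x, x)\<close> in the directions \<open>(0, u)\<close> and \<open>(0, v)\<close>. In this description it depends smoothly on \<open>x\<close>.
\<close>

lemma sym_form_smooth:
  assumes i: "i \<in> index M"
  shows "smooth_on (prod_scale (smul M) (prod_scale (smul M) (smul M))) (smul M) ((chart M i ` cdom M i) \<times> UNIV)
    (\<lambda>(x, u, v). sym_form i (inv_into (cdom M i) (chart M i) x) u v)"
proof -
  interpret MM: smooth_atlas "prod_manifold M M" by (rule prod_atlas)
  let ?s = "smul M" and ?U = "local_dom (prod_manifold M M) M \<mu> (i, i) i"
  let ?ss = "prod_scale ?s ?s" and ?W = "(chart M i ` cdom M i) \<times> (UNIV :: ('v \<times> 'v) set)"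
  let ?g = "\<lambda>p :: 'v \<times> 'v \<times> 'v. ((fst p, fst p), ((0, fst (snd p)), (0, snd (snd p)))) :: ('v \<times> 'v) \<times> ('v \<times> 'v) \<times> ('v \<times> 'v)"
  let ?D = "second_differential ?ss ?s ?U (local_rep (prod_manifold M M) M \<mu> (i, i) i)"
  note tms = tm topological_module_prod
  have W: "open ?W" using open_chart_image[OF i] by (intro open_Times) auto
  have sm: "smooth_on ?ss ?s ?U (local_rep (prod_manifold M M) M \<mu> (i, i) i)"
    using smooth_reps_smooth_on[OF \<mu>_smooth, of "(i, i)" i] i by simp
  have D: "smooth_on (prod_scale ?ss (prod_scale ?ss ?ss)) ?s (?U \<times> UNIV) (\<lambda>(x, u, v). ?D x u v)"
    by (intro smooth_on_second_differential tms sm)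
  have "continuous_linear (prod_scale ?s ?ss) (prod_scale ?ss (prod_scale ?ss ?ss)) ?g"
    by (auto simp: continuous_linear_def prod_scale_def intro!: continuous_intros)
  then have g: "smooth_on (prod_scale ?s ?ss) (prod_scale ?ss (prod_scale ?ss ?ss)) ?W ?g"
    by (intro smooth_on_linear tms W)
  have img: "?g ` ?W \<subseteq> ?U \<times> UNIV"
  proof clarsimp
    fix q assume "q \<in> cdom M i"
    then show "(chart M i q, chart M i q) \<in> ?U"
      using MM.chart_in_local_dom[of "(i, i)" "(q, q)" M \<mu> i] i cdom_points by simp
  qed
  have "smooth_on (prod_scale ?s ?ss) ?s ?W (\<lambda>p. (\<lambda>(x, u, v). ?D x u v) (?g p))"
    by (rule smooth_on_compose[OF _ _ _ g D img]) (auto intro!: tms)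
  then show ?thesis
  proof (rule smooth_on_cong)
    fix t assume "t \<in> ?W"
    then obtain q u v where t: "t = (chart M i q, u, v)" "q \<in> cdom M i" by auto
    then have "i \<in> charts_at M q" "q \<in> points M" using i cdom_points by auto
    then show "(\<lambda>(x, u, v). ?D x u v) (?g t) = (\<lambda>(x, u, v). sym_form i (inv_into (cdom M i) (chart M i) x) u v) t"
      using \<sigma>_rep(2)[of i q i q i u v] t i by (simp add: sym_form_def rep_second_differential_def)
  qed
qed

end


section \<open>Linear connections in straightened charts\<close>

text \<open>
  The push-forward map in the definition of the connection form \<open>b\<close>, and its inverse.
\<close>

definition bend :: "('v \<Rightarrow> 'v \<Rightarrow> 'v::ab_group_add) \<Rightarrow> 'v \<times> 'v \<times> 'v \<Rightarrow> 'v \<times> 'v \<times> 'v" where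
  "bend b = (\<lambda>(u, v, w). (u, v, w + b u v))"

definition unbend :: "('v \<Rightarrow> 'v \<Rightarrow> 'v::ab_group_add) \<Rightarrow> 'v \<times> 'v \<times> 'v \<Rightarrow> 'v \<times> 'v \<times> 'v" where
  "unbend b = (\<lambda>(u, v, w). (u, v, w - b u v))"

lemma bend_unbend [simp]: "bend b (unbend b t) = t" "unbend b (bend b t) = t"
  by (auto simp: bend_def unbend_def split: prod.splits)

lemma fiber_scale_simp [simp]: "fiber_scale M r (u, v, w) = (smul M r u, smul M r v, smul M r w)"
  by (simp add: fiber_scale_def prod_scale_def)

lemma map_prod_fiber_linear:
  assumes "\<And>u v. S (u + v) = S u + S v" and "\<And>r u. S (smul M r u) = smul M r (S u)"
  shows "map_prod S (map_prod S S) (t + t') = map_prod S (map_prod S S) t + map_prod S (map_prod S S) t'"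
    and "map_prod S (map_prod S S) (fiber_scale M r t) = fiber_scale M r (map_prod S (map_prod S S) t)"
proof -
  obtain u v w u' v' w' where t: "t = (u, v, w)" "t' = (u', v', w')" by (metis prod_cases3)
  show "map_prod S (map_prod S S) (t + t') = map_prod S (map_prod S S) t + map_prod S (map_prod S S) t'"
    unfolding t by (simp add: assms(1))
  show "map_prod S (map_prod S S) (fiber_scale M r t) = fiber_scale M r (map_prod S (map_prod S S) t)"
    unfolding t by (simp add: assms(2))
qed

definition straight_chart :: "('v \<Rightarrow> 'v \<Rightarrow> 'v::ab_group_add) \<Rightarrow> 'i \<Rightarrow> ('m, 'i, 'v) second_tangent \<Rightarrow> 'v \<times> 'v \<times> 'v" where
  "straight_chart b i z = unbend b (fiber_chart i z)"

lemma bilinear_mapI: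
  assumes "Modules.module s"
    and "\<And>u u' v. b (u + u') v = b u v + b u' v" "\<And>u v v'. b u (v + v') = b u v + b u v'"
    and "\<And>r u v. b (s r u) v = s r (b u v)" "\<And>r u v. b u (s r v) = s r (b u v)"
  shows "bilinear_map s b"
  using assms by (simp add: bilinear_map_def module_hom_iff)

lemma bilinear_mapD:
  assumes "bilinear_map s b"
  shows "b (u + u') v = b u v + b u' v" "b u (v + v') = b u v + b u v'"
    and "b (s r u) v = s r (b u v)" "b u (s r v) = s r (b u v)"
    and "b 0 v = 0" "b u 0 = 0" "b (- u) v = - b u v" "b u (- v) = - b u v"
proof -
  have L: "b (u + u') v = b u v + b u' v" for u u' v using assms by (simp add: bilinear_map_def module_hom_iff)
  have R: "b u (v + v') = b u v + b u v'" for u v v' using assms by (simp add: bilinear_map_def module_hom_iff)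
  show "b (u + u') v = b u v + b u' v" "b u (v + v') = b u v + b u v'" by (rule L, rule R)
  show "b (s r u) v = s r (b u v)" "b u (s r v) = s r (b u v)"
    using assms by (simp_all add: bilinear_map_def module_hom_iff)
  have "b 0 v + b 0 v = b 0 v + 0" "b u 0 + b u 0 = b u 0 + 0" using L[of 0 0 v] R[of u 0 0] by simp_all
  then show "b 0 v = 0" "b u 0 = 0" by (auto dest: add_left_imp_eq)
  show "b (- u) v = - b u v" "b u (- v) = - b u v"
    using additive_neg[of "\<lambda>u. b u v"] additive_neg[of "b u"] L R by auto
qed

context smooth_atlas
begin

lemma straight_chart_bij:
  assumes "i \<in> charts_at M p"
  shows "z \<in> TT_fiber M p \<Longrightarrow> fiber_point M i p (bend b (straight_chart b i z)) = z"
    and "fiber_point M i p (bend b t) \<in> TT_fiber M p"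
    and "straight_chart b i (fiber_point M i p (bend b t)) = t"
  using fiber_point[OF assms] fiber_point_chart[OF assms] by (simp_all add: straight_chart_def)

lemma straight_chart_inj:
  assumes "i \<in> charts_at M p" "z \<in> TT_fiber M p" "z' \<in> TT_fiber M p" "straight_chart b i z = straight_chart b i z'"
  shows "z = z'"
  using straight_chart_bij(1)[OF assms(1)] assms by metis

text \<open>
  This is the push-forward condition, read through the inverse of the parametrisation: the operations
  of the fiber are then determined by their values in the straightened chart.
\<close>

lemma connection_form_iff:
  assumes i: "i \<in> charts_at M p"
  shows "connection_form M L i p b \<longleftrightarrow> bilinear_map (smul M) b \<and>
    (\<forall>z\<in>TT_fiber M p. \<forall>z'\<in>TT_fiber M p. z \<oplus>\<^bsub>L p\<^esub> z' \<in> TT_fiber M p \<and>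
      straight_chart b i (z \<oplus>\<^bsub>L p\<^esub> z') = straight_chart b i z + straight_chart b i z') \<and>
    (\<forall>r. \<forall>z\<in>TT_fiber M p. r \<odot>\<^bsub>L p\<^esub> z \<in> TT_fiber M p \<and>
      straight_chart b i (r \<odot>\<^bsub>L p\<^esub> z) = fiber_scale M r (straight_chart b i z))" (is "_ \<longleftrightarrow> _ \<and> ?add \<and> ?smult")
proof -
  let ?\<Psi> = "\<lambda>t. fiber_point M i p (bend b t)"
  have \<Psi>: "(\<lambda>(u, v, w). inv_into (TT_fiber M p) (fiber_chart i) (u, v, w + b u v)) = ?\<Psi>"
    by (auto simp: inv_fiber_chart[OF i] bend_def)
  note S = straight_chart_bij[OF i, where b = b]
  have "(\<forall>t t'. ?\<Psi> (t + t') = ?\<Psi> t \<oplus>\<^bsub>L p\<^esub> ?\<Psi> t') \<longleftrightarrow> ?add"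
  proof
    assume *: "\<forall>t t'. ?\<Psi> (t + t') = ?\<Psi> t \<oplus>\<^bsub>L p\<^esub> ?\<Psi> t'"
    show ?add
    proof (intro ballI)
      fix z z' assume "z \<in> TT_fiber M p" "z' \<in> TT_fiber M p"
      then have "z \<oplus>\<^bsub>L p\<^esub> z' = ?\<Psi> (straight_chart b i z + straight_chart b i z')"
        using *[rule_format, of "straight_chart b i z" "straight_chart b i z'"] S(1) by simp
      then show "z \<oplus>\<^bsub>L p\<^esub> z' \<in> TT_fiber M p \<and>
          straight_chart b i (z \<oplus>\<^bsub>L p\<^esub> z') = straight_chart b i z + straight_chart b i z'"
        using S(2,3) by simp
    qed
  next
    assume ?add
    then show "\<forall>t t'. ?\<Psi> (t + t') = ?\<Psi> t \<oplus>\<^bsub>L p\<^esub> ?\<Psi> t'"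
      using S(2,3) by (intro allI straight_chart_inj[OF i, where b = b]) simp_all
  qed
  moreover have "(\<forall>r t. ?\<Psi> (fiber_scale M r t) = r \<odot>\<^bsub>L p\<^esub> ?\<Psi> t) \<longleftrightarrow> ?smult"
  proof
    assume *: "\<forall>r t. ?\<Psi> (fiber_scale M r t) = r \<odot>\<^bsub>L p\<^esub> ?\<Psi> t"
    show ?smult
    proof (intro allI ballI)
      fix r z assume "z \<in> TT_fiber M p"
      then have "r \<odot>\<^bsub>L p\<^esub> z = ?\<Psi> (fiber_scale M r (straight_chart b i z))"
        using *[rule_format, of r "straight_chart b i z"] S(1) by simp
      then show "r \<odot>\<^bsub>L p\<^esub> z \<in> TT_fiber M p \<and> straight_chart b i (r \<odot>\<^bsub>L p\<^esub> z) = fiber_scale M r (straight_chart b i z)"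
        using S(2,3) by simp
    qed
  next
    assume ?smult
    then show "\<forall>r t. ?\<Psi> (fiber_scale M r t) = r \<odot>\<^bsub>L p\<^esub> ?\<Psi> t"
      using S(2,3) by (intro allI straight_chart_inj[OF i, where b = b]) simp_all
  qed
  ultimately show ?thesis unfolding connection_form_def Let_def \<Psi> by simp
qed

lemma connection_formD:
  assumes "connection_form M L i p b" "i \<in> charts_at M p" "z \<in> TT_fiber M p"
  shows "z' \<in> TT_fiber M p \<Longrightarrow> z \<oplus>\<^bsub>L p\<^esub> z' \<in> TT_fiber M p"
    and "z' \<in> TT_fiber M p \<Longrightarrow> straight_chart b i (z \<oplus>\<^bsub>L p\<^esub> z') = straight_chart b i z + straight_chart b i z'"
    and "r \<odot>\<^bsub>L p\<^esub> z \<in> TT_fiber M p"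
    and "straight_chart b i (r \<odot>\<^bsub>L p\<^esub> z) = fiber_scale M r (straight_chart b i z)"
  using assms by (auto simp: connection_form_iff)

lemma straight_chart_minus:
  assumes c: "connection_form M L i p b" and i: "i \<in> charts_at M p"
    and L: "carrier (L p) = TT_fiber M p" "Module.module scalar_ring (L p)"
    and z: "z \<in> TT_fiber M p" "z' \<in> TT_fiber M p"
  shows "straight_chart b i (z \<ominus>\<^bsub>L p\<^esub> z') = straight_chart b i z - straight_chart b i z'"
    and "z \<ominus>\<^bsub>L p\<^esub> z' \<in> TT_fiber M p"
proof -
  interpret L: abelian_group "L p" using L(2) by (simp add: Module.module_def)
  note D = connection_formD[OF c i]
  have "\<zero>\<^bsub>L p\<^esub> \<in> TT_fiber M p" using L.zero_closed L(1) by simp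
  then have "straight_chart b i \<zero>\<^bsub>L p\<^esub> + straight_chart b i \<zero>\<^bsub>L p\<^esub> = straight_chart b i \<zero>\<^bsub>L p\<^esub> + 0"
    using D(2)[of "\<zero>\<^bsub>L p\<^esub>" "\<zero>\<^bsub>L p\<^esub>"] L.zero_closed by simp
  then have 0: "straight_chart b i \<zero>\<^bsub>L p\<^esub> = 0" by (rule add_left_imp_eq)
  have n: "\<ominus>\<^bsub>L p\<^esub> z' \<in> TT_fiber M p" using L.a_inv_closed z(2) L(1) by simp
  have "straight_chart b i z' + straight_chart b i (\<ominus>\<^bsub>L p\<^esub> z') = 0"
    using D(2)[OF z(2) n] L.r_neg[of z'] z(2) L(1) 0 by simp
  then have "straight_chart b i (\<ominus>\<^bsub>L p\<^esub> z') = - straight_chart b i z'"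
    by (rule minus_unique[symmetric])
  then show "straight_chart b i (z \<ominus>\<^bsub>L p\<^esub> z') = straight_chart b i z - straight_chart b i z'"
    using D(2)[OF z(1) n] by (simp add: a_minus_def)
  show "z \<ominus>\<^bsub>L p\<^esub> z' \<in> TT_fiber M p" using D(1)[OF z(1) n] by (simp add: a_minus_def)
qed

text \<open>
  The sum of the points with the coordinates \<open>(u, 0, 0)\<close> and \<open>(0, v, 0)\<close> is \<open>(u, v, b(u, v))\<close>.
\<close>

lemma connection_form_unique:
  assumes b: "connection_form M L i p b" and b': "connection_form M L i p b'" and i: "i \<in> charts_at M p"
  shows "b = b'"
proof (intro ext)
  fix u v
  note bil = bilinear_mapD[of "smul M" b] bilinear_mapD[of "smul M" b']
  have B: "bilinear_map (smul M) b" "bilinear_map (smul M) b'" using b b' by (auto simp: connection_form_def)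
  let ?z = "fiber_point M i p (u, 0, 0)" and ?z' = "fiber_point M i p (0, v, 0)"
  have z: "?z \<in> TT_fiber M p" "?z' \<in> TT_fiber M p" by (rule fiber_point[OF i])+
  have c: "fiber_chart i ?z = (u, 0, 0)" "fiber_chart i ?z' = (0, v, 0)" by (rule fiber_point[OF i])+
  have "straight_chart b i (?z \<oplus>\<^bsub>L p\<^esub> ?z') = (u, v, 0)" "straight_chart b' i (?z \<oplus>\<^bsub>L p\<^esub> ?z') = (u, v, 0)"
    using connection_formD(2)[OF b i z] connection_formD(2)[OF b' i z] B
    by (simp_all add: straight_chart_def c unbend_def bilinear_mapD)
  then have "fiber_chart i (?z \<oplus>\<^bsub>L p\<^esub> ?z') = bend b (u, v, 0)" "fiber_chart i (?z \<oplus>\<^bsub>L p\<^esub> ?z') = bend b' (u, v, 0)"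
    unfolding straight_chart_def by (metis bend_unbend(1))+
  then show "b u v = b' u v" by (simp add: bend_def)
qed

end


section \<open>The canonical connection of a symmetric space\<close>

text \<open>
  The combination \<open>2z - z'\<close> in straightened coordinates. The quadratic map \<open>q(u, v) = b(u, v)\<close> satisfies
  \<open>q(2a - a') - 2 q(a) + q(a') = 2 q(a - a')\<close>; this is why half of the second differential straightens
  the product.
\<close>

lemma fiber_affine_identity:
  fixes b :: "'v \<Rightarrow> 'v \<Rightarrow> 'v::ab_group_add"
  assumes "bilinear_map s b"
  shows "unbend b (u + u - u', v + v - v', w + w - w' + (b (u - u') (v - v') + b (u - u') (v - v')))
    = unbend b (u, v, w) + unbend b (u, v, w) - unbend b (u', v', w')"
proof -
  have d: "b (x - y) z = b x z - b y z" "b z (x - y) = b z x - b z y" for x y z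
    using bilinear_mapD[OF assms] by (metis uminus_add_conv_diff add.commute)+
  show ?thesis
    by (simp add: unbend_def bilinear_mapD(1,2)[OF assms] d)
qed

context symmetric
begin

definition canonical_form :: "'i \<Rightarrow> 'm \<Rightarrow> 'v \<Rightarrow> 'v \<Rightarrow> 'v" where
  "canonical_form i p u v = smul M half (sym_form i p u v)"

lemma canonical_form_double: "canonical_form i p u v + canonical_form i p u v = sym_form i p u v"
  by (simp add: canonical_form_def half_double)

lemma canonical_form_eqI: "(\<And>u v. b u v + b u v = sym_form i p u v) \<Longrightarrow> b = canonical_form i p"
  by (intro ext) (metis canonical_form_def half_double(1))

lemma canonical_form_bilinear: "i \<in> charts_at M p \<Longrightarrow> bilinear_map (smul M) (canonical_form i p)"
  by (rule bilinear_mapI)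
    (auto simp: canonical_form_def sym_form_bilinear V.scale_right_distrib V.module_axioms mult.commute simp del: charts_at_iff)

lemma canonical_form_symmetric: "i \<in> charts_at M p \<Longrightarrow> canonical_form i p u v = canonical_form i p v u"
  using sym_form_bilinear(5)[of i p u v] by (simp add: canonical_form_def)

lemma TT_product_fiber:
  assumes i: "i \<in> charts_at M p" and z: "z \<in> TT_fiber M p" "z' \<in> TT_fiber M p"
    and c: "fiber_chart i z = (u, v, w)" "fiber_chart i z' = (u', v', w')"
  shows "TT_product M \<mu> (z, z') \<in> TT_fiber M p"
    and "fiber_chart i (TT_product M \<mu> (z, z')) =
      (u + u - u', v + v - v', w + w - w' + sym_form i p (u - u') (v - v'))"
proof -
  have p: "\<mu> (p, p) = p" using i cdom_points by auto
  then have k: "i \<in> charts_at M (\<mu> (p, p))" using i by simp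
  note T = TT_product_chart[OF \<mu>_smooth z i i k c]
  show "TT_product M \<mu> (z, z') \<in> TT_fiber M p" using T(1) p by simp
  show "fiber_chart i (TT_product M \<mu> (z, z')) =
      (u + u - u', v + v - v', w + w - w' + sym_form i p (u - u') (v - v'))"
    unfolding T(2) by (simp add: \<mu>_second_order[OF i] add.commute)
qed

text \<open>
  Subtracting \<open>A/2\<close> at the two arguments and at their product absorbs the term \<open>A(u - u', v - v')\<close>
  of the product, since \<open>A\<close> is bilinear.
\<close>

lemma straight_TT_product:
  assumes i: "i \<in> charts_at M p" and z: "z \<in> TT_fiber M p" "z' \<in> TT_fiber M p"
  defines "\<kappa> \<equiv> straight_chart (canonical_form i p) i"
  shows "\<kappa> (TT_product M \<mu> (z, z')) = \<kappa> z + \<kappa> z - \<kappa> z'"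
proof -
  obtain u v w u' v' w' where c: "fiber_chart i z = (u, v, w)" "fiber_chart i z' = (u', v', w')"
    by (metis prod_cases3)
  show ?thesis
    using fiber_affine_identity[OF canonical_form_bilinear[OF i], of u u' v v' w w'] TT_product_fiber(2)[OF i z c]
    by (simp add: \<kappa>_def straight_chart_def c canonical_form_double)
qed

text \<open>
  The second differential of \<open>f\<close> is the difference of the two canonical forms, which is just what the
  straightening removes. The case \<open>f = id\<close> covers the changes of charts.
\<close>

lemma straight_homomorphism:
  assumes f: "smooth_reps M M f" and i: "i \<in> charts_at M p" and j: "j \<in> charts_at M (f p)"
    and hom: "\<And>q. q \<in> points M \<Longrightarrow> f (\<mu> (p, q)) = \<mu> (f p, f q)"
  shows "unbend (canonical_form j (f p)) (second_tangent_rep (rep_differential M M f i j p) (rep_second_differential M M f i j p) t)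
    = map_prod (rep_differential M M f i j p) (map_prod (rep_differential M M f i j p) (rep_differential M M f i j p))
        (unbend (canonical_form i p) t)"
proof -
  let ?S = "rep_differential M M f i j p" and ?B = "rep_second_differential M M f i j p"
  obtain u v w where t: "t = (u, v, w)" by (cases t)
  have "i \<in> index M" "p \<in> cdom M i" "j \<in> index M" "f p \<in> cdom M j" using i j by auto
  note lin = rep_differential_linear[OF smooth_atlas_axioms smooth_atlas_axioms f this]
  have B: "?B u v = canonical_form j (f p) (?S u) (?S v) - ?S (canonical_form i p u v)"
  proof -
    have "?B u v = smul M half (?B u v + ?B u v)" by (simp only: half_double)
    also have "\<dots> = smul M half (sym_form j (f p) (?S u) (?S v) - ?S (sym_form i p u v))"
      by (simp only: homomorphism_second_differential[OF f i j hom])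
    also have "\<dots> = canonical_form j (f p) (?S u) (?S v) - ?S (canonical_form i p u v)"
      by (simp add: canonical_form_def V.scale_right_diff_distrib lin(2))
    finally show ?thesis .
  qed
  have "?S (w - canonical_form i p u v) = ?S w - ?S (canonical_form i p u v)"
    using lin(1)[of w "- canonical_form i p u v"] lin(4) by simp
  then show ?thesis by (simp add: t second_tangent_rep_def unbend_def B)
qed

text \<open>
  This property in charts mediates between invariance under the symmetries and flatness on the
  fibers: each of them is equivalent to it.
\<close>

definition has_canonical_forms :: "('m \<Rightarrow> ('k, ('m, 'i, 'v) second_tangent) module) \<Rightarrow> bool" where
  "has_canonical_forms L \<longleftrightarrow> (\<forall>p. \<forall>i\<in>charts_at M p. connection_form M L i p (canonical_form i p))"

lemma has_canonical_formsD: "has_canonical_forms L \<Longrightarrow> i \<in> charts_at M p \<Longrightarrow> connection_form M L i p (canonical_form i p)"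
  by (simp add: has_canonical_forms_def)

lemma linear_connectionD:
  assumes "linear_connection M L"
  shows "p \<in> points M \<Longrightarrow> carrier (L p) = TT_fiber M p" "p \<in> points M \<Longrightarrow> Module.module scalar_ring (L p)"
    and "i \<in> charts_at M p \<Longrightarrow> \<exists>b. connection_form M L i p b"
  using assms by (auto simp: linear_connection_def)

text \<open>
  Evaluate flatness at points with the coordinates \<open>(u, v, 0)\<close> and \<open>(0, 0, 0)\<close>, where the product
  has the last coordinate \<open>A(u, v)\<close> and \<open>2z\<close> has the last coordinate \<open>2 b(u, v)\<close>.
\<close>

lemma flat_imp_canonical_forms:
  assumes L: "linear_connection M L" and flat: "flat_on_fibers M \<mu> L"
  shows "has_canonical_forms L"
  unfolding has_canonical_forms_def
proof (intro allI ballI)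
  fix p i assume i: "i \<in> charts_at M p"
  then have p: "p \<in> points M" using cdom_points by auto
  obtain b where b: "connection_form M L i p b" using linear_connectionD(3)[OF L i] by auto
  then have B: "bilinear_map (smul M) b" by (simp add: connection_form_def)
  have "b u v + b u v = sym_form i p u v" for u v
  proof -
    let ?z = "fiber_point M i p (u, v, 0)" and ?z' = "fiber_point M i p (0, 0, 0)"
    have z: "?z \<in> TT_fiber M p" "?z' \<in> TT_fiber M p"
      and c: "fiber_chart i ?z = (u, v, 0)" "fiber_chart i ?z' = (0, 0, 0)" by (rule fiber_point[OF i])+
    have z2: "2 \<odot>\<^bsub>L p\<^esub> ?z \<in> TT_fiber M p" by (rule connection_formD(3)[OF b i z(1)])
    have two: "smul M 2 x = x + x" for x
      using V.scale_left_distrib[of 1 1 x] by simp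
    have "TT_product M \<mu> (?z, ?z') = (2 \<odot>\<^bsub>L p\<^esub> ?z) \<ominus>\<^bsub>L p\<^esub> ?z'"
      using flat p z by (simp add: flat_on_fibers_def)
    then have "straight_chart b i (TT_product M \<mu> (?z, ?z')) = fiber_scale M 2 (straight_chart b i ?z) - straight_chart b i ?z'"
      using straight_chart_minus(1)[OF b i linear_connectionD(1,2)[OF L p] z2 z(2)] connection_formD(4)[OF b i z(1)] by simp
    then show ?thesis
      using TT_product_fiber(2)[OF i z c]
      by (simp add: straight_chart_def c unbend_def bilinear_mapD[OF B] two)
  qed
  then have "b = canonical_form i p" by (rule canonical_form_eqI)
  then show "connection_form M L i p (canonical_form i p)" using b by simp
qed

text \<open>
  Only the symmetry at \<open>p\<close> itself and the fiber over \<open>p\<close> are considered. There \<open>TT\<sigma>\<^sub>p\<close> is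
  \<open>(u, v, w) \<mapsto> (-u, -v, A(u, v) - w)\<close>; its additivity at \<open>(u, 0, 0)\<close> and \<open>(0, v, 0)\<close> gives \<open>A = 2b\<close>.
\<close>

lemma invariant_imp_canonical_forms:
  assumes L: "linear_connection M L" and inv: "invariant_under_symmetries M \<mu> L"
  shows "has_canonical_forms L"
  unfolding has_canonical_forms_def
proof (intro allI ballI)
  fix p i assume i: "i \<in> charts_at M p"
  then have p: "p \<in> points M" using cdom_points by auto
  obtain b where b: "connection_form M L i p b" using linear_connectionD(3)[OF L i] by auto
  then have B: "bilinear_map (smul M) b" by (simp add: connection_form_def)
  let ?\<sigma> = "\<lambda>y. \<mu> (p, y)"
  have lin: "linear_map (L p) (L p) (TT_map M ?\<sigma>)"
    using inv p by (simp add: invariant_under_symmetries_def invariant_connection_def) (metis M1)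
  have \<sigma>: "TT_map M ?\<sigma> z \<in> TT_fiber M p" "fiber_chart i (TT_map M ?\<sigma> z) = (- u, - v, sym_form i p u v - w)"
    if "z \<in> TT_fiber M p" "fiber_chart i z = (u, v, w)" for z u v w
    using TT_map_chart[OF \<sigma>_smooth[OF p] that(1) i, of i] that i p \<sigma>_differential[OF i]
    by (simp_all add: second_tangent_rep_def sym_form_def)
  have "b u v + b u v = sym_form i p u v" for u v
  proof -
    let ?z = "fiber_point M i p (u, 0, 0)" and ?z' = "fiber_point M i p (0, v, 0)" and ?T = "TT_map M ?\<sigma>"
    have z: "?z \<in> TT_fiber M p" "?z' \<in> TT_fiber M p"
      and c: "fiber_chart i ?z = (u, 0, 0)" "fiber_chart i ?z' = (0, v, 0)" by (rule fiber_point[OF i])+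
    have zz: "?z \<oplus>\<^bsub>L p\<^esub> ?z' \<in> TT_fiber M p" by (rule connection_formD(1)[OF b i z])
    have "straight_chart b i (?z \<oplus>\<^bsub>L p\<^esub> ?z') = (u, v, 0)"
      using connection_formD(2)[OF b i z] by (simp add: straight_chart_def c unbend_def bilinear_mapD[OF B])
    then have czz: "fiber_chart i (?z \<oplus>\<^bsub>L p\<^esub> ?z') = (u, v, b u v)"
      unfolding straight_chart_def using bend_unbend(1)[of b "fiber_chart i (?z \<oplus>\<^bsub>L p\<^esub> ?z')"] by (simp add: bend_def)
    have A0: "sym_form i p u 0 = 0" "sym_form i p 0 v = 0"
      using sym_form_bilinear(3)[OF i, of 0 0 v] sym_form_bilinear(4)[OF i, of u 0 0] by simp_all
    have "?T (?z \<oplus>\<^bsub>L p\<^esub> ?z') = ?T ?z \<oplus>\<^bsub>L p\<^esub> ?T ?z'"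
      using lin z linear_connectionD(1)[OF L p] by (simp add: linear_map_def)
    then have "straight_chart b i (?T (?z \<oplus>\<^bsub>L p\<^esub> ?z')) = straight_chart b i (?T ?z) + straight_chart b i (?T ?z')"
      using connection_formD(2)[OF b i \<sigma>(1)[OF z(1) c(1)] \<sigma>(1)[OF z(2) c(2)]] by simp
    then show ?thesis
      using \<sigma>(2)[OF z(1) c(1)] \<sigma>(2)[OF z(2) c(2)] \<sigma>(2)[OF zz czz]
      by (simp add: straight_chart_def unbend_def bilinear_mapD[OF B] A0) (simp add: algebra_simps)
  qed
  then have "b = canonical_form i p" by (rule canonical_form_eqI)
  then show "connection_form M L i p (canonical_form i p)" using b by simp
qed

lemma canonical_forms_imp_flat:
  assumes L: "linear_connection M L" and can: "has_canonical_forms L"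
  shows "flat_on_fibers M \<mu> L"
  unfolding flat_on_fibers_def
proof (intro ballI)
  fix p z z' assume p: "p \<in> points M" and z: "z \<in> TT_fiber M p" "z' \<in> TT_fiber M p"
  obtain i where "i \<in> index M" "p \<in> cdom M i" using chart_exists[OF p] .
  then have i: "i \<in> charts_at M p" by simp
  note c = has_canonical_formsD[OF can i]
  have z2: "2 \<odot>\<^bsub>L p\<^esub> z \<in> TT_fiber M p" by (rule connection_formD(3)[OF c i z(1)])
  note m = straight_chart_minus[OF c i linear_connectionD(1,2)[OF L p] z2 z(2)]
  obtain u v w u' v' w' where cz: "fiber_chart i z = (u, v, w)" "fiber_chart i z' = (u', v', w')" by (metis prod_cases3)
  have two: "smul M 2 x = x + x" for x using V.scale_left_distrib[of 1 1 x] by simp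
  have two': "fiber_scale M 2 t = t + t" for t by (cases t) (simp add: two)
  show "TT_product M \<mu> (z, z') = (2 \<odot>\<^bsub>L p\<^esub> z) \<ominus>\<^bsub>L p\<^esub> z'"
  proof (rule straight_chart_inj[OF i TT_product_fiber(1)[OF i z cz] m(2)])
    show "straight_chart (canonical_form i p) i (TT_product M \<mu> (z, z'))
        = straight_chart (canonical_form i p) i ((2 \<odot>\<^bsub>L p\<^esub> z) \<ominus>\<^bsub>L p\<^esub> z')"
      unfolding m(1) connection_formD(4)[OF c i z(1)] straight_TT_product[OF i z] two' ..
  qed
qed

lemma canonical_forms_imp_invariant:
  assumes L: "linear_connection M L" and can: "has_canonical_forms L"
  shows "invariant_under_symmetries M \<mu> L"
  unfolding invariant_under_symmetries_def invariant_connection_def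
proof (intro ballI)
  fix x p assume x: "x \<in> points M" and p: "p \<in> points M"
  let ?\<sigma> = "\<lambda>y. \<mu> (x, y)" and ?q = "\<mu> (x, p)"
  have q: "?q \<in> points M" using x p by (rule \<mu>_closed)
  obtain i where "i \<in> index M" "p \<in> cdom M i" using chart_exists[OF p] .
  then have i: "i \<in> charts_at M p" by simp
  obtain j where "j \<in> index M" "?q \<in> cdom M j" using chart_exists[OF q] .
  then have j: "j \<in> charts_at M ?q" by simp
  note c = has_canonical_formsD[OF can i] and d = has_canonical_formsD[OF can j]
  let ?S = "rep_differential M M ?\<sigma> i j p"
  let ?S3 = "map_prod ?S (map_prod ?S ?S)"
  have T: "TT_map M ?\<sigma> z \<in> TT_fiber M ?q"
    "straight_chart (canonical_form j ?q) j (TT_map M ?\<sigma> z) = ?S3 (straight_chart (canonical_form i p) i z)"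
    if "z \<in> TT_fiber M p" for z
    using TT_map_chart[OF \<sigma>_smooth[OF x] that i j] straight_homomorphism[OF \<sigma>_smooth[OF x] i j] M3[OF x p]
    by (simp_all add: straight_chart_def)
  have "i \<in> index M" "p \<in> cdom M i" "j \<in> index M" "?q \<in> cdom M j" using i j by auto
  note lin = rep_differential_linear[OF smooth_atlas_axioms smooth_atlas_axioms \<sigma>_smooth[OF x] this]
  note add = map_prod_fiber_linear(1)[OF lin(1,2)] and scale = map_prod_fiber_linear(2)[OF lin(1,2)]
  show "linear_map (L p) (L ?q) (TT_map M ?\<sigma>)"
    unfolding linear_map_def linear_connectionD(1)[OF L p] linear_connectionD(1)[OF L q]
  proof (intro conjI ballI allI)
    show "TT_map M ?\<sigma> \<in> TT_fiber M p \<rightarrow> TT_fiber M ?q" using T(1) by auto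
    fix z assume z: "z \<in> TT_fiber M p"
    {
      fix z' assume z': "z' \<in> TT_fiber M p"
      show "TT_map M ?\<sigma> (z \<oplus>\<^bsub>L p\<^esub> z') = TT_map M ?\<sigma> z \<oplus>\<^bsub>L ?q\<^esub> TT_map M ?\<sigma> z'"
        by (rule straight_chart_inj[OF j T(1)[OF connection_formD(1)[OF c i z z']]
              connection_formD(1)[OF d j T(1)[OF z] T(1)[OF z']], where b = "canonical_form j ?q"])
          (simp only: T(2)[OF connection_formD(1)[OF c i z z']] connection_formD(2)[OF c i z z'] add
            connection_formD(2)[OF d j T(1)[OF z] T(1)[OF z']] T(2)[OF z] T(2)[OF z'])
    next
      fix r
      show "TT_map M ?\<sigma> (r \<odot>\<^bsub>L p\<^esub> z) = r \<odot>\<^bsub>L ?q\<^esub> TT_map M ?\<sigma> z"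
        by (rule straight_chart_inj[OF j T(1)[OF connection_formD(3)[OF c i z]]
              connection_formD(3)[OF d j T(1)[OF z]], where b = "canonical_form j ?q"])
          (simp only: T(2)[OF connection_formD(3)[OF c i z]] connection_formD(4)[OF c i z] scale
            connection_formD(4)[OF d j T(1)[OF z]] T(2)[OF z])
    }
  qed
qed

lemma canonical_forms_unique:
  assumes L: "has_canonical_forms L" and L': "has_canonical_forms L'"
  shows "same_connection M L L'"
  unfolding same_connection_def
proof (intro ballI conjI allI)
  fix p z assume p: "p \<in> points M" and z: "z \<in> TT_fiber M p"
  obtain i where "i \<in> index M" "p \<in> cdom M i" using chart_exists[OF p] .
  then have i: "i \<in> charts_at M p" by simp
  note c = has_canonical_formsD[OF L i] and d = has_canonical_formsD[OF L' i]
  show "z \<oplus>\<^bsub>L p\<^esub> z' = z \<oplus>\<^bsub>L' p\<^esub> z'" if "z' \<in> TT_fiber M p" for z'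
    by (rule straight_chart_inj[OF i connection_formD(1)[OF c i z that] connection_formD(1)[OF d i z that],
        where b = "canonical_form i p"])
      (simp only: connection_formD(2)[OF c i z that] connection_formD(2)[OF d i z that])
  show "r \<odot>\<^bsub>L p\<^esub> z = r \<odot>\<^bsub>L' p\<^esub> z" for r
    by (rule straight_chart_inj[OF i connection_formD(3)[OF c i z] connection_formD(3)[OF d i z],
        where b = "canonical_form i p"])
      (simp only: connection_formD(4)[OF c i z] connection_formD(4)[OF d i z])
qed

lemma canonical_torsion:
  assumes L: "has_canonical_forms L" and i: "i \<in> charts_at M p"
  shows "torsion M L i p u v = 0"
proof -
  have "(THE b. connection_form M L i p b) = canonical_form i p"
    using has_canonical_formsD[OF L i] connection_form_unique[OF _ _ i] by (intro the_equality) auto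
  then show ?thesis using canonical_form_symmetric[OF i, of u v] by (simp add: torsion_def)
qed

end


section \<open>Criteria for smoothness\<close>

lemma tangent_bundle_topology:
  "mtop (tangent_bundle N)
    = topology_generated_by {tangent_cdom N i \<inter> tangent_chart N i -` W | i W. i \<in> index N \<and> open W}"
  by (simp add: tangent_bundle_def)

text \<open>
  The topology of a tangent bundle is generated by preimages of open sets under charts, and smooth
  representatives have open domains. So for maps into a tangent bundle continuity follows from
  smoothness of the representatives.
\<close>

lemma continuous_map_into_tangent_bundle:
  assumes points: "points X = (\<Union>c\<in>index X. cdom X c)"
    and inj: "\<And>c. c \<in> index X \<Longrightarrow> inj_on (chart X c) (cdom X c)"
    and dom: "\<And>c. c \<in> index X \<Longrightarrow> openin (mtop X) (cdom X c)"
    and cont: "\<And>c. c \<in> index X \<Longrightarrow> continuous_map (subtopology (mtop X) (cdom X c)) euclidean (chart X c)"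
    and N: "smooth_atlas N" and F: "smooth_reps X (tangent_bundle N) F"
  shows "continuous_map (mtop X) (mtop (tangent_bundle N)) F"
  unfolding tangent_bundle_topology
proof (rule continuous_on_generated_topo)
  interpret N: smooth_atlas N by fact
  show "F ` points X \<subseteq> \<Union>{tangent_cdom N i \<inter> tangent_chart N i -` W | i W. i \<in> index N \<and> open W}"
    using smooth_reps_points[OF F] unfolding tangent_bundle_topology by auto
  fix B assume "B \<in> {tangent_cdom N i \<inter> tangent_chart N i -` W | i W. i \<in> index N \<and> open W}"
  then obtain j W where B: "B = tangent_cdom N j \<inter> tangent_chart N j -` W" "j \<in> index N" "open W" by auto
  let ?V = "\<lambda>c. local_dom X (tangent_bundle N) F c j \<inter> local_rep X (tangent_bundle N) F c j -` W"
  have "F -` B \<inter> points X = (\<Union>c\<in>index X. {q \<in> cdom X c. chart X c q \<in> ?V c})"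
  proof -
    have "F q \<in> B \<longleftrightarrow> chart X c q \<in> ?V c" if "c \<in> index X" "q \<in> cdom X c" for c q
    proof -
      have "chart X c q \<in> local_dom X (tangent_bundle N) F c j \<longleftrightarrow> F q \<in> tangent_cdom N j"
        using inj[OF that(1)] that(2) by (auto simp: local_dom_def inj_on_def simp del: tangent_cdom_iff)
      moreover have "local_rep X (tangent_bundle N) F c j (chart X c q) = tangent_chart N j (F q)"
        using inv_into_f_f[OF inj[OF that(1)] that(2)] by (simp add: local_rep_def)
      ultimately show ?thesis by (simp add: B(1) del: tangent_cdom_iff tangent_chart_apply)
    qed
    then show ?thesis unfolding points by blast
  qed
  moreover have "openin (mtop X) {q \<in> cdom X c. chart X c q \<in> ?V c}" if c: "c \<in> index X" for c
  proof -
    have sm: "smooth_on (smul X) (smul (tangent_bundle N)) (local_dom X (tangent_bundle N) F c j) (local_rep X (tangent_bundle N) F c j)"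
      using smooth_reps_smooth_on[OF F c, of j] B(2) by simp
    have "open (?V c)"
      by (rule continuous_open_preimage[OF smooth_on_continuous[OF sm] smooth_on_open[OF sm] B(3)])
    then have "openin (subtopology (mtop X) (cdom X c)) {q \<in> topspace (subtopology (mtop X) (cdom X c)). chart X c q \<in> ?V c}"
      by (intro openin_continuous_map_preimage[OF cont[OF c]]) simp
    moreover have "topspace (subtopology (mtop X) (cdom X c)) = cdom X c"
      using openin_subset[OF dom[OF c]] by auto
    ultimately have "openin (subtopology (mtop X) (cdom X c)) {q \<in> cdom X c. chart X c q \<in> ?V c}"
      by (simp only:)
    then show ?thesis using openin_open_subtopology[OF dom[OF c]] by blast
  qed
  ultimately show "openin (mtop X) (F -` B \<inter> points X)" by auto
qed

text \<open>
  A map that sends a whole chart domain into a single chart domain of the target only has to be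
  examined in this pair of charts.
\<close>

lemma smooth_on_change_target:
  assumes X: "topological_module (smul X)" and N: "smooth_atlas N" and i: "i \<in> index N" and j: "j \<in> index N"
    and G: "smooth_on (smul X) (smul N) (chart X c ` cdom X c) G" and inj: "inj_on (chart X c) (cdom X c)"
    and F: "\<And>q. q \<in> cdom X c \<Longrightarrow> F q \<in> cdom N i" "\<And>q. q \<in> cdom X c \<Longrightarrow> G (chart X c q) = chart N i (F q)"
  shows "smooth_on (smul X) (smul N) (local_dom X N F c j) (local_rep X N F c j)"
proof -
  interpret N: smooth_atlas N by fact
  let ?\<phi> = "local_rep N N id i j" and ?U = "local_dom N N id i j"
  let ?W = "chart X c ` cdom X c \<inter> G -` ?U"
  have \<phi>: "smooth_on (smul N) (smul N) ?U ?\<phi>" by (rule N.transition_smooth[OF i j])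
  have dom: "local_dom X N F c j = ?W"
    using F N.chart_in_local_dom[OF i, of _ N id j] by (auto simp: local_dom_def[of X])
  have W: "open ?W"
    by (rule continuous_open_preimage[OF smooth_on_continuous[OF G] smooth_on_open[OF G] smooth_on_open[OF \<phi>]])
  have "smooth_on (smul X) (smul N) ?W (\<lambda>y. ?\<phi> (G y))"
    by (rule smooth_on_compose[OF X N.tm N.tm smooth_on_subset[OF G W] \<phi>]) auto
  then show ?thesis unfolding dom
  proof (rule smooth_on_cong)
    fix y assume "y \<in> ?W"
    then obtain q where q: "q \<in> cdom X c" "y = chart X c q" by auto
    then show "?\<phi> (G y) = local_rep X N F c j y"
      using F[OF q(1)] N.local_rep_chart[OF i, of "F q" N id j] inv_into_f_f[OF inj q(1)] by (simp add: local_rep_def[of X])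
  qed
qed

lemma rep_differential_smooth:
  assumes "smooth_atlas M" "smooth_atlas N" "smooth_reps M N f"
    "i \<in> index M" "p \<in> cdom M i" "j \<in> index N" "f p \<in> cdom N j"
  shows "smooth_on (smul M) (smul N) UNIV (rep_differential M N f i j p)"
    and "smooth_on (prod_scale (smul M) (smul M)) (smul N) UNIV (\<lambda>(u, v). rep_second_differential M N f i j p u v)"
proof -
  interpret M: smooth_atlas M by fact
  interpret N: smooth_atlas N by fact
  let ?U = "local_dom M N f i j" and ?s = "smul M"
  have x: "chart M i p \<in> ?U" using assms by (simp add: M.chart_in_local_dom)
  note tms = M.tm topological_module_prod[OF M.tm M.tm]
  note sm = smooth_reps_smooth_on[OF assms(3,4,6)]
  have 1: "smooth_on ?s (prod_scale ?s ?s) UNIV (\<lambda>u. (chart M i p, u))"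
    by (intro smooth_on_Pair smooth_on_const smooth_on_id M.tm open_UNIV)
  show "smooth_on ?s (smul N) UNIV (rep_differential M N f i j p)"
    using smooth_on_compose[OF M.tm tms(2) N.tm 1 smooth_on_differential[OF M.tm N.tm sm]] x
    by (auto simp: rep_differential_def)
  have 2: "smooth_on (prod_scale ?s ?s) (prod_scale ?s (prod_scale ?s ?s)) UNIV (\<lambda>t. (chart M i p, t))"
    by (intro smooth_on_Pair smooth_on_const smooth_on_id tms open_UNIV)
  show "smooth_on (prod_scale ?s ?s) (smul N) UNIV (\<lambda>(u, v). rep_second_differential M N f i j p u v)"
    using smooth_on_compose[OF tms(2) topological_module_prod[OF tms] N.tm 2 smooth_on_second_differential[OF M.tm N.tm sm]] x
    by (auto simp: rep_second_differential_def case_prod_unfold)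
qed


section \<open>Charts of the second tangent bundle\<close>

lemma TT_simps [simp]:
  "smul (TT M) = prod_scale (prod_scale (smul M) (smul M)) (prod_scale (smul M) (smul M))"
  "index (TT M) = index M"
  by (simp_all add: TT_def)

context smooth_atlas
begin

lemma smooth_atlas_TT: "smooth_atlas (TT M)"
  unfolding TT_def by (intro smooth_atlas_tangent_bundle smooth_atlas_axioms)

lemma points_TT: "z \<in> points (TT M) \<longleftrightarrow> z \<in> TT_fiber M (foot z)"
  by (simp add: TT_fiber_def)

lemma cdom_TT: "z \<in> cdom (TT M) i \<longleftrightarrow> z \<in> TT_fiber M (foot z) \<and> foot z \<in> cdom M i"
  by (auto simp: TT_def TT_fiber_iff foot_def)

lemma chart_TT: "chart (TT M) i z = ((chart M i (foot z), fst (fiber_chart i z)), snd (fiber_chart i z))"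
  by (simp add: TT_def fiber_chart_eq foot_def)

lemma foot_in_points: "z \<in> TT_fiber M p \<Longrightarrow> p \<in> points M"
  using tangent_vectors_point[of "fst z" M] by (auto simp: TT_fiber_iff)

lemma foot_TT_fiber: "z \<in> TT_fiber M p \<Longrightarrow> foot z = p"
  by (simp add: TT_fiber_def)

lemma tm_fiber: "topological_module (fiber_scale M)"
  unfolding fiber_scale_def by (intro topological_module_prod tm)

lemma continuous_map_into_TT:
  assumes "points X = (\<Union>c\<in>index X. cdom X c)"
    and "\<And>c. c \<in> index X \<Longrightarrow> inj_on (chart X c) (cdom X c)"
    and "\<And>c. c \<in> index X \<Longrightarrow> openin (mtop X) (cdom X c)"
    and "\<And>c. c \<in> index X \<Longrightarrow> continuous_map (subtopology (mtop X) (cdom X c)) euclidean (chart X c)"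
    and "smooth_reps X (TT M) F"
  shows "continuous_map (mtop X) (mtop (TT M)) F"
  using assms unfolding TT_def by (intro continuous_map_into_tangent_bundle smooth_atlas_TM)

lemma chart_image_TT:
  assumes "i \<in> index M"
  shows "chart (TT M) i ` cdom (TT M) i = (chart M i ` cdom M i \<times> UNIV) \<times> UNIV"
proof (intro equalityI subsetI)
  fix y assume "y \<in> (chart M i ` cdom M i \<times> (UNIV :: 'v set)) \<times> (UNIV :: ('v \<times> 'v) set)"
  then obtain p and u :: 'v and t where y: "p \<in> cdom M i" "y = ((chart M i p, u), t)" by auto
  then have "i \<in> charts_at M p" using assms by simp
  note fp = fiber_point[OF this, of "(u, t)"]
  then show "y \<in> chart (TT M) i ` cdom (TT M) i"
    using y by (intro image_eqI[of _ _ "fiber_point M i p (u, t)"]) (auto simp: cdom_TT chart_TT foot_TT_fiber[OF fp(1)])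
qed (auto simp: cdom_TT chart_TT)

end


section \<open>Existence of the canonical connection\<close>

lemma cring_scalar_ring: "cring (scalar_ring :: 'k::comm_ring_1 ring)"
proof (rule cringI)
  show "abelian_group (scalar_ring :: 'k ring)"
    by (rule abelian_groupI) (auto simp: scalar_ring_def algebra_simps intro: exI[of _ "- _"])
  show "comm_monoid (scalar_ring :: 'k ring)"
    by (rule comm_monoidI) (auto simp: scalar_ring_def algebra_simps)
qed (auto simp: scalar_ring_def algebra_simps)

lemma (in smooth_atlas) module_of_connection_form:
  assumes c: "connection_form M L i p b" and i: "i \<in> charts_at M p"
    and carrier: "carrier (L p) = TT_fiber M p" and zero: "\<zero>\<^bsub>L p\<^esub> \<in> TT_fiber M p" "straight_chart b i \<zero>\<^bsub>L p\<^esub> = 0"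
  shows "Module.module scalar_ring (L p)"
proof -
  interpret F: topological_module "fiber_scale M" by (rule tm_fiber)
  note D = connection_formD[OF c i]
  note eq = straight_chart_inj[OF i, where b = b]
  show ?thesis
  proof (rule Module.moduleI)
    show "cring scalar_ring" by (rule cring_scalar_ring)
    show "abelian_group (L p)"
    proof (rule abelian_groupI; unfold carrier)
      fix x assume x: "x \<in> TT_fiber M p"
      have y: "(- 1) \<odot>\<^bsub>L p\<^esub> x \<in> TT_fiber M p" by (rule D(3)[OF x])
      have "(- 1) \<odot>\<^bsub>L p\<^esub> x \<oplus>\<^bsub>L p\<^esub> x = \<zero>\<^bsub>L p\<^esub>"
        by (rule eq) (simp_all add: D x y zero)
      then show "\<exists>y\<in>TT_fiber M p. y \<oplus>\<^bsub>L p\<^esub> x = \<zero>\<^bsub>L p\<^esub>" using y by auto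
    qed (auto intro!: eq simp: D zero add.assoc add.commute)
  qed (auto intro!: eq simp: D carrier scalar_ring_def F.scale_left_distrib F.scale_right_distrib)
qed

context symmetric
begin

text \<open>
  On each fiber, the linear structure of the straightened coordinates is transported by one selected
  chart. The multiplicative fields of the record carry arbitrary values.
\<close>

definition canonical_connection :: "'m \<Rightarrow> ('k, ('m, 'i, 'v) second_tangent) module" where
  "canonical_connection p = (let i = (SOME i. i \<in> charts_at M p);
      \<kappa> = straight_chart (canonical_form i p) i;
      \<psi> = (\<lambda>t. fiber_point M i p (bend (canonical_form i p) t))
    in \<lparr>carrier = TT_fiber M p, monoid.mult = (\<lambda>_ _. undefined), one = undefined, zero = \<psi> 0,
        add = (\<lambda>z z'. \<psi> (\<kappa> z + \<kappa> z')), smult = (\<lambda>r z. \<psi> (fiber_scale M r (\<kappa> z)))\<rparr>)"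

lemma straight_transition:
  assumes i: "i \<in> charts_at M p" and j: "j \<in> charts_at M p" and z: "z \<in> TT_fiber M p"
  defines "S \<equiv> rep_differential M M id i j p"
  shows "straight_chart (canonical_form j p) j z = map_prod S (map_prod S S) (straight_chart (canonical_form i p) i z)"
  using straight_homomorphism[OF smooth_reps_id i, of j "fiber_chart i z"] fiber_chart_transition[OF i j z] j
  by (simp add: straight_chart_def S_def)

text \<open>
  A change of charts is linear in the straightened coordinates, because the identity is a
  homomorphism of \<open>\<mu>\<close>. Thus the structure defined by the selected chart is linear in every chart.
\<close>

lemma canonical_connection_forms: "has_canonical_forms canonical_connection"
  unfolding has_canonical_forms_def
proof (intro allI ballI)
  fix p j assume j: "j \<in> charts_at M p"
  define i where "i = (SOME i. i \<in> charts_at M p)"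
  have i: "i \<in> charts_at M p" unfolding i_def using j by (rule someI)
  let ?\<kappa> = "straight_chart (canonical_form i p) i" and ?\<kappa>' = "straight_chart (canonical_form j p) j"
  let ?S = "rep_differential M M id i j p"
  note S = straight_chart_bij[OF i, where b = "canonical_form i p"]
  have ij: "i \<in> index M" "p \<in> cdom M i" "j \<in> index M" "id p \<in> cdom M j" using i j by auto
  note lin = rep_differential_linear[OF smooth_atlas_axioms smooth_atlas_axioms smooth_reps_id ij]
  have add: "z \<oplus>\<^bsub>canonical_connection p\<^esub> z' = fiber_point M i p (bend (canonical_form i p) (?\<kappa> z + ?\<kappa> z'))"
    and smult: "r \<odot>\<^bsub>canonical_connection p\<^esub> z = fiber_point M i p (bend (canonical_form i p) (fiber_scale M r (?\<kappa> z)))" for z z' r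
    by (simp_all add: canonical_connection_def Let_def i_def)
  note S3 = map_prod_fiber_linear[of ?S M, OF lin(1,2)]
  show "connection_form M canonical_connection j p (canonical_form j p)"
    unfolding connection_form_iff[OF j] add smult
    by (intro conjI ballI allI canonical_form_bilinear[OF j] S(2)) (simp_all only: straight_transition[OF i j] S(2,3) S3)
qed

lemma canonical_connection_module:
  assumes p: "p \<in> points M"
  shows "carrier (canonical_connection p) = TT_fiber M p" and "Module.module scalar_ring (canonical_connection p)"
proof -
  show carrier: "carrier (canonical_connection p) = TT_fiber M p"
    by (simp add: canonical_connection_def Let_def)
  obtain j where "j \<in> index M" "p \<in> cdom M j" using chart_exists[OF p] .
  then have j: "j \<in> charts_at M p" by simp
  define i where "i = (SOME i. i \<in> charts_at M p)"
  have i: "i \<in> charts_at M p" unfolding i_def using j by (rule someI)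
  have zero: "\<zero>\<^bsub>canonical_connection p\<^esub> = fiber_point M i p (bend (canonical_form i p) 0)"
    by (simp add: canonical_connection_def Let_def i_def)
  show "Module.module scalar_ring (canonical_connection p)"
    by (rule module_of_connection_form[where b = "canonical_form i p", OF has_canonical_formsD[OF canonical_connection_forms i] i carrier])
      (simp_all only: zero straight_chart_bij(2,3)[OF i])
qed

lemma canonical_form_smooth:
  assumes i: "i \<in> index M" and s: "topological_module s"
    and a: "smooth_on s (smul M) W a" "\<And>q. q \<in> W \<Longrightarrow> a q \<in> chart M i ` cdom M i"
    and u: "smooth_on s (smul M) W u" and v: "smooth_on s (smul M) W v"
  shows "smooth_on s (smul M) W (\<lambda>q. canonical_form i (inv_into (cdom M i) (chart M i) (a q)) (u q) (v q))"
proof -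
  let ?D = "\<lambda>(x, u, v). sym_form i (inv_into (cdom M i) (chart M i) x) u v"
  have "smooth_on s (smul M) W (\<lambda>q. ?D (a q, u q, v q))"
    by (rule smooth_on_compose[OF s _ tm smooth_on_Pair[OF a(1) smooth_on_Pair[OF u v]] sym_form_smooth[OF i]])
      (use a(2) in \<open>auto intro!: topological_module_prod tm\<close>)
  then show ?thesis
    unfolding canonical_form_def using smooth_on_scale_const[OF s tm] by simp
qed

lemma canonical_add_chart:
  assumes i: "i \<in> charts_at M p" and z: "z \<in> TT_fiber M p" "z' \<in> TT_fiber M p"
    and c: "fiber_chart i z = (u, v, w)" "fiber_chart i z' = (u', v', w')"
  shows "fiber_chart i (z \<oplus>\<^bsub>canonical_connection p\<^esub> z')
    = (u + u', v + v', w + w' + (canonical_form i p u v' + canonical_form i p u' v))"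
proof -
  note cf = has_canonical_formsD[OF canonical_connection_forms i]
  note B = bilinear_mapD[OF canonical_form_bilinear[OF i]]
  have "fiber_chart i (z \<oplus>\<^bsub>canonical_connection p\<^esub> z')
      = bend (canonical_form i p) (unbend (canonical_form i p) (u, v, w) + unbend (canonical_form i p) (u', v', w'))"
    using connection_formD(2)[OF cf i z] unfolding straight_chart_def c by (metis bend_unbend(1))
  then show ?thesis by (simp add: bend_def unbend_def B(1,2))
qed

lemma canonical_smult_chart:
  assumes i: "i \<in> charts_at M p" and z: "z \<in> TT_fiber M p" and c: "fiber_chart i z = (u, v, w)"
  shows "fiber_chart i (r \<odot>\<^bsub>canonical_connection p\<^esub> z)
    = (smul M r u, smul M r v, smul M r (w - canonical_form i p u v) + canonical_form i p (smul M r u) (smul M r v))"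
proof -
  note cf = has_canonical_formsD[OF canonical_connection_forms i]
  have "fiber_chart i (r \<odot>\<^bsub>canonical_connection p\<^esub> z)
      = bend (canonical_form i p) (fiber_scale M r (unbend (canonical_form i p) (u, v, w)))"
    using connection_formD(4)[OF cf i z] unfolding straight_chart_def c by (metis bend_unbend(1))
  then show ?thesis by (simp add: bend_def unbend_def)
qed

lemma fiber_product_simps [simp]:
  "smul (fiber_product M) = prod_scale (smul M) (prod_scale (fiber_scale M) (fiber_scale M))"
  "index (fiber_product M) = index M"
  "cdom (fiber_product M) i = {(z, z'). z \<in> cdom (TT M) i \<and> z' \<in> cdom (TT M) i \<and> foot z = foot z'}"
  "chart (fiber_product M) i = (\<lambda>(z, z'). (chart M i (foot z), fiber_chart i z, fiber_chart i z'))"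
  "mtop (fiber_product M) = subtopology (prod_topology (mtop (TT M)) (mtop (TT M))) {(z, z'). foot z = foot z'}"
  by (simp_all add: fiber_product_def)

text \<open>
  The fibered product lies in \<open>TTM \<times> TTM\<close>, and its chart is obtained from the product chart by omitting
  the second copy of the base point.
\<close>

lemma fiber_product_atlas:
  assumes i: "i \<in> index M"
  shows "inj_on (chart (fiber_product M) i) (cdom (fiber_product M) i)"
    and "openin (mtop (fiber_product M)) (cdom (fiber_product M) i)"
    and "continuous_map (subtopology (mtop (fiber_product M)) (cdom (fiber_product M) i)) euclidean (chart (fiber_product M) i)"
    and "chart (fiber_product M) i ` cdom (fiber_product M) i = chart M i ` cdom M i \<times> UNIV"
proof -
  interpret T: smooth_atlas "TT M" by (rule smooth_atlas_TT)
  have iT: "i \<in> index (TT M)" using i by simp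
  show "inj_on (chart (fiber_product M) i) (cdom (fiber_product M) i)"
  proof (rule inj_onI)
    fix q q' assume q: "q \<in> cdom (fiber_product M) i" "q' \<in> cdom (fiber_product M) i"
      "chart (fiber_product M) i q = chart (fiber_product M) i q'"
    then have e: "chart (TT M) i (fst q) = chart (TT M) i (fst q')" "chart (TT M) i (snd q) = chart (TT M) i (snd q')"
      by (auto simp: chart_TT case_prod_beta)
    have "fst q \<in> cdom (TT M) i" "snd q \<in> cdom (TT M) i" "fst q' \<in> cdom (TT M) i" "snd q' \<in> cdom (TT M) i"
      using q(1,2) by auto
    then show "q = q'"
      using inj_onD[OF T.chart_inj[OF iT] e(1)] inj_onD[OF T.chart_inj[OF iT] e(2)] by (simp add: prod_eq_iff)
  qed
  have dom: "cdom (fiber_product M) i = (cdom (TT M) i \<times> cdom (TT M) i) \<inter> {(z, z'). foot z = foot z'}" by auto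
  show "openin (mtop (fiber_product M)) (cdom (fiber_product M) i)"
    unfolding dom fiber_product_simps openin_subtopology
    using T.cdom_open[OF iT] by (intro exI[of _ "cdom (TT M) i \<times> cdom (TT M) i"]) (auto simp: openin_prod_Times_iff)
  let ?P = "prod_topology (subtopology (mtop (TT M)) (cdom (TT M) i)) (subtopology (mtop (TT M)) (cdom (TT M) i))"
  let ?g = "\<lambda>p :: (('v \<times> 'v) \<times> ('v \<times> 'v)) \<times> (('v \<times> 'v) \<times> ('v \<times> 'v)).
    (fst (fst (fst p)), (snd (fst (fst p)), snd (fst p)), (snd (fst (snd p)), snd (snd p)))"
  have "continuous_map ?P (prod_topology euclidean euclidean) (\<lambda>q. (chart (TT M) i (fst q), chart (TT M) i (snd q)))"
    by (intro continuous_map_pairedI continuous_map_compose[OF continuous_map_fst, unfolded comp_def]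
      continuous_map_compose[OF continuous_map_snd, unfolded comp_def] T.chart_continuous iT)
  moreover have "continuous_map euclidean euclidean ?g"
    by (simp add: continuous_intros)
  ultimately have "continuous_map ?P euclidean (?g \<circ> (\<lambda>q. (chart (TT M) i (fst q), chart (TT M) i (snd q))))"
    by (intro continuous_map_compose) auto
  then have "continuous_map (subtopology (prod_topology (mtop (TT M)) (mtop (TT M))) (cdom (TT M) i \<times> cdom (TT M) i))
      euclidean (?g \<circ> (\<lambda>q. (chart (TT M) i (fst q), chart (TT M) i (snd q))))"
    by (simp add: subtopology_Times)
  then have "continuous_map (subtopology (subtopology (prod_topology (mtop (TT M)) (mtop (TT M))) (cdom (TT M) i \<times> cdom (TT M) i)) {(z, z'). foot z = foot z'})
      euclidean (?g \<circ> (\<lambda>q. (chart (TT M) i (fst q), chart (TT M) i (snd q))))"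
    by (rule continuous_map_from_subtopology)
  moreover have "subtopology (subtopology (prod_topology (mtop (TT M)) (mtop (TT M))) (cdom (TT M) i \<times> cdom (TT M) i)) {(z, z'). foot z = foot z'}
      = subtopology (mtop (fiber_product M)) (cdom (fiber_product M) i)"
    unfolding fiber_product_simps(3,5) subtopology_subtopology by (rule arg_cong[where f = "subtopology _"]) auto
  moreover have "?g \<circ> (\<lambda>q. (chart (TT M) i (fst q), chart (TT M) i (snd q))) = chart (fiber_product M) i"
    by (auto simp: chart_TT fun_eq_iff)
  ultimately show "continuous_map (subtopology (mtop (fiber_product M)) (cdom (fiber_product M) i)) euclidean (chart (fiber_product M) i)"
    by simp
  show "chart (fiber_product M) i ` cdom (fiber_product M) i = chart M i ` cdom M i \<times> UNIV"
  proof (intro equalityI subsetI)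
    fix y assume "y \<in> chart M i ` cdom M i \<times> (UNIV :: (('v \<times> 'v \<times> 'v) \<times> ('v \<times> 'v \<times> 'v)) set)"
    then obtain p t t' where y: "p \<in> cdom M i" "y = (chart M i p, t, t')" by auto
    then have ci: "i \<in> charts_at M p" using i by simp
    have f: "foot (fiber_point M i p t) = p" for t by (rule foot_TT_fiber[OF fiber_point(1)[OF ci]])
    show "y \<in> chart (fiber_product M) i ` cdom (fiber_product M) i"
      using y fiber_point[OF ci]
      by (intro image_eqI[of _ _ "(fiber_point M i p t, fiber_point M i p t')"]) (simp_all add: cdom_TT f)
  qed (auto simp: cdom_TT)
qed

text \<open>
  In the chart \<open>i\<close> the last coordinate of a sum is \<open>w + w' + b(u, v') + b(u', v)\<close>, where \<open>b\<close> depends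
  smoothly on the base point. A different chart at the target is reached by a transition map.
\<close>

lemma canonical_add_smooth: "smooth_map (fiber_product M) (TT M) (\<lambda>(z, z'). z \<oplus>\<^bsub>canonical_connection (foot z)\<^esub> z')"
proof -
  let ?F = "\<lambda>(z, z'). z \<oplus>\<^bsub>canonical_connection (foot z)\<^esub> z'" and ?s = "smul M"
  let ?S = "prod_scale ?s (prod_scale (fiber_scale M) (fiber_scale M))"
  have S: "topological_module ?S" by (intro topological_module_prod tm tm_fiber)
  have points: "points (fiber_product M) = (\<Union>c\<in>index (fiber_product M). cdom (fiber_product M) c)"
  proof (intro equalityI subsetI)
    fix q assume "q \<in> points (fiber_product M)"
    then obtain z z' where q: "q = (z, z')" "z \<in> TT_fiber M (foot z)" "z' \<in> TT_fiber M (foot z')" "foot z = foot z'"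
      by (auto simp: points_TT)
    obtain i where "i \<in> index M" "foot z \<in> cdom M i" using chart_exists[OF foot_in_points[OF q(2)]] .
    then show "q \<in> (\<Union>c\<in>index (fiber_product M). cdom (fiber_product M) c)"
      using q by (auto simp: cdom_TT)
  qed (auto simp: points_TT cdom_TT)
  have closed: "?F (z, z') \<in> TT_fiber M p" if z: "z \<in> TT_fiber M p" "z' \<in> TT_fiber M p" for z z' p
  proof -
    obtain i where "i \<in> index M" "p \<in> cdom M i" using chart_exists[OF foot_in_points[OF z(1)]] .
    then have i: "i \<in> charts_at M p" by simp
    show ?thesis
      using connection_formD(1)[OF has_canonical_formsD[OF canonical_connection_forms i] i z] foot_TT_fiber[OF z(1)] by simp
  qed
  have "smooth_on ?S (smul (TT M)) (local_dom (fiber_product M) (TT M) ?F i j) (local_rep (fiber_product M) (TT M) ?F i j)"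
    if i: "i \<in> index M" and j: "j \<in> index M" for i j
  proof -
    let ?W = "chart M i ` cdom M i \<times> (UNIV :: (('v \<times> 'v \<times> 'v) \<times> ('v \<times> 'v \<times> 'v)) set)"
    have W: "open ?W" using open_chart_image[OF i] by (intro open_Times) auto
    have lin: "smooth_on ?S ?s ?W l" if "continuous_linear ?S ?s l" for l
      by (rule smooth_on_linear[OF S tm that W])
    have pr: "continuous_linear ?S ?s (\<lambda>q. fst q)"
      "continuous_linear ?S ?s (\<lambda>q. fst (fst (snd q)))" "continuous_linear ?S ?s (\<lambda>q. fst (snd (fst (snd q))))"
      "continuous_linear ?S ?s (\<lambda>q. snd (snd (fst (snd q))))" "continuous_linear ?S ?s (\<lambda>q. fst (snd (snd q)))"
      "continuous_linear ?S ?s (\<lambda>q. fst (snd (snd (snd q))))" "continuous_linear ?S ?s (\<lambda>q. snd (snd (snd (snd q))))"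
      by (auto simp: continuous_linear_def prod_scale_def fiber_scale_def intro!: continuous_intros)
    note sm = pr[THEN lin]
    let ?b = "\<lambda>q. canonical_form i (inv_into (cdom M i) (chart M i) (fst q))"
    let ?G = "\<lambda>q. ((fst q, fst (fst (snd q)) + fst (snd (snd q))),
      (fst (snd (fst (snd q))) + fst (snd (snd (snd q))),
       (snd (snd (fst (snd q))) + snd (snd (snd (snd q)))) +
        (?b q (fst (fst (snd q))) (fst (snd (snd (snd q)))) + ?b q (fst (snd (snd q))) (fst (snd (fst (snd q)))))))"
    have G: "smooth_on ?S (smul (TT M)) ?W ?G"
      unfolding TT_simps
      by (intro smooth_on_Pair smooth_on_add[OF tm] canonical_form_smooth[OF i S] sm) auto
    show ?thesis
    proof (rule smooth_on_change_target[where i = i and c = i and X = "fiber_product M" and G = ?G, unfolded fiber_product_simps(1,2)])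
      show "topological_module ?S" by (rule S)
      show "smooth_atlas (TT M)" by (rule smooth_atlas_TT)
      show "i \<in> index (TT M)" "j \<in> index (TT M)" using i j by auto
      show "smooth_on ?S (smul (TT M)) (chart (fiber_product M) i ` cdom (fiber_product M) i) ?G"
        unfolding fiber_product_atlas(4)[OF i] by (rule G)
      show "inj_on (chart (fiber_product M) i) (cdom (fiber_product M) i)" by (rule fiber_product_atlas(1)[OF i])
      fix q assume "q \<in> cdom (fiber_product M) i"
      then obtain z z' p where q: "q = (z, z')" "z \<in> TT_fiber M p" "z' \<in> TT_fiber M p" "p \<in> cdom M i"
        "foot z = p" "foot z' = p" by (auto simp: cdom_TT)
      then have ci: "i \<in> charts_at M p" using i by simp
      obtain u v w u' v' w' where c: "fiber_chart i z = (u, v, w)" "fiber_chart i z' = (u', v', w')" by (metis prod_cases3)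
      note add = canonical_add_chart[OF ci q(2,3) c] and foot = foot_TT_fiber[OF closed[OF q(2,3)]]
      show "?F q \<in> cdom (TT M) i" using closed[OF q(2,3)] foot q(1,4) by (simp add: cdom_TT)
      show "?G (chart (fiber_product M) i q) = chart (TT M) i (?F q)"
        using add foot q i c by (simp add: chart_TT)
    qed
  qed
  moreover have "?F q \<in> points (TT M)" if q: "q \<in> points (fiber_product M)" for q
  proof -
    obtain z z' where z: "q = (z, z')" "z \<in> TT_fiber M (foot z)" "z' \<in> TT_fiber M (foot z)"
      using q by (auto simp: points_TT)
    have "?F q \<in> TT_fiber M (foot z)" unfolding z(1) by (rule closed[OF z(2,3)])
    then show ?thesis by (simp add: TT_fiber_def)
  qed
  ultimately have reps: "smooth_reps (fiber_product M) (TT M) ?F" by (simp add: smooth_reps_def)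
  have "continuous_map (mtop (fiber_product M)) (mtop (TT M)) ?F"
    by (rule continuous_map_into_TT[OF points fiber_product_atlas(1,2,3) reps]) simp_all
  then show ?thesis using reps by (simp add: smooth_map_def smooth_reps_def)
qed

lemma ring_manifold_simps [simp]:
  "smul ring_manifold = (*)" "index ring_manifold = UNIV" "cdom ring_manifold c = UNIV" "chart ring_manifold c = id"
  "mtop ring_manifold = euclidean"
  by (simp_all add: ring_manifold_def)

lemma smooth_atlas_ring: "smooth_atlas (ring_manifold :: ('k, 'k, unit, 'k) manifold)"
proof (rule smooth_atlas.intro)
  show "smooth_on (smul (ring_manifold :: ('k, 'k, unit, 'k) manifold)) (smul (ring_manifold :: ('k, 'k, unit, 'k) manifold))
      (local_dom (ring_manifold :: ('k, 'k, unit, 'k) manifold) (ring_manifold :: ('k, 'k, unit, 'k) manifold) id i j)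
      (local_rep (ring_manifold :: ('k, 'k, unit, 'k) manifold) (ring_manifold :: ('k, 'k, unit, 'k) manifold) id i j)" for i j
    using smooth_on_id[OF topological_module_ring open_UNIV] by (simp add: local_dom_def local_rep_def inv_id id_def comp_def)
qed (auto simp: topological_module_ring)

text \<open>
  In the chart \<open>i\<close> the last coordinate of a scalar multiple is \<open>r (w - b(u, v)) + b(r u, r v)\<close>.
\<close>

lemma canonical_smult_smooth:
  "smooth_map (prod_manifold ring_manifold (TT M)) (TT M) (\<lambda>(r, z). r \<odot>\<^bsub>canonical_connection (foot z)\<^esub> z)"
proof -
  let ?X = "prod_manifold (ring_manifold :: ('k, 'k, unit, 'k) manifold) (TT M)"
  let ?F = "\<lambda>(r, z). r \<odot>\<^bsub>canonical_connection (foot z)\<^esub> z" and ?s = "smul M"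
  interpret X: smooth_atlas ?X by (intro smooth_atlas_prod smooth_atlas_ring smooth_atlas_TT)
  let ?S = "prod_scale (*) (prod_scale (prod_scale ?s ?s) (prod_scale ?s ?s))"
  have S: "topological_module ?S" by (intro topological_module_prod topological_module_ring tm)
  have closed: "?F (r, z) \<in> TT_fiber M p" if z: "z \<in> TT_fiber M p" for r z p
  proof -
    obtain i where "i \<in> index M" "p \<in> cdom M i" using chart_exists[OF foot_in_points[OF z]] .
    then have i: "i \<in> charts_at M p" by simp
    show ?thesis
      using connection_formD(3)[OF has_canonical_formsD[OF canonical_connection_forms i] i z] foot_TT_fiber[OF z] by simp
  qed
  have "smooth_on ?S (smul (TT M)) (local_dom ?X (TT M) ?F (c, i) j) (local_rep ?X (TT M) ?F (c, i) j)"
    if i: "i \<in> index M" and j: "j \<in> index M" for c i j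
  proof -
    let ?W = "(UNIV :: 'k set) \<times> ((chart M i ` cdom M i \<times> UNIV) \<times> (UNIV :: ('v \<times> 'v) set))"
    have W: "open ?W" using open_chart_image[OF i] by (intro open_Times) auto
    have pr: "continuous_linear ?S ?s (\<lambda>q. fst (fst (snd q)))" "continuous_linear ?S ?s (\<lambda>q. snd (fst (snd q)))"
      "continuous_linear ?S ?s (\<lambda>q. fst (snd (snd q)))" "continuous_linear ?S ?s (\<lambda>q. snd (snd (snd q)))"
      by (auto simp: continuous_linear_def prod_scale_def intro!: continuous_intros)
    have "smooth_on ?S ?s ?W l" if "continuous_linear ?S ?s l" for l
      by (rule smooth_on_linear[OF S tm that W])
    note sm = pr[THEN this]
    have smr: "smooth_on ?S (*) ?W fst"
      by (rule smooth_on_linear[OF S topological_module_ring continuous_linear_fst W])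
    let ?b = "\<lambda>q. canonical_form i (inv_into (cdom M i) (chart M i) (fst (fst (snd q))))"
    let ?G = "\<lambda>q. ((fst (fst (snd q)), ?s (fst q) (snd (fst (snd q)))), (?s (fst q) (fst (snd (snd q))),
      ?s (fst q) (snd (snd (snd q)) - ?b q (snd (fst (snd q))) (fst (snd (snd q))))
        + ?b q (?s (fst q) (snd (fst (snd q)))) (?s (fst q) (fst (snd (snd q))))))"
    have G: "smooth_on ?S (smul (TT M)) ?W ?G"
      unfolding TT_simps
      by (intro smooth_on_Pair smooth_on_add[OF tm] smooth_on_diff[OF S tm] smooth_on_scale[OF S tm]
        canonical_form_smooth[OF i S] sm smr) auto
    have img: "chart ?X (c, i) ` cdom ?X (c, i) = ?W"
      using chart_image_TT[OF i] by (simp add: map_prod_surj_on)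
    have "smooth_on (smul ?X) (smul (TT M)) (local_dom ?X (TT M) ?F (c, i) j) (local_rep ?X (TT M) ?F (c, i) j)"
    proof (rule smooth_on_change_target[where i = i and c = "(c, i)" and X = ?X and G = ?G])
      show "topological_module (smul ?X)" using S by simp
      show "smooth_atlas (TT M)" by (rule smooth_atlas_TT)
      show "i \<in> index (TT M)" "j \<in> index (TT M)" using i j by auto
      show "smooth_on (smul ?X) (smul (TT M)) (chart ?X (c, i) ` cdom ?X (c, i)) ?G" unfolding img using G by simp
      show "inj_on (chart ?X (c, i)) (cdom ?X (c, i))" using X.chart_inj[of "(c, i)"] i by simp
      fix q assume "q \<in> cdom ?X (c, i)"
      then obtain r z p where q: "q = (r, z)" "z \<in> TT_fiber M p" "p \<in> cdom M i" "foot z = p" by (auto simp: cdom_TT)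
      then have ci: "i \<in> charts_at M p" using i by simp
      obtain u v w where c: "fiber_chart i z = (u, v, w)" by (metis prod_cases3)
      note smult = canonical_smult_chart[OF ci q(2) c] and foot = foot_TT_fiber[OF closed[OF q(2)]]
      show "?F q \<in> cdom (TT M) i" using closed[OF q(2), of r] foot[of r] q(1,3) by (simp add: cdom_TT)
      show "?G (chart ?X (c, i) q) = chart (TT M) i (?F q)"
        using smult[of r] foot[of r] q i c by (simp add: chart_TT)
    qed
    then show ?thesis by simp
  qed
  moreover have "?F q \<in> points (TT M)" if q: "q \<in> points ?X" for q
  proof -
    obtain r z where z: "q = (r, z)" "z \<in> TT_fiber M (foot z)" using q by (auto simp: points_TT)
    have "?F q \<in> TT_fiber M (foot z)" unfolding z(1) by (rule closed[OF z(2)])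
    then show ?thesis by (simp add: TT_fiber_def)
  qed
  ultimately have reps: "smooth_reps ?X (TT M) ?F" by (auto simp: smooth_reps_def)
  have "continuous_map (mtop ?X) (mtop (TT M)) ?F"
    by (rule continuous_map_into_TT[OF X.points_eq X.chart_inj X.cdom_open X.chart_continuous reps])
  then show ?thesis using reps by (simp add: smooth_map_def smooth_reps_def)
qed

lemma canonical_connection_linear: "linear_connection M canonical_connection"
  unfolding linear_connection_def
proof (intro conjI ballI)
  fix i p assume "i \<in> index M" "p \<in> cdom M i"
  then have "i \<in> charts_at M p" by simp
  then show "\<exists>b. connection_form M canonical_connection i p b"
    using has_canonical_formsD[OF canonical_connection_forms] by blast
qed (use canonical_connection_module canonical_add_smooth canonical_smult_smooth in auto)

end


section \<open>Abelian reflection spaces\<close>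

text \<open>
  A product of two symmetries of a flat space is the translation by \<open>2 (\<kappa> x - \<kappa> y)\<close>, and translations
  commute.
\<close>

lemma abelian_reflection_spaceI:
  fixes \<kappa> :: "'a \<Rightarrow> 'b::ab_group_add"
  assumes inj: "inj_on \<kappa> X"
    and closed: "\<And>x y. x \<in> X \<Longrightarrow> y \<in> X \<Longrightarrow> \<mu> (x, y) \<in> X"
    and flat: "\<And>x y. x \<in> X \<Longrightarrow> y \<in> X \<Longrightarrow> \<kappa> (\<mu> (x, y)) = \<kappa> x + \<kappa> x - \<kappa> y"
  shows "abelian_reflection_space X \<mu>"
proof -
  let ?G = "BijGroup X"
  let ?S = "{compose X (symmetry X \<mu> x) (symmetry X \<mu> y) | x y. x \<in> X \<and> y \<in> X}"
  let ?T = "{f \<in> Bij X. \<exists>c. \<forall>y\<in>X. \<kappa> (f y) = \<kappa> y + c}"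
  interpret G: group ?G by (rule group_BijGroup)
  have involution: "\<mu> (x, \<mu> (x, y)) = y" if "x \<in> X" "y \<in> X" for x y
    using inj_onD[OF inj, of "\<mu> (x, \<mu> (x, y))" y] that by (simp add: closed flat)
  have bij: "symmetry X \<mu> x \<in> Bij X" if "x \<in> X" for x
  proof -
    have "bij_betw (symmetry X \<mu> x) X X"
      by (rule bij_betw_byWitness[where f' = "symmetry X \<mu> x"])
        (use that in \<open>auto simp: symmetry_def closed involution\<close>)
    then show ?thesis by (simp add: Bij_def symmetry_def)
  qed
  have S: "?S \<subseteq> ?T"
  proof
    fix f assume "f \<in> ?S"
    then obtain x y where f: "f = compose X (symmetry X \<mu> x) (symmetry X \<mu> y)" "x \<in> X" "y \<in> X" by blast
    have "\<kappa> (f z) = \<kappa> z + (\<kappa> x + \<kappa> x - (\<kappa> y + \<kappa> y))" if "z \<in> X" for z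
      using f that by (simp add: compose_def symmetry_def closed flat algebra_simps)
    then show "f \<in> ?T" using f compose_Bij[OF bij bij] by blast
  qed
  have H: "generate ?G ?S \<subseteq> ?T"
  proof
    fix f assume "f \<in> generate ?G ?S"
    then show "f \<in> ?T"
    proof induction
      case one
      have "\<forall>y\<in>X. \<kappa> ((\<lambda>x\<in>X. x) y) = \<kappa> y + 0" by simp
      then show ?case using id_Bij[of X] unfolding BijGroup_def monoid.simps by blast
    next
      case (incl h)
      then show ?case using S by blast
    next
      case (inv h)
      then obtain c where h: "h \<in> Bij X" "\<forall>y\<in>X. \<kappa> (h y) = \<kappa> y + c" using S by blast
      have "\<kappa> (inv_into X h y) = \<kappa> y + (- c)" if "y \<in> X" for y
      proof -
        have "inv_into X h y \<in> X" "h (inv_into X h y) = y"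
          using Bij_inv_into_mem[OF h(1) that] f_inv_into_f[of y h X] h(1) that by (auto simp: Bij_def bij_betw_def)
        then show ?thesis using h(2) by (metis add.assoc add.right_inverse add.right_neutral)
      qed
      then have "\<forall>y\<in>X. \<kappa> ((\<lambda>x\<in>X. inv_into X h x) y) = \<kappa> y + (- c)" by simp
      then show ?case unfolding inv_BijGroup[OF h(1)] using restrict_inv_into_Bij[OF h(1)] by blast
    next
      case (eng f g)
      then obtain c d where fg: "f \<in> Bij X" "g \<in> Bij X" "\<forall>y\<in>X. \<kappa> (f y) = \<kappa> y + c" "\<forall>y\<in>X. \<kappa> (g y) = \<kappa> y + d"
        by blast
      have "g y \<in> X" if "y \<in> X" for y using Bij_imp_funcset[OF fg(2)] that by auto
      then have "\<forall>y\<in>X. \<kappa> (compose X f g y) = \<kappa> y + (d + c)" using fg by (simp add: compose_def add.assoc)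
      then show ?case using fg compose_Bij[OF fg(1,2)] by (simp add: BijGroup_def)
    qed
  qed
  have comm: "f \<otimes>\<^bsub>?G\<^esub> g = g \<otimes>\<^bsub>?G\<^esub> f" if "f \<in> ?T" "g \<in> ?T" for f g
  proof -
    obtain c d where fg: "f \<in> Bij X" "g \<in> Bij X" "\<forall>y\<in>X. \<kappa> (f y) = \<kappa> y + c" "\<forall>y\<in>X. \<kappa> (g y) = \<kappa> y + d"
      using \<open>f \<in> ?T\<close> \<open>g \<in> ?T\<close> by blast
    have in_X: "f y \<in> X" "g y \<in> X" if "y \<in> X" for y
      using Bij_imp_funcset[OF fg(1)] Bij_imp_funcset[OF fg(2)] that by auto
    have "f (g y) = g (f y)" if "y \<in> X" for y
      using inj_onD[OF inj, of "f (g y)" "g (f y)"] fg in_X that by (simp add: algebra_simps)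
    then have "compose X f g = compose X g f" by (auto simp: compose_def)
    then show ?thesis using fg by (simp add: BijGroup_def)
  qed
  have sub: "subgroup (generate ?G ?S) ?G"
    by (rule G.generate_is_subgroup) (use S in \<open>auto simp: BijGroup_def\<close>)
  then have "group (?G\<lparr>carrier := generate ?G ?S\<rparr>)"
    by (rule subgroup.subgroup_is_group) (rule group_BijGroup)
  moreover have "f \<otimes>\<^bsub>?G\<^esub> g = g \<otimes>\<^bsub>?G\<^esub> f" if "f \<in> generate ?G ?S" "g \<in> generate ?G ?S" for f g
    by (rule comm[OF subsetD[OF H that(1)] subsetD[OF H that(2)]])
  ultimately show ?thesis
    unfolding abelian_reflection_space_def by (intro group.group_comm_groupI) simp_all
qed


section \<open>The fibers as symmetric spaces\<close>

lemma fiber_manifold_simps [simp]: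
  "mtop (fiber_manifold M p) = subtopology (mtop (TT M)) (TT_fiber M p)"
  "smul (fiber_manifold M p) = fiber_scale M"
  "index (fiber_manifold M p) = charts_at M p"
  "cdom (fiber_manifold M p) i = TT_fiber M p"
  "chart (fiber_manifold M p) i = fiber_chart i"
  by (simp_all add: fiber_manifold_def)

context smooth_atlas
begin

lemma points_fiber_manifold: "points (fiber_manifold M p) = TT_fiber M p"
  by (auto simp: TT_fiber_def)

lemma second_tangent_rep_smooth:
  assumes "i \<in> charts_at M p" "j \<in> charts_at M p"
  shows "smooth_on (fiber_scale M) (fiber_scale M) UNIV
    (second_tangent_rep (rep_differential M M id i j p) (rep_second_differential M M id i j p))"
proof -
  let ?s = "smul M" and ?S = "rep_differential M M id i j p" and ?B = "rep_second_differential M M id i j p"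
  have ij: "i \<in> index M" "p \<in> cdom M i" "j \<in> index M" "id p \<in> cdom M j" using assms by auto
  note sm = rep_differential_smooth[OF smooth_atlas_axioms smooth_atlas_axioms smooth_reps_id ij]
  note tms = tm_fiber tm topological_module_prod[OF tm tm]
  have "continuous_linear (fiber_scale M) ?s fst" "continuous_linear (fiber_scale M) ?s (\<lambda>t. fst (snd t))"
    "continuous_linear (fiber_scale M) ?s (\<lambda>t. snd (snd t))"
    by (auto simp: continuous_linear_def fiber_scale_def prod_scale_def intro!: continuous_intros)
  note pr = this[THEN smooth_on_linear[OF tms(1,2) _ open_UNIV]]
  have S: "smooth_on (fiber_scale M) ?s UNIV (\<lambda>t. ?S (l t))" if "smooth_on (fiber_scale M) ?s UNIV l" for l
    by (rule smooth_on_compose[OF tms(1,2,2) that sm(1)]) simp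
  have B: "smooth_on (fiber_scale M) ?s UNIV (\<lambda>t. (\<lambda>(u, v). ?B u v) (fst t, fst (snd t)))"
    by (rule smooth_on_compose[OF tms(1,3,2) smooth_on_Pair[OF pr(1,2)] sm(2)]) simp
  have "smooth_on (fiber_scale M) (prod_scale ?s (prod_scale ?s ?s)) UNIV
      (\<lambda>t. (?S (fst t), ?S (fst (snd t)), ?B (fst t) (fst (snd t)) + ?S (snd (snd t))))"
    using B by (intro smooth_on_Pair smooth_on_add[OF tm] S pr) simp
  then show ?thesis by (simp add: fiber_scale_def second_tangent_rep_def case_prod_unfold)
qed

text \<open>
  The fiber carries the subspace topology of \<open>TTM\<close>. The inverse of a fiber chart is continuous as a map
  into \<open>TTM\<close>, because it is smooth in the charts of \<open>TTM\<close>.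
\<close>

lemma smooth_manifold_fiber:
  assumes p: "p \<in> points M"
  shows "smooth_manifold (fiber_manifold M p)"
  unfolding smooth_manifold_def
proof (intro conjI ballI)
  let ?F = "fiber_manifold M p"
  interpret T: smooth_atlas "TT M" by (rule smooth_atlas_TT)
  show "topological_module (smul ?F)" by (simp add: tm_fiber)
  obtain i0 where "i0 \<in> index M" "p \<in> cdom M i0" using chart_exists[OF p] .
  then show "points ?F = (\<Union>i\<in>index ?F. cdom ?F i)"
    unfolding points_fiber_manifold by auto
  fix i assume "i \<in> index ?F"
  then have i: "i \<in> charts_at M p" by simp
  have img: "fiber_chart i ` TT_fiber M p = UNIV" using fiber_chart_bij[OF i] by (simp add: bij_betw_def)
  show "openin (mtop ?F) (cdom ?F i)"
    using openin_topspace[of "mtop ?F"] by (simp only: points_fiber_manifold fiber_manifold_simps(4))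
  show "open (chart ?F i ` cdom ?F i)" by (simp add: img)
  have sub: "subtopology (mtop ?F) (cdom ?F i) = subtopology (mtop (TT M)) (TT_fiber M p)"
    by (simp add: subtopology_subtopology)
  have "homeomorphic_maps (subtopology (mtop (TT M)) (TT_fiber M p)) euclidean (fiber_chart i) (fiber_point M i p)"
    unfolding homeomorphic_maps_def
  proof (intro conjI ballI)
    have "continuous_map (subtopology (mtop (TT M)) (cdom (TT M) i)) euclidean (\<lambda>z. (snd (fst (chart (TT M) i z)), snd (chart (TT M) i z)))"
    proof -
      have "continuous_map euclidean euclidean (\<lambda>c :: ('v \<times> 'v) \<times> ('v \<times> 'v). (snd (fst c), snd c))"
        by (simp add: continuous_intros)
      from continuous_map_compose[OF T.chart_continuous this] show ?thesis using i by (simp add: comp_def)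
    qed
    then have "continuous_map (subtopology (subtopology (mtop (TT M)) (cdom (TT M) i)) (TT_fiber M p)) euclidean
        (\<lambda>z. (snd (fst (chart (TT M) i z)), snd (chart (TT M) i z)))"
      by (rule continuous_map_from_subtopology)
    moreover have "cdom (TT M) i \<inter> TT_fiber M p = TT_fiber M p"
      using i foot_TT_fiber by (auto simp: cdom_TT)
    ultimately show "continuous_map (subtopology (mtop (TT M)) (TT_fiber M p)) euclidean (fiber_chart i)"
      by (simp add: subtopology_subtopology chart_TT)
    let ?X = "\<lparr>mtop = euclidean, smul = fiber_scale M, index = {i}, cdom = (\<lambda>_. UNIV), chart = (\<lambda>_ t. t)\<rparr>
      :: ('k, 'v \<times> 'v \<times> 'v, 'i, 'v \<times> 'v \<times> 'v) manifold"
    have "smooth_reps ?X (TT M) (fiber_point M i p)"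
    proof -
      have "fiber_point M i p t \<in> points (TT M)" for t using fiber_point(1)[OF i] by (simp add: TT_fiber_def)
      moreover have "smooth_on (smul ?X) (smul (TT M)) (local_dom ?X (TT M) (fiber_point M i p) i j)
          (local_rep ?X (TT M) (fiber_point M i p) i j)" if j: "j \<in> index (TT M)" for j
      proof (rule smooth_on_change_target[where i = i and G = "\<lambda>t. ((chart M i p, fst t), snd t)"])
        show "topological_module (smul ?X)" by (simp add: tm_fiber)
        show "smooth_atlas (TT M)" by (rule smooth_atlas_TT)
        show "i \<in> index (TT M)" "j \<in> index (TT M)" using i j by auto
        have "smooth_on (fiber_scale M) (prod_scale (prod_scale (smul M) (smul M)) (prod_scale (smul M) (smul M))) UNIV
            (\<lambda>t. ((chart M i p, fst t), snd t))"
        proof (intro smooth_on_Pair smooth_on_const tm open_UNIV)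
          show "smooth_on (fiber_scale M) (smul M) UNIV fst" "smooth_on (fiber_scale M) (prod_scale (smul M) (smul M)) UNIV snd"
            unfolding fiber_scale_def
            by (intro smooth_on_linear topological_module_prod tm open_UNIV continuous_linear_fst continuous_linear_snd)+
        qed
        then show "smooth_on (smul ?X) (smul (TT M)) (chart ?X i ` cdom ?X i) (\<lambda>t. ((chart M i p, fst t), snd t))" by simp
        show "inj_on (chart ?X i) (cdom ?X i)" by simp
        fix t
        show "fiber_point M i p t \<in> cdom (TT M) i" "((chart M i p, fst (chart ?X i t)), snd (chart ?X i t)) = chart (TT M) i (fiber_point M i p t)"
          using i fiber_point[OF i, of t] foot_TT_fiber[OF fiber_point(1)[OF i, of t]] by (simp_all add: cdom_TT chart_TT)
      qed
      ultimately show ?thesis by (simp add: smooth_reps_def)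
    qed
    from continuous_map_into_TT[OF _ _ _ _ this] have "continuous_map euclidean (mtop (TT M)) (fiber_point M i p)"
      by (simp add: id_def[symmetric])
    then show "continuous_map euclidean (subtopology (mtop (TT M)) (TT_fiber M p)) (fiber_point M i p)"
      using fiber_point(1)[OF i] by (auto simp: continuous_map_in_subtopology)
  qed (use fiber_point[OF i] fiber_point_chart[OF i] in auto)
  then show "homeomorphic_map (subtopology (mtop ?F) (cdom ?F i)) (top_of_set (chart ?F i ` cdom ?F i)) (chart ?F i)"
    unfolding sub by (auto simp: img homeomorphic_map_maps)
  fix j assume "j \<in> index ?F"
  then have j: "j \<in> charts_at M p" by simp
  have dom: "local_dom ?F ?F id i j = UNIV" by (simp add: local_dom_def img)
  show "smooth_on (smul ?F) (smul ?F) (local_dom ?F ?F id i j) (local_rep ?F ?F id i j)"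
    unfolding dom fiber_manifold_simps
  proof (rule smooth_on_cong[OF second_tangent_rep_smooth[OF i j]])
    fix t
    show "second_tangent_rep (rep_differential M M id i j p) (rep_second_differential M M id i j p) t = local_rep ?F ?F id i j t"
      using fiber_chart_transition[OF i j fiber_point(1)[OF i, of t]] fiber_point(2)[OF i, of t]
      by (simp add: local_rep_def inv_fiber_chart[OF i])
  qed
qed

lemma tangent_uminus_in:
  assumes z: "z \<in> tangent_vectors M"
  shows "tangent_uminus M z \<in> tangent_vectors M"
proof -
  have eq: "fst (tangent_uminus M z) = fst z" "snd (tangent_uminus M z) = (\<lambda>i\<in>charts_at M (fst z). - snd z i)"
    by (simp_all add: tangent_uminus_def case_prod_beta)
  show ?thesis
    unfolding tangent_vectors_iff eq
  proof (intro conjI ballI)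
    show "fst z \<in> points M" by (rule tangent_vectors_point[OF z])
    fix i j assume ij: "i \<in> charts_at M (fst z)" "j \<in> charts_at M (fst z)"
    then have "i \<in> index M" "fst z \<in> cdom M i" "j \<in> index M" "id (fst z) \<in> cdom M j" by auto
    then have neg: "rep_differential M M id i j (fst z) (- u) = - rep_differential M M id i j (fst z) u" for u
      by (rule rep_differential_linear(4)[OF smooth_atlas_axioms smooth_atlas_axioms smooth_reps_id])
    show "(\<lambda>i\<in>charts_at M (fst z). - snd z i) j
        = rep_differential M M id i j (fst z) ((\<lambda>i\<in>charts_at M (fst z). - snd z i) i)"
      using ij neg tangent_vectors_transition[OF z ij] by (simp del: charts_at_iff)
  qed simp
qed

end

context symmetric
begin

lemma TT_product_closed:
  assumes "i \<in> charts_at M p" "z \<in> TT_fiber M p" "z' \<in> TT_fiber M p"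
  shows "TT_product M \<mu> (z, z') \<in> TT_fiber M p"
  using TT_product_fiber(1)[OF assms] by (metis prod_cases3)

text \<open>
  One formula \<open>Q\<close> for \<open>TT\<mu>\<close> in coordinates is used for two targets: for the fiber, where it shows that
  the representatives are smooth, and for \<open>TTM\<close>, where it yields continuity with respect to the
  subspace topology.
\<close>

lemma TT_product_smooth_on_fiber:
  assumes p: "p \<in> points M"
  defines "F \<equiv> fiber_manifold M p"
  shows "smooth_map (prod_manifold F F) F (TT_product M \<mu>)"
proof -
  have F: "smooth_atlas F" unfolding F_def by (intro smooth_manifold_atlas smooth_manifold_fiber p)
  interpret FF: smooth_atlas "prod_manifold F F" by (rule smooth_atlas_prod[OF F F])
  obtain k where "k \<in> index M" "p \<in> cdom M k" using chart_exists[OF p] .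
  then have k: "k \<in> charts_at M p" by simp
  let ?s = "smul M"
  let ?S = "prod_scale (fiber_scale M) (fiber_scale M)"
  have S: "topological_module ?S" by (intro topological_module_prod tm_fiber)
  define Q where "Q i j q = (rep_differential (prod_manifold M M) M \<mu> (i, j) k (p, p) (fst (fst q), fst (snd q)),
      rep_differential (prod_manifold M M) M \<mu> (i, j) k (p, p) (fst (snd (fst q)), fst (snd (snd q))),
      rep_second_differential (prod_manifold M M) M \<mu> (i, j) k (p, p) (fst (fst q), fst (snd q)) (fst (snd (fst q)), fst (snd (snd q)))
        + rep_differential (prod_manifold M M) M \<mu> (i, j) k (p, p) (snd (snd (fst q)), snd (snd (snd q))))" for i j q
  have Qs: "smooth_on ?S (fiber_scale M) UNIV (Q i j)" if ij: "i \<in> charts_at M p" "j \<in> charts_at M p" for i j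
  proof -
    have c: "(i, j) \<in> index (prod_manifold M M)" "(p, p) \<in> cdom (prod_manifold M M) (i, j)" "k \<in> index M" "\<mu> (p, p) \<in> cdom M k"
      using ij k p by auto
    note sm = rep_differential_smooth[OF prod_atlas smooth_atlas_axioms \<mu>_smooth c]
    note tms = tm topological_module_prod[OF tm tm] topological_module_prod[OF topological_module_prod[OF tm tm] topological_module_prod[OF tm tm]]
    have "continuous_linear ?S (prod_scale ?s ?s) (\<lambda>q. (fst (fst q), fst (snd q)))"
      "continuous_linear ?S (prod_scale ?s ?s) (\<lambda>q. (fst (snd (fst q)), fst (snd (snd q))))"
      "continuous_linear ?S (prod_scale ?s ?s) (\<lambda>q. (snd (snd (fst q)), snd (snd (snd q))))"
      by (auto simp: continuous_linear_def fiber_scale_def prod_scale_def intro!: continuous_intros)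
    note pr = this[THEN smooth_on_linear[OF S tms(2) _ open_UNIV]]
    have m: "smooth_on ?S ?s UNIV (\<lambda>q. rep_differential (prod_manifold M M) M \<mu> (i, j) k (p, p) (l q))"
      if "smooth_on ?S (prod_scale ?s ?s) UNIV l" for l
      by (rule smooth_on_compose[OF S tms(2,1) that sm(1)[unfolded prod_manifold_simps]]) simp
    have D: "smooth_on ?S ?s UNIV (\<lambda>q. (\<lambda>(a, b). rep_second_differential (prod_manifold M M) M \<mu> (i, j) k (p, p) a b)
        ((fst (fst q), fst (snd q)), (fst (snd (fst q)), fst (snd (snd q)))))"
      by (rule smooth_on_compose[OF S tms(3,1) smooth_on_Pair[OF pr(1,2)] sm(2)[unfolded prod_manifold_simps]]) simp
    have "smooth_on ?S (prod_scale ?s (prod_scale ?s ?s)) UNIV (Q i j)"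
      unfolding Q_def using D by (intro smooth_on_Pair smooth_on_add[OF tm] m pr) simp
    then show ?thesis by (simp add: fiber_scale_def)
  qed
  have Qc: "Q i j (fiber_chart i z, fiber_chart j z') = fiber_chart k (TT_product M \<mu> (z, z'))"
    if "i \<in> charts_at M p" "j \<in> charts_at M p" "z \<in> TT_fiber M p" "z' \<in> TT_fiber M p" for i j z z'
  proof -
    have kp: "k \<in> charts_at M (\<mu> (p, p))" using k p by simp
    obtain u v w u' v' w' where c: "fiber_chart i z = (u, v, w)" "fiber_chart j z' = (u', v', w')" by (metis prod_cases3)
    show ?thesis
      unfolding TT_product_chart(2)[OF \<mu>_smooth that(3,4,1,2) kp c] by (simp add: Q_def c)
  qed
  have img: "chart (prod_manifold F F) (i, j) ` cdom (prod_manifold F F) (i, j) = UNIV"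
    if "i \<in> charts_at M p" "j \<in> charts_at M p" for i j
    using fiber_chart_bij[OF that(1)] fiber_chart_bij[OF that(2)]
    by (simp add: F_def bij_betw_def map_prod_surj_on[of _ _ UNIV _ _ UNIV, unfolded UNIV_Times_UNIV])
  have points: "TT_product M \<mu> q \<in> TT_fiber M p" if "q \<in> points (prod_manifold F F)" for q
  proof -
    have "fst q \<in> TT_fiber M p" "snd q \<in> TT_fiber M p"
      using that by (auto simp: F_def points_fiber_manifold simp del: fiber_manifold_simps(1))
    from TT_product_closed[OF k this] show ?thesis by simp
  qed
  have target: "smooth_on (smul (prod_manifold F F)) (smul N) (local_dom (prod_manifold F F) N (TT_product M \<mu>) (i, j) l)
      (local_rep (prod_manifold F F) N (TT_product M \<mu>) (i, j) l)"
    if N: "smooth_atlas N" "k \<in> index N" "l \<in> index N" and ij: "i \<in> charts_at M p" "j \<in> charts_at M p"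
      and h: "smooth_on (fiber_scale M) (smul N) UNIV h"
      and NT: "\<And>z. z \<in> TT_fiber M p \<Longrightarrow> z \<in> cdom N k" "\<And>z. z \<in> TT_fiber M p \<Longrightarrow> h (fiber_chart k z) = chart N k z"
    for N :: "('k, ('m, 'i, 'v) second_tangent, 'i, 'y::{ab_group_add,t2_space}) manifold" and h i j l
  proof (rule smooth_on_change_target[where i = k and G = "\<lambda>q. h (Q i j q)"])
    show "topological_module (smul (prod_manifold F F))" using S by (simp add: F_def)
    have "smooth_on ?S (smul N) UNIV (\<lambda>q. h (Q i j q))"
      by (rule smooth_on_compose[OF S tm_fiber smooth_atlas.tm[OF N(1)] Qs[OF ij] h]) simp
    then show "smooth_on (smul (prod_manifold F F)) (smul N) (chart (prod_manifold F F) (i, j) ` cdom (prod_manifold F F) (i, j))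
        (\<lambda>q. h (Q i j q))"
      unfolding img[OF ij] by (simp add: F_def)
    show "inj_on (chart (prod_manifold F F) (i, j)) (cdom (prod_manifold F F) (i, j))"
      using FF.chart_inj[of "(i, j)"] ij by (simp add: F_def)
    fix q assume "q \<in> cdom (prod_manifold F F) (i, j)"
    then obtain z z' where q: "q = (z, z')" "z \<in> TT_fiber M p" "z' \<in> TT_fiber M p" by (auto simp: F_def)
    note c = TT_product_closed[OF k q(2,3)]
    show "TT_product M \<mu> q \<in> cdom N k" using NT(1)[OF c] q(1) by simp
    show "h (Q i j (chart (prod_manifold F F) (i, j) q)) = chart N k (TT_product M \<mu> q)"
      using NT(2)[OF c] Qc[OF ij q(2,3)] q(1) by (simp add: F_def)
  qed (use N in auto)
  have repF: "smooth_reps (prod_manifold F F) F (TT_product M \<mu>)"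
    unfolding smooth_reps_def
  proof (intro conjI ballI)
    show "TT_product M \<mu> q \<in> points F" if "q \<in> points (prod_manifold F F)" for q
      using points[OF that] by (simp only: F_def points_fiber_manifold)
    fix ij l assume "ij \<in> index (prod_manifold F F)" and l: "l \<in> index F"
    then obtain i j where ij: "ij = (i, j)" "i \<in> charts_at M p" "j \<in> charts_at M p" by (auto simp: F_def simp del: charts_at_iff)
    show "smooth_on (smul (prod_manifold F F)) (smul F) (local_dom (prod_manifold F F) F (TT_product M \<mu>) ij l)
        (local_rep (prod_manifold F F) F (TT_product M \<mu>) ij l)"
      unfolding ij(1)
      by (rule target[OF F _ l ij(2,3), of "\<lambda>t. t"])
        (use k smooth_on_id[OF tm_fiber open_UNIV] in \<open>auto simp: F_def\<close>)
  qed
  have repT: "smooth_reps (prod_manifold F F) (TT M) (TT_product M \<mu>)"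
    unfolding smooth_reps_def
  proof (intro conjI ballI)
    show "TT_product M \<mu> q \<in> points (TT M)" if "q \<in> points (prod_manifold F F)" for q
      using points[OF that] by (simp add: TT_fiber_def)
    fix ij l assume "ij \<in> index (prod_manifold F F)" and l: "l \<in> index (TT M)"
    then obtain i j where ij: "ij = (i, j)" "i \<in> charts_at M p" "j \<in> charts_at M p" by (auto simp: F_def simp del: charts_at_iff)
    have "smooth_on (fiber_scale M) (prod_scale (prod_scale ?s ?s) (prod_scale ?s ?s)) UNIV (\<lambda>t. ((chart M k p, fst t), snd t))"
    proof (intro smooth_on_Pair smooth_on_const tm open_UNIV)
      show "smooth_on (fiber_scale M) ?s UNIV fst" "smooth_on (fiber_scale M) (prod_scale ?s ?s) UNIV snd"
        unfolding fiber_scale_def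
        by (intro smooth_on_linear topological_module_prod tm open_UNIV continuous_linear_fst continuous_linear_snd)+
    qed
    then show "smooth_on (smul (prod_manifold F F)) (smul (TT M)) (local_dom (prod_manifold F F) (TT M) (TT_product M \<mu>) ij l)
        (local_rep (prod_manifold F F) (TT M) (TT_product M \<mu>) ij l)"
      unfolding ij(1)
      by (intro target[OF smooth_atlas_TT _ l ij(2,3), of "\<lambda>t. ((chart M k p, fst t), snd t)"])
        (use k in \<open>auto simp: cdom_TT chart_TT foot_TT_fiber\<close>)
  qed
  have "continuous_map (mtop (prod_manifold F F)) (mtop (TT M)) (TT_product M \<mu>)"
    by (rule continuous_map_into_TT[OF FF.points_eq FF.chart_inj FF.cdom_open FF.chart_continuous repT])
  then have "continuous_map (mtop (prod_manifold F F)) (mtop F) (TT_product M \<mu>)"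
    using points by (auto simp: F_def continuous_map_in_subtopology simp del: prod_manifold_simps(1))
  then show ?thesis using repF by (simp add: smooth_map_def smooth_reps_def)
qed

text \<open>
  In the coordinates of the fiber, the symmetry at \<open>z = (u, v, w)\<close> maps \<open>z + r t\<close> to
  \<open>z + r (-t + (0, 0, r A(t\<^sub>1, t\<^sub>2)))\<close>, so the second order term does not contribute to the differential.
\<close>

lemma fiber_symmetry_differential:
  assumes p: "p \<in> points M"
  defines "F \<equiv> fiber_manifold M p"
  assumes u: "a \<in> tangent_vectors F" "fst a = z"
  shows "tangent_map F F (\<lambda>y. TT_product M \<mu> (z, y)) a = tangent_uminus F a"
proof -
  interpret F: smooth_atlas F unfolding F_def by (intro smooth_manifold_atlas smooth_manifold_fiber p)
  have z: "z \<in> TT_fiber M p"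
    using tangent_vectors_point[OF u(1)] u(2) by (simp only: F_def points_fiber_manifold)
  obtain i where "i \<in> index M" "p \<in> cdom M i" using chart_exists[OF p] .
  then have i: "i \<in> charts_at M p" by simp
  then have iF: "i \<in> index F" "z \<in> cdom F i" using z by (simp_all add: F_def)
  let ?\<sigma> = "\<lambda>y. TT_product M \<mu> (z, y)"
  have zz: "?\<sigma> z = z"
    by (rule straight_chart_inj[OF i TT_product_closed[OF i z z] z, where b = "canonical_form i p"])
      (simp add: straight_TT_product[OF i z z])
  have pF: "z \<in> points F" using z by (simp only: F_def points_fiber_manifold)
  have \<sigma>: "smooth_reps F F ?\<sigma>"
    by (rule F.section_smooth[OF smooth_map_reps[OF TT_product_smooth_on_fiber[OF p, folded F_def]] pF])
  obtain u v w where c: "fiber_chart i z = (u, v, w)" by (metis prod_cases3)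
  have dom: "local_dom F F ?\<sigma> i i = UNIV"
  proof -
    have "TT_fiber M p \<inter> ?\<sigma> -` TT_fiber M p = TT_fiber M p" using TT_product_closed[OF i z] by auto
    then show ?thesis using fiber_chart_bij[OF i] by (simp add: local_dom_def F_def bij_betw_def)
  qed
  have rep: "local_rep F F ?\<sigma> i i (u', v', w')
      = (u + u - u', v + v - v', w + w - w' + sym_form i p (u - u') (v - v'))" for u' v' w'
    using TT_product_fiber(2)[OF i z fiber_point(1)[OF i] c fiber_point(2)[OF i]]
    by (simp add: local_rep_def F_def inv_fiber_chart[OF i])
  have "rep_differential F F ?\<sigma> i i z t = - t" for t
  proof -
    obtain t1 t2 t3 where t: "t = (t1, t2, t3)" by (cases t)
    have sm: "smooth_on (fiber_scale M) (fiber_scale M) UNIV (local_rep F F ?\<sigma> i i)"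
      using smooth_reps_smooth_on[OF \<sigma> iF(1) iF(1)] by (simp add: dom) (simp add: F_def)
    \<comment> \<open>the increment in the direction \<open>r t\<close> has the second order term \<open>r\<^sup>2 A(t1, t2)\<close>, divided once by \<open>r\<close>\<close>
    have "differential (fiber_scale M) (fiber_scale M) UNIV (local_rep F F ?\<sigma> i i) (u, v, w) t
        = (\<lambda>r. (- t1, - t2, - t3 + smul M r (sym_form i p t1 t2))) 0"
    proof (rule differential_eqI[OF tm_fiber tm_fiber sm UNIV_I open_UNIV UNIV_I])
      show "continuous_on UNIV (\<lambda>r. (- t1, - t2, - t3 + smul M r (sym_form i p t1 t2)))"
        by (intro continuous_on_Pair V.cont_add V.cont_scale continuous_on_const continuous_on_id)
      fix r
      have "sym_form i p (- smul M r t1) (- smul M r t2) = smul M r (smul M r (sym_form i p t1 t2))"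
        by (simp only: sym_form_bilinear[OF i] minus_minus)
      then show "local_rep F F ?\<sigma> i i ((u, v, w) + fiber_scale M r t) - local_rep F F ?\<sigma> i i (u, v, w)
          = fiber_scale M r (- t1, - t2, - t3 + smul M r (sym_form i p t1 t2))"
        using sym_form_bilinear(3)[OF i, of 0 0 0]
        by (simp add: t rep V.scale_right_distrib V.scale_right_diff_distrib)
    qed
    then show ?thesis using t c by (simp add: rep_differential_def dom) (simp add: F_def t)
  qed
  note d = this
  have T: "tangent_map F F ?\<sigma> a \<in> tangent_vectors F"
    by (rule tangent_map_in[OF F.smooth_atlas_axioms F.smooth_atlas_axioms \<sigma> u(1)])
  have Teq: "tangent_map F F ?\<sigma> a = (z, \<lambda>j\<in>charts_at F z. rep_differential F F ?\<sigma> i j z (snd a i))"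
    using tangent_map_eq[OF F.smooth_atlas_axioms F.smooth_atlas_axioms \<sigma> u(1), of i] iF u(2) zz by simp
  show ?thesis
    by (rule F.tangent_vectors_eqI[OF T F.tangent_uminus_in[OF u(1)], of i])
      (use Teq u(2) iF d in \<open>auto simp: tangent_uminus_def case_prod_beta\<close>)
qed

lemma fiber_symmetric_space:
  assumes p: "p \<in> points M"
  shows "symmetric_space (fiber_manifold M p) (TT_product M \<mu>)"
    and "abelian_reflection_space (TT_fiber M p) (TT_product M \<mu>)"
proof -
  obtain i where "i \<in> index M" "p \<in> cdom M i" using chart_exists[OF p] .
  then have i: "i \<in> charts_at M p" by simp
  let ?\<kappa> = "straight_chart (canonical_form i p) i"
  note closed = TT_product_closed[OF i] and flat = straight_TT_product[OF i]
  note eq = straight_chart_inj[OF i, where b = "canonical_form i p"]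
  show "abelian_reflection_space (TT_fiber M p) (TT_product M \<mu>)"
    by (rule abelian_reflection_spaceI[where \<kappa> = ?\<kappa>]) (auto intro: inj_onI eq closed flat)
  have two: "(2::'k) dvd 1" using symmetric_space by (simp add: symmetric_space_def)
  show "symmetric_space (fiber_manifold M p) (TT_product M \<mu>)"
    unfolding symmetric_space_def points_fiber_manifold
  proof (intro conjI ballI impI)
    show "(2::'k) dvd 1" by (rule two)
    show "smooth_manifold (fiber_manifold M p)" by (rule smooth_manifold_fiber[OF p])
    show "smooth_map (prod_manifold (fiber_manifold M p) (fiber_manifold M p)) (fiber_manifold M p) (TT_product M \<mu>)"
      by (rule TT_product_smooth_on_fiber[OF p])
    fix x assume x: "x \<in> TT_fiber M p"
    show "TT_product M \<mu> (x, x) = x" by (rule eq[OF closed[OF x x] x]) (simp add: flat x)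
    {
      fix y assume y: "y \<in> TT_fiber M p"
      note xy = closed[OF x y]
      show "TT_product M \<mu> (x, TT_product M \<mu> (x, y)) = y"
        by (rule eq[OF closed[OF x xy] y]) (simp add: flat x y xy)
      fix z assume z: "z \<in> TT_fiber M p"
      note xz = closed[OF x z] and yz = closed[OF y z]
      show "TT_product M \<mu> (x, TT_product M \<mu> (y, z)) = TT_product M \<mu> (TT_product M \<mu> (x, y), TT_product M \<mu> (x, z))"
        by (rule eq[OF closed[OF x yz] closed[OF xy xz]]) (simp add: flat x y z xy xz yz algebra_simps)
    next
      fix a assume "a \<in> tangent_vectors (fiber_manifold M p)" "fst a = x"
      then show "tangent_map (fiber_manifold M p) (fiber_manifold M p) (\<lambda>y. TT_product M \<mu> (x, y)) a
          = tangent_uminus (fiber_manifold M p) a"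
        by (rule fiber_symmetry_differential[OF p])
    }
  qed
qed

end


section \<open>The invariant connection\<close>

theorem theorem26p3:
  fixes M :: "('k::dense_unit_ring, 'm, 'i, 'v::{ab_group_add,t2_space}) manifold"
    and \<mu> :: "'m \<times> 'm \<Rightarrow> 'm"
  assumes "symmetric_space M \<mu>"
  shows "(\<exists>L. linear_connection M L \<and>
            invariant_under_symmetries M \<mu> L \<and> flat_on_fibers M \<mu> L \<and>
            (\<forall>L'. linear_connection M L' \<longrightarrow>
              (invariant_under_symmetries M \<mu> L' \<longleftrightarrow> flat_on_fibers M \<mu> L') \<and>
              (invariant_under_symmetries M \<mu> L' \<longrightarrow> same_connection M L L') \<and>
              (flat_on_fibers M \<mu> L' \<longrightarrow> same_connection M L L')) \<and>
            (\<forall>i\<in>index M. \<forall>p\<in>cdom M i. \<forall>u v. torsion M L i p u v = 0))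
       \<and> (\<forall>x\<in>points M. symmetric_space (fiber_manifold M x) (TT_product M \<mu>) \<and>
            abelian_reflection_space (TT_fiber M x) (TT_product M \<mu>))"
proof -
  interpret symmetric M \<mu> by standard (rule assms)
  let ?L = canonical_connection
  have L: "linear_connection M ?L" "has_canonical_forms ?L"
    by (rule canonical_connection_linear canonical_connection_forms)+
  have inv: "invariant_under_symmetries M \<mu> L' \<longleftrightarrow> has_canonical_forms L'"
    and flat: "flat_on_fibers M \<mu> L' \<longleftrightarrow> has_canonical_forms L'" if "linear_connection M L'" for L'
    using that invariant_imp_canonical_forms flat_imp_canonical_forms canonical_forms_imp_invariant
      canonical_forms_imp_flat by blast+
  have "torsion M ?L i p u v = 0" if "i \<in> index M" "p \<in> cdom M i" for i p u v
    using canonical_torsion[OF L(2), of i p] that by simp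
  then show ?thesis
    using L inv flat canonical_forms_unique fiber_symmetric_space
    by (intro conjI exI[of _ ?L]) blast+
qed

end
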